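(* Let $(C,\nabla,g,\xi)$ be an $(n+1)$-dimensional radiant Hessian manifold with $\xi=\lambda\rho$, where $\rho$ is a radiant vector field and $\lambda\ne 0,2$ is a constant, and let $p\in C$. (i) If $\xi_p=0$, then there exists a flat local coordinate system $(x^1,\ldots,x^{n+1})$ on a neighbourhood of $p$ such that $$g=\sum_{i=1}^{n+1}(dx^i)^2\quad\text{and}\quad \xi=\sum_{i=1}^{n+1}x^i\frac{\partial}{\partial x^i}.$$ (ii) If $\xi_p\neq 0$, then there exists a flat local coordinate system $(x^1,\ldots,x^{n+1})$ on a neighbourhood of $p$ such that $$x^{n+1}>0,\qquad \xi=\lambda\sum_{i=1}^{n+1}x^i\frac{\partial}{\partial x^i}\qquad\text{and}\qquad g=\mathrm{Hess}\left((x^{n+1})^{2\lambda^{-1}}\psi\right),$$ where $\psi$ is a function constant along the radiant vector field $\sum_{i=1}^{n+1} x^i\frac{\partial}{\partial x^i}$ such that $$(4\lambda^{-2}-2\lambda^{-1})\psi>0,$$ $$X^2\psi>\max\left((2-4\lambda^{-1})X(\psi)-(4\lambda^{-2}-2\lambda^{-1})\psi,\ 0\right)$$ for any nonzero flat vector field $X=\sum_{i=1}^n b_i\frac{\partial}{\partial x^i}$, $b_i\in\mathbb{R}$.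
   Context: A flat affine manifold $(C,\nabla)$ is a manifold with a flat torsion-free connection $\nabla$; flat (affine) coordinates are local coordinates whose coordinate vector fields are $\nabla$-parallel. A Hessian manifold $(C,\nabla,g)$ is a flat affine manifold with a Riemannian metric $g$ that is locally $\mathrm{Hess}\,\varphi=\nabla d\varphi$ for a function $\varphi$. A selfsimilar Hessian manifold $(C,\nabla,g,\xi)$ is a Hessian manifold endowed with a vector field $\xi$ such that $\mathcal{L}_\xi g=2g$ and the flow of $\xi$ preserves $\nabla$. A radiant vector field is a vector field $\rho$ with $\nabla\rho=\mathrm{Id}$. A selfsimilar Hessian manifold is radiant if $\xi=\lambda\rho$ for some radiant vector field $\rho$ on $C$ and some constant $\lambda\neq0,2$. *)

theory Defs
  imports "HOL-Analysis.Analysis"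
begin

section \<open>Smooth maps between Euclidean spaces\<close>

text \<open>Continuous differentiability on an open set, by iterated directional derivatives. This is
  the usual notion when the source is finite-dimensional, the only case used here.\<close>

primrec Ck_on :: "nat \<Rightarrow> ('e::euclidean_space \<Rightarrow> 'f::real_normed_vector) \<Rightarrow> 'e set \<Rightarrow> bool" where
  "Ck_on 0 f S \<longleftrightarrow> continuous_on S f"
| "Ck_on (Suc k) f S \<longleftrightarrow>
     (\<forall>x\<in>S. f differentiable (at x)) \<and> (\<forall>v. Ck_on k (\<lambda>x. frechet_derivative f (at x) v) S)"

definition smooth_on :: "'e::euclidean_space set \<Rightarrow> ('e \<Rightarrow> 'f::real_normed_vector) \<Rightarrow> bool" where
  "smooth_on S f \<longleftrightarrow> (\<forall>k. Ck_on k f S)"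


section \<open>Smooth manifolds\<close>

text \<open>A chart is a pair of its domain and its coordinate map; the coordinates of a point are
  indexed by the finite type \<open>'m\<close>, so that the dimension is \<open>CARD('m)\<close>. Values of the coordinate
  map outside the domain are irrelevant.\<close>

type_synonym ('a, 'm) chart = "'a set \<times> ('a \<Rightarrow> real ^ 'm)"

record ('a, 'm) manifold =
  mtop :: "'a topology"
  atlas :: "('a, 'm) chart set"

abbreviation points :: "('a, 'm::finite) manifold \<Rightarrow> 'a set" where
  "points M \<equiv> topspace (mtop M)"

definition chart_inv :: "('a, 'm::finite) chart \<Rightarrow> real ^ 'm \<Rightarrow> 'a" where
  "chart_inv c = inv_into (fst c) (snd c)"

definition is_chart :: "'a topology \<Rightarrow> ('a, 'm::finite) chart \<Rightarrow> bool" where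
  "is_chart T c \<longleftrightarrow> openin T (fst c) \<and> open (snd c ` fst c) \<and>
     homeomorphic_map (subtopology T (fst c)) (top_of_set (snd c ` fst c)) (snd c)"

definition compatible_charts :: "('a, 'm::finite) chart \<Rightarrow> ('a, 'm) chart \<Rightarrow> bool" where
  "compatible_charts c d \<longleftrightarrow>
     smooth_on (snd c ` (fst c \<inter> fst d)) (snd d \<circ> chart_inv c) \<and>
     smooth_on (snd d ` (fst c \<inter> fst d)) (snd c \<circ> chart_inv d)"

definition smooth_manifold :: "('a, 'm::finite) manifold \<Rightarrow> bool" where
  "smooth_manifold M \<longleftrightarrow>
     Hausdorff_space (mtop M) \<and> second_countable (mtop M) \<and>
     (\<Union>c\<in>atlas M. fst c) = points M \<and>
     (\<forall>c\<in>atlas M. is_chart (mtop M) c) \<and>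
     (\<forall>c\<in>atlas M. \<forall>d\<in>atlas M. compatible_charts c d)"

text \<open>The charts of the maximal atlas.\<close>

definition local_coordinates :: "('a, 'm::finite) manifold \<Rightarrow> ('a, 'm) chart \<Rightarrow> bool" where
  "local_coordinates M c \<longleftrightarrow> is_chart (mtop M) c \<and> (\<forall>d\<in>atlas M. compatible_charts c d)"

definition coord :: "('a, 'm::finite) chart \<Rightarrow> 'm \<Rightarrow> 'a \<Rightarrow> real" where
  "coord c i q = snd c q $ i"

definition smooth_fun :: "('a, 'm::finite) manifold \<Rightarrow> 'a set \<Rightarrow> ('a \<Rightarrow> real) \<Rightarrow> bool" where
  "smooth_fun M U f \<longleftrightarrow> openin (mtop M) U \<and>
     (\<forall>c\<in>atlas M. smooth_on (snd c ` (fst c \<inter> U)) (f \<circ> chart_inv c))"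

definition smooth_at :: "('a, 'm::finite) manifold \<Rightarrow> 'a \<Rightarrow> ('a \<Rightarrow> real) \<Rightarrow> bool" where
  "smooth_at M q f \<longleftrightarrow> (\<exists>U. q \<in> U \<and> smooth_fun M U f)"


section \<open>Tangent vectors and vector fields\<close>

text \<open>A tangent vector at \<open>q\<close> is the directional derivative operator it induces on the functions
  that are smooth near \<open>q\<close>. So that equal tangent vectors are equal as HOL functions, the operator
  is set to 0 on all other functions.\<close>

type_synonym 'a tvec = "('a \<Rightarrow> real) \<Rightarrow> real"
type_synonym 'a vfield = "'a \<Rightarrow> 'a tvec"

definition zero_tvec :: "'a tvec" where
  "zero_tvec = (\<lambda>f. 0)"

definition coord_vec :: "('a, 'm::finite) manifold \<Rightarrow> ('a, 'm) chart \<Rightarrow> real ^ 'm \<Rightarrow> 'a vfield" where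
  "coord_vec M c a q = (\<lambda>f. if smooth_at M q f
     then frechet_derivative (f \<circ> chart_inv c) (at (snd c q)) a else 0)"

text \<open>The coordinate vector field \<open>\<partial>/\<partial>x\<^sup>i\<close> of the chart \<open>c\<close>.\<close>

definition coord_field :: "('a, 'm::finite) manifold \<Rightarrow> ('a, 'm) chart \<Rightarrow> 'm \<Rightarrow> 'a vfield" where
  "coord_field M c i = coord_vec M c (axis i 1)"

definition tangent_space :: "('a, 'm::finite) manifold \<Rightarrow> 'a \<Rightarrow> 'a tvec set" where
  "tangent_space M q = {v. \<exists>c\<in>atlas M. q \<in> fst c \<and> (\<exists>a. v = coord_vec M c a q)}"

definition smooth_vf :: "('a, 'm::finite) manifold \<Rightarrow> 'a set \<Rightarrow> 'a vfield \<Rightarrow> bool" where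
  "smooth_vf M U X \<longleftrightarrow> openin (mtop M) U \<and> (\<forall>q\<in>U. X q \<in> tangent_space M q) \<and>
     (\<forall>V f. V \<subseteq> U \<longrightarrow> smooth_fun M V f \<longrightarrow> smooth_fun M V (\<lambda>q. X q f))"

definition lie_bracket :: "('a, 'm::finite) manifold \<Rightarrow> 'a vfield \<Rightarrow> 'a vfield \<Rightarrow> 'a vfield" where
  "lie_bracket M X Y q = (\<lambda>f. if smooth_at M q f
     then X q (\<lambda>r. Y r f) - Y q (\<lambda>r. X r f) else 0)"

definition tangent_map ::
    "('a, 'm::finite) manifold \<Rightarrow> ('a \<Rightarrow> 'a) \<Rightarrow> 'a \<Rightarrow> 'a tvec \<Rightarrow> 'a tvec" where
  "tangent_map M F q v = (\<lambda>f. if smooth_at M (F q) f then v (f \<circ> F) else 0)"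

definition pushforward ::
    "('a, 'm::finite) manifold \<Rightarrow> ('a \<Rightarrow> 'a) \<Rightarrow> 'a set \<Rightarrow> 'a vfield \<Rightarrow> 'a vfield" where
  "pushforward M F V X q = tangent_map M F (inv_into V F q) (X (inv_into V F q))"


section \<open>Affine connections\<close>

text \<open>A connection assigns to vector fields \<open>X\<close>, \<open>Y\<close> on an open set \<open>U\<close> a vector field
  \<open>nabla X Y\<close> on \<open>U\<close>. Vector fields being total HOL functions, the second clause says that the
  result on \<open>U\<close> only depends on the values of the arguments on \<open>U\<close> (compatibility with
  restriction).\<close>

definition affine_connection ::
    "('a, 'm::finite) manifold \<Rightarrow> ('a vfield \<Rightarrow> 'a vfield \<Rightarrow> 'a vfield) \<Rightarrow> bool" where
  "affine_connection M nabla \<longleftrightarrow>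
     (\<forall>U X Y. smooth_vf M U X \<longrightarrow> smooth_vf M U Y \<longrightarrow> smooth_vf M U (nabla X Y)) \<and>
     (\<forall>U X X' Y Y'. smooth_vf M U X \<longrightarrow> smooth_vf M U X' \<longrightarrow>
        smooth_vf M U Y \<longrightarrow> smooth_vf M U Y' \<longrightarrow>
        (\<forall>q\<in>U. X q = X' q \<and> Y q = Y' q) \<longrightarrow> (\<forall>q\<in>U. nabla X Y q = nabla X' Y' q)) \<and>
     (\<forall>U X X' Y. smooth_vf M U X \<longrightarrow> smooth_vf M U X' \<longrightarrow> smooth_vf M U Y \<longrightarrow>
        (\<forall>q\<in>U. nabla (\<lambda>r f. X r f + X' r f) Y q = (\<lambda>f. nabla X Y q f + nabla X' Y q f))) \<and>
     (\<forall>U h X Y. smooth_fun M U h \<longrightarrow> smooth_vf M U X \<longrightarrow> smooth_vf M U Y \<longrightarrow>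
        (\<forall>q\<in>U. nabla (\<lambda>r f. h r * X r f) Y q = (\<lambda>f. h q * nabla X Y q f))) \<and>
     (\<forall>U X Y Y'. smooth_vf M U X \<longrightarrow> smooth_vf M U Y \<longrightarrow> smooth_vf M U Y' \<longrightarrow>
        (\<forall>q\<in>U. nabla X (\<lambda>r f. Y r f + Y' r f) q = (\<lambda>f. nabla X Y q f + nabla X Y' q f))) \<and>
     (\<forall>U h X Y. smooth_fun M U h \<longrightarrow> smooth_vf M U X \<longrightarrow> smooth_vf M U Y \<longrightarrow>
        (\<forall>q\<in>U. nabla X (\<lambda>r f. h r * Y r f) q = (\<lambda>f. X q h * Y q f + h q * nabla X Y q f)))"

definition torsion_free ::
    "('a, 'm::finite) manifold \<Rightarrow> ('a vfield \<Rightarrow> 'a vfield \<Rightarrow> 'a vfield) \<Rightarrow> bool" where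
  "torsion_free M nabla \<longleftrightarrow> (\<forall>U X Y. smooth_vf M U X \<longrightarrow> smooth_vf M U Y \<longrightarrow>
     (\<forall>q\<in>U. (\<lambda>f. nabla X Y q f - nabla Y X q f) = lie_bracket M X Y q))"

definition flat_connection ::
    "('a, 'm::finite) manifold \<Rightarrow> ('a vfield \<Rightarrow> 'a vfield \<Rightarrow> 'a vfield) \<Rightarrow> bool" where
  "flat_connection M nabla \<longleftrightarrow>
     (\<forall>U X Y Z. smooth_vf M U X \<longrightarrow> smooth_vf M U Y \<longrightarrow> smooth_vf M U Z \<longrightarrow>
       (\<forall>q\<in>U. (\<lambda>f. nabla X (nabla Y Z) q f - nabla Y (nabla X Z) q f
                     - nabla (lie_bracket M X Y) Z q f) = zero_tvec))"

definition flat_affine_manifold ::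
    "('a, 'm::finite) manifold \<Rightarrow> ('a vfield \<Rightarrow> 'a vfield \<Rightarrow> 'a vfield) \<Rightarrow> bool" where
  "flat_affine_manifold M nabla \<longleftrightarrow> smooth_manifold M \<and> affine_connection M nabla \<and>
     torsion_free M nabla \<and> flat_connection M nabla"

definition parallel_vf ::
    "('a, 'm::finite) manifold \<Rightarrow> ('a vfield \<Rightarrow> 'a vfield \<Rightarrow> 'a vfield) \<Rightarrow> 'a set \<Rightarrow> 'a vfield \<Rightarrow> bool"
  where
  "parallel_vf M nabla U Y \<longleftrightarrow> smooth_vf M U Y \<and>
     (\<forall>V X. V \<subseteq> U \<longrightarrow> smooth_vf M V X \<longrightarrow> (\<forall>q\<in>V. nabla X Y q = zero_tvec))"

definition flat_coordinates ::
    "('a, 'm::finite) manifold \<Rightarrow> ('a vfield \<Rightarrow> 'a vfield \<Rightarrow> 'a vfield) \<Rightarrow> ('a, 'm) chart \<Rightarrow> bool" where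
  "flat_coordinates M nabla c \<longleftrightarrow> local_coordinates M c \<and>
     (\<forall>i. parallel_vf M nabla (fst c) (coord_field M c i))"

definition radiant_vf ::
    "('a, 'm::finite) manifold \<Rightarrow> ('a vfield \<Rightarrow> 'a vfield \<Rightarrow> 'a vfield) \<Rightarrow> 'a vfield \<Rightarrow> bool" where
  "radiant_vf M nabla \<rho> \<longleftrightarrow> smooth_vf M (points M) \<rho> \<and>
     (\<forall>U X. smooth_vf M U X \<longrightarrow> (\<forall>q\<in>U. nabla X \<rho> q = X q))"


section \<open>Hessian manifolds\<close>

definition differential :: "('a \<Rightarrow> real) \<Rightarrow> 'a \<Rightarrow> 'a tvec \<Rightarrow> real" where
  "differential f q v = v f"

text \<open>\<open>(\<nabla>\<^sub>X \<alpha>)(Y) = X (\<alpha>(Y)) - \<alpha>(\<nabla>\<^sub>X Y)\<close> for a 1-form \<open>\<alpha>\<close>.\<close>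

definition nabla_form ::
    "('a vfield \<Rightarrow> 'a vfield \<Rightarrow> 'a vfield) \<Rightarrow> ('a \<Rightarrow> 'a tvec \<Rightarrow> real) \<Rightarrow> 'a vfield \<Rightarrow> 'a vfield \<Rightarrow> 'a \<Rightarrow> real"
  where
  "nabla_form nabla \<alpha> X Y q = X q (\<lambda>r. \<alpha> r (Y r)) - \<alpha> q (nabla X Y q)"

definition Hess ::
    "('a vfield \<Rightarrow> 'a vfield \<Rightarrow> 'a vfield) \<Rightarrow> ('a \<Rightarrow> real) \<Rightarrow> 'a vfield \<Rightarrow> 'a vfield \<Rightarrow> 'a \<Rightarrow> real" where
  "Hess nabla \<phi> = nabla_form nabla (differential \<phi>)"

definition riemannian_metric ::
    "('a, 'm::finite) manifold \<Rightarrow> ('a \<Rightarrow> 'a tvec \<Rightarrow> 'a tvec \<Rightarrow> real) \<Rightarrow> bool" where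
  "riemannian_metric M g \<longleftrightarrow>
     (\<forall>q\<in>points M. \<forall>u\<in>tangent_space M q. \<forall>v\<in>tangent_space M q. \<forall>w\<in>tangent_space M q. \<forall>a b.
        g q (\<lambda>f. a * u f + b * v f) w = a * g q u w + b * g q v w) \<and>
     (\<forall>q\<in>points M. \<forall>u\<in>tangent_space M q. \<forall>v\<in>tangent_space M q. g q u v = g q v u) \<and>
     (\<forall>q\<in>points M. \<forall>u\<in>tangent_space M q. u \<noteq> zero_tvec \<longrightarrow> g q u u > 0) \<and>
     (\<forall>U X Y. smooth_vf M U X \<longrightarrow> smooth_vf M U Y \<longrightarrow> smooth_fun M U (\<lambda>q. g q (X q) (Y q)))"

text \<open>\<open>g = Hess \<phi>\<close> on the open set \<open>U\<close>.\<close>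

definition is_Hess_on ::
    "('a, 'm::finite) manifold \<Rightarrow> ('a vfield \<Rightarrow> 'a vfield \<Rightarrow> 'a vfield) \<Rightarrow> 'a set \<Rightarrow>
     ('a \<Rightarrow> 'a tvec \<Rightarrow> 'a tvec \<Rightarrow> real) \<Rightarrow> ('a \<Rightarrow> real) \<Rightarrow> bool" where
  "is_Hess_on M nabla U g \<phi> \<longleftrightarrow> smooth_fun M U \<phi> \<and>
     (\<forall>V X Y. V \<subseteq> U \<longrightarrow> smooth_vf M V X \<longrightarrow> smooth_vf M V Y \<longrightarrow>
        (\<forall>q\<in>V. g q (X q) (Y q) = Hess nabla \<phi> X Y q))"

definition Hessian_manifold ::
    "('a, 'm::finite) manifold \<Rightarrow> ('a vfield \<Rightarrow> 'a vfield \<Rightarrow> 'a vfield) \<Rightarrow>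
     ('a \<Rightarrow> 'a tvec \<Rightarrow> 'a tvec \<Rightarrow> real) \<Rightarrow> bool" where
  "Hessian_manifold M nabla g \<longleftrightarrow> flat_affine_manifold M nabla \<and> riemannian_metric M g \<and>
     (\<forall>q\<in>points M. \<exists>U \<phi>. q \<in> U \<and> is_Hess_on M nabla U g \<phi>)"


section \<open>Selfsimilar Hessian manifolds\<close>

definition lie_deriv_metric ::
    "('a, 'm::finite) manifold \<Rightarrow> 'a vfield \<Rightarrow> ('a \<Rightarrow> 'a tvec \<Rightarrow> 'a tvec \<Rightarrow> real) \<Rightarrow>
     'a vfield \<Rightarrow> 'a vfield \<Rightarrow> 'a \<Rightarrow> real" where
  "lie_deriv_metric M \<xi> g X Y q = \<xi> q (\<lambda>r. g r (X r) (Y r))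
     - g q (lie_bracket M \<xi> X q) (Y q) - g q (X q) (lie_bracket M \<xi> Y q)"

text \<open>The local flow of \<open>\<xi>\<close>, defined on \<open>U\<close> for times \<open>\<bar>t\<bar> < e\<close>: each \<open>t \<mapsto> \<Phi> t q\<close> is an integral curve
  of \<open>\<xi>\<close> starting at \<open>q\<close>. Continuity of the integral curves is implied, since \<open>f\<close> ranges over total
  functions that are arbitrary away from \<open>\<Phi> t q\<close>; smoothness of the flow then holds by uniqueness.\<close>

definition local_flow ::
    "('a, 'm::finite) manifold \<Rightarrow> 'a vfield \<Rightarrow> 'a set \<Rightarrow> real \<Rightarrow> (real \<Rightarrow> 'a \<Rightarrow> 'a) \<Rightarrow> bool" where
  "local_flow M \<xi> U e \<Phi> \<longleftrightarrow> openin (mtop M) U \<and> e > 0 \<and>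
     (\<forall>q\<in>U. \<Phi> 0 q = q \<and>
        (\<forall>t. \<bar>t\<bar> < e \<longrightarrow> \<Phi> t q \<in> points M \<and>
           (\<forall>f. smooth_at M (\<Phi> t q) f \<longrightarrow>
              ((\<lambda>s. f (\<Phi> s q)) has_real_derivative \<xi> (\<Phi> t q) f) (at t))))"

text \<open>\<open>\<Phi>\<^sub>t\<^sub>*(\<nabla>\<^sub>X Y) = \<nabla>\<^bsub>\<Phi>\<^sub>t\<^sub>*X\<^esub> \<Phi>\<^sub>t\<^sub>*Y\<close> for every local flow \<open>\<Phi>\<close> of \<open>\<xi>\<close>.\<close>

definition flow_preserves_connection ::
    "('a, 'm::finite) manifold \<Rightarrow> 'a vfield \<Rightarrow> ('a vfield \<Rightarrow> 'a vfield \<Rightarrow> 'a vfield) \<Rightarrow> bool" where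
  "flow_preserves_connection M \<xi> nabla \<longleftrightarrow>
     (\<forall>U e \<Phi>. local_flow M \<xi> U e \<Phi> \<longrightarrow>
        (\<forall>t V X Y. \<bar>t\<bar> < e \<longrightarrow> V \<subseteq> U \<longrightarrow> smooth_vf M V X \<longrightarrow> smooth_vf M V Y \<longrightarrow>
           (\<forall>q\<in>V. tangent_map M (\<Phi> t) q (nabla X Y q) =
              nabla (pushforward M (\<Phi> t) V X) (pushforward M (\<Phi> t) V Y) (\<Phi> t q))))"

definition selfsimilar_Hessian_manifold ::
    "('a, 'm::finite) manifold \<Rightarrow> ('a vfield \<Rightarrow> 'a vfield \<Rightarrow> 'a vfield) \<Rightarrow>
     ('a \<Rightarrow> 'a tvec \<Rightarrow> 'a tvec \<Rightarrow> real) \<Rightarrow> 'a vfield \<Rightarrow> bool" where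
  "selfsimilar_Hessian_manifold M nabla g \<xi> \<longleftrightarrow>
     Hessian_manifold M nabla g \<and> smooth_vf M (points M) \<xi> \<and>
     (\<forall>U X Y. smooth_vf M U X \<longrightarrow> smooth_vf M U Y \<longrightarrow>
        (\<forall>q\<in>U. lie_deriv_metric M \<xi> g X Y q = 2 * g q (X q) (Y q))) \<and>
     flow_preserves_connection M \<xi> nabla"

text \<open>\<open>(M, nabla, g, \<xi>)\<close> is a radiant Hessian manifold with \<open>\<xi> = l \<rho>\<close>.\<close>

definition radiant_Hessian_manifold ::
    "('a, 'm::finite) manifold \<Rightarrow> ('a vfield \<Rightarrow> 'a vfield \<Rightarrow> 'a vfield) \<Rightarrow>
     ('a \<Rightarrow> 'a tvec \<Rightarrow> 'a tvec \<Rightarrow> real) \<Rightarrow> 'a vfield \<Rightarrow> 'a vfield \<Rightarrow> real \<Rightarrow> bool" where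
  "radiant_Hessian_manifold M nabla g \<xi> \<rho> l \<longleftrightarrow>
     selfsimilar_Hessian_manifold M nabla g \<xi> \<and> radiant_vf M nabla \<rho> \<and>
     l \<noteq> 0 \<and> l \<noteq> 2 \<and> (\<forall>q\<in>points M. \<xi> q = (\<lambda>f. l * \<rho> q f))"

text \<open>The radiant vector field \<open>\<Sum>\<^sub>i x\<^sup>i \<partial>/\<partial>x\<^sup>i\<close> of the chart \<open>c\<close>.\<close>

definition euler_field :: "('a, 'm::finite) manifold \<Rightarrow> ('a, 'm) chart \<Rightarrow> 'a vfield" where
  "euler_field M c q = (\<lambda>f. \<Sum>i\<in>UNIV. coord c i q * coord_field M c i q f)"

end

theory Submission
  imports Defs
begin

text \<open>Put \<open>m = 2/l\<close>. The whole argument takes place in a chart around \<open>p\<close> whose coordinates are flat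
  and whose Euler field \<open>E = \<Sum>\<^sub>i x\<^sup>i \<partial>\<^sub>i\<close> is \<open>\<rho>\<close>, so that \<open>\<xi> = l E\<close>.

  Such a chart exists for the following reason (\<open>radiant_flat_coordinates\<close>). In any chart, the
  equations for a parallel vector field and for a parallel 1-form are linear systems
  \<open>Du(x) v = A(x)(v, u(x))\<close>, and zero curvature is exactly the condition that second derivatives
  of a solution commute. Under this condition the system has a solution near a given point with any
  initial value (\<open>integrable_linear_system\<close>), so there are a parallel frame \<open>X\<^sub>i\<close> and the dual
  parallel coframe \<open>\<theta>\<^sup>i\<close>. Instead of integrating the closed forms \<open>\<theta>\<^sup>i\<close>, put \<open>x\<^sup>i = \<theta>\<^sup>i(\<rho>)\<close>: since \<open>\<theta>\<^sup>i\<close>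
  is parallel and \<open>\<nabla>\<rho> = Id\<close>, the differential of this function is \<open>\<theta>\<^sup>i\<close>. The \<open>x\<^sup>i\<close> are then flat
  coordinates with \<open>\<partial>\<^sub>i = X\<^sub>i\<close>, and \<open>\<rho> = \<Sum>\<^sub>i \<theta>\<^sup>i(\<rho>) X\<^sub>i\<close> is their Euler field.

  In these coordinates the metric is a matrix \<open>G(x)\<close> with two properties. Since \<open>g\<close> is locally a
  Hessian, the derivative of \<open>G\<close> is symmetric in all three indices (\<open>codazzi\<close>). Since
  \<open>L\<^sub>\<xi> g = 2 g\<close> and \<open>\<xi> = l E\<close>, the entries of \<open>G\<close> are homogeneous of degree \<open>m - 2\<close>
  (\<open>metric_homogeneous\<close>).

  If \<open>\<xi>\<close> vanishes at \<open>p\<close>, then \<open>p\<close> is the origin of the coordinates. As \<open>G(0)\<close> is positive definite,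
  homogeneity forces \<open>m = 2\<close>, that is \<open>l = 1\<close>, and then \<open>G\<close> is constant along rays, hence constant
  (\<open>metric_at_origin\<close>). Starting from a frame that is orthonormal at \<open>p\<close> makes it the identity matrix.

  If \<open>\<xi>\<close> does not vanish at \<open>p\<close>, the frame is chosen such that the coordinate with index \<open>k\<close> is positive.
  The two properties of \<open>G\<close> imply that \<open>\<phi> = g(E, E) / (m\<^sup>2 - m)\<close> satisfies \<open>g = Hess \<phi>\<close> and
  \<open>E \<phi> = m \<phi>\<close>; here \<open>l \<noteq> 2\<close> makes the denominator nonzero. So \<open>\<psi> = (x\<^sup>k)\<^sup>-\<^sup>m \<phi>\<close> is constant along \<open>E\<close>.
  For a constant field \<open>X\<close> without \<open>\<partial>\<^sub>k\<close>-component, the numbers \<open>g(E, E)\<close>, \<open>g(X, E)\<close> and \<open>g(X, X)\<close> are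
  \<open>(x\<^sup>k)\<^sup>m\<close> times \<open>(m\<^sup>2 - m) \<psi>\<close>, \<open>(m - 1) X \<psi>\<close> and \<open>X\<^sup>2 \<psi>\<close>. The inequalities for \<open>\<psi>\<close> are therefore the
  positivity of \<open>g\<close> on \<open>E\<close>, on \<open>X\<close> and on \<open>X + E\<close> (\<open>potential_normal_form\<close>).\<close>

section \<open>Calculus of smooth maps\<close>

abbreviation fderiv :: "('e::euclidean_space \<Rightarrow> 'f::real_normed_vector) \<Rightarrow> 'e \<Rightarrow> 'e \<Rightarrow> 'f" where
  "fderiv f x \<equiv> frechet_derivative f (at x)"

lemma fderiv_eq: "(f has_derivative f') (at x) \<Longrightarrow> fderiv f x = f'"
  by (metis frechet_derivative_at)

lemma fderiv_cong_open:
  assumes "open S" "x \<in> S" "\<And>y. y \<in> S \<Longrightarrow> f y = g y"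
  shows "fderiv f x = fderiv g x"
proof -
  have "(f has_derivative D) (at x) \<longleftrightarrow> (g has_derivative D) (at x)" for D
    using has_derivative_transform_within_open[OF _ assms(1,2)] assms(3) by metis
  then show ?thesis unfolding frechet_derivative_def by simp
qed

lemma differentiable_cong_open:
  assumes "open S" "x \<in> S" "\<And>y. y \<in> S \<Longrightarrow> f y = g y"
  shows "f differentiable (at x) \<longleftrightarrow> g differentiable (at x)"
  using has_derivative_transform_within_open[OF _ assms(1,2)] assms(3)
  unfolding differentiable_def by metis

lemma Ck_on_cong:
  assumes "open S" "\<And>x. x \<in> S \<Longrightarrow> f x = g x"
  shows "Ck_on k f S \<longleftrightarrow> Ck_on k g S"
  using assms(2)
proof (induction k arbitrary: f g)
  case 0
  then show ?case by (simp cong: continuous_on_cong)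
next
  case (Suc k)
  have "\<forall>x\<in>S. f differentiable (at x) \<longleftrightarrow> g differentiable (at x)"
    using differentiable_cong_open[OF assms(1)] Suc.prems by blast
  moreover have "Ck_on k (\<lambda>x. fderiv f x v) S \<longleftrightarrow> Ck_on k (\<lambda>x. fderiv g x v) S" for v
    by (rule Suc.IH) (metis fderiv_cong_open[OF assms(1)] Suc.prems)
  ultimately show ?case by simp
qed

lemma Ck_on_subset: "Ck_on k f S \<Longrightarrow> T \<subseteq> S \<Longrightarrow> Ck_on k f T"
  by (induction k arbitrary: f) (auto intro: continuous_on_subset)

text \<open>On an arbitrary set \<open>S\<close> the definition only asks for continuity of the last derivatives on \<open>S\<close>, so
  it can be verified on open neighbourhoods of the points of \<open>S\<close>.\<close>

lemma Ck_on_local: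
  assumes "\<And>x. x \<in> S \<Longrightarrow> \<exists>W. open W \<and> x \<in> W \<and> Ck_on k f W"
  shows "Ck_on k f S"
  using assms
proof (induction k arbitrary: f)
  case 0
  show ?case unfolding Ck_on.simps continuous_on_eq_continuous_within
  proof
    fix x assume "x \<in> S"
    then obtain W where "open W" "x \<in> W" "continuous_on W f" using 0 by auto
    then have "continuous (at x) f" by (simp add: continuous_on_eq_continuous_at)
    then show "continuous (at x within S) f" by (rule continuous_at_imp_continuous_at_within)
  qed
next
  case (Suc k)
  show ?case unfolding Ck_on.simps
  proof (intro conjI ballI allI)
    fix x assume "x \<in> S"
    then show "f differentiable (at x)" using Suc.prems by fastforce
  next
    fix v
    show "Ck_on k (\<lambda>x. fderiv f x v) S"
      by (rule Suc.IH) (use Suc.prems in fastforce)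
  qed
qed

lemma Ck_on_Suc_imp: "Ck_on (Suc k) f S \<Longrightarrow> Ck_on k f S"
proof (induction k arbitrary: f)
  case 0
  then have "f differentiable_on S"
    by (auto simp: differentiable_on_def intro: differentiable_at_withinI)
  then show ?case by (simp add: differentiable_imp_continuous_on)
qed auto

lemma Ck_on_SucI:
  assumes "open S" "\<And>x. x \<in> S \<Longrightarrow> (f has_derivative f' x) (at x)"
    and "\<And>v. Ck_on k (\<lambda>x. f' x v) S"
  shows "Ck_on (Suc k) f S"
  unfolding Ck_on.simps
proof (intro conjI ballI allI)
  fix x assume "x \<in> S"
  then show "f differentiable (at x)" using assms(2) differentiableI by blast
next
  fix v
  have "Ck_on k (\<lambda>x. fderiv f x v) S \<longleftrightarrow> Ck_on k (\<lambda>x. f' x v) S"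
    by (rule Ck_on_cong[OF assms(1)]) (metis assms(2) fderiv_eq)
  then show "Ck_on k (\<lambda>x. fderiv f x v) S" using assms(3) by simp
qed

lemma Ck_on_SucD:
  assumes "Ck_on (Suc k) f S" "x \<in> S"
  shows "(f has_derivative fderiv f x) (at x)"
  using assms frechet_derivative_works by auto

lemma Ck_on_const: "Ck_on k (\<lambda>x. c) S"
  by (induction k arbitrary: c) (auto simp: frechet_derivative_const)

lemma Ck_on_add:
  assumes "open S" shows "Ck_on k f S \<Longrightarrow> Ck_on k g S \<Longrightarrow> Ck_on k (\<lambda>x. f x + g x) S"
proof (induction k arbitrary: f g)
  case 0
  then show ?case by (simp add: continuous_on_add)
next
  case (Suc k)
  show ?case
    by (rule Ck_on_SucI[OF assms, where f' = "\<lambda>x v. fderiv f x v + fderiv g x v"])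
      (use Suc in \<open>auto intro!: has_derivative_add Ck_on_SucD[OF Suc.prems(1)] Ck_on_SucD[OF Suc.prems(2)]\<close>)
qed

lemma Ck_on_sum:
  assumes "open S" "\<And>i. i \<in> I \<Longrightarrow> Ck_on k (f i) S"
  shows "Ck_on k (\<lambda>x. \<Sum>i\<in>I. f i x) S"
  using assms(2)
  by (induction I rule: infinite_finite_induct) (auto intro: Ck_on_const Ck_on_add[OF assms(1)])

lemma Ck_on_bounded_linear:
  assumes "open S" "bounded_linear L"
  shows "Ck_on k f S \<Longrightarrow> Ck_on k (\<lambda>x. L (f x)) S"
proof (induction k arbitrary: f)
  case 0
  then show ?case by (simp add: bounded_linear.continuous_on[OF assms(2)])
next
  case (Suc k)
  show ?case
    by (rule Ck_on_SucI[OF assms(1), where f' = "\<lambda>x v. L (fderiv f x v)"])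
      (use Suc in \<open>auto intro!: bounded_linear.has_derivative[OF assms(2)] Ck_on_SucD[OF Suc.prems]\<close>)
qed

lemma Ck_on_bounded_bilinear:
  assumes "open S" "bounded_bilinear prd"
  shows "Ck_on k f S \<Longrightarrow> Ck_on k g S \<Longrightarrow> Ck_on k (\<lambda>x. prd (f x) (g x)) S"
proof (induction k arbitrary: f g)
  case 0
  then show ?case by (simp add: bounded_bilinear.continuous_on[OF assms(2)])
next
  case (Suc k)
  have "Ck_on k (\<lambda>x. prd (f x) (fderiv g x v) + prd (fderiv f x v) (g x)) S" for v
    using Suc.prems Ck_on_Suc_imp[OF Suc.prems(1)] Ck_on_Suc_imp[OF Suc.prems(2)]
    by (intro Ck_on_add[OF assms(1)] Suc.IH) auto
  then show ?case
    by (intro Ck_on_SucI[OF assms(1), where f' = "\<lambda>x v. prd (f x) (fderiv g x v) + prd (fderiv f x v) (g x)"])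
      (auto intro!: bounded_bilinear.FDERIV[OF assms(2)] Ck_on_SucD[OF Suc.prems(1)] Ck_on_SucD[OF Suc.prems(2)])
qed

lemma linear_euclidean_expansion:
  fixes v :: "'e::euclidean_space"
  assumes "linear L" shows "L v = (\<Sum>b\<in>Basis. (v \<bullet> b) *\<^sub>R L b)"
proof -
  have "L v = L (\<Sum>b\<in>Basis. (v \<bullet> b) *\<^sub>R b)" by (simp add: euclidean_representation)
  then show ?thesis by (simp add: linear_sum[OF assms] linear_cmul[OF assms])
qed

text \<open>The derivative of a composition is expanded in a basis of the middle space, since the
  differentiability classes only speak of derivatives in constant directions.\<close>

lemma Ck_on_compose:
  fixes g :: "'e::euclidean_space \<Rightarrow> 'h::euclidean_space"
  assumes "open S" "open T"
  shows "Ck_on k g S \<Longrightarrow> Ck_on k f T \<Longrightarrow> (\<And>x. x \<in> S \<Longrightarrow> g x \<in> T) \<Longrightarrow> Ck_on k (\<lambda>x. f (g x)) S"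
proof (induction k arbitrary: f g)
  case 0
  then show ?case using continuous_on_compose2[of T f S g] by auto
next
  case (Suc k)
  have g': "(g has_derivative fderiv g x) (at x)" if "x \<in> S" for x
    using Ck_on_SucD[OF Suc.prems(1) that] .
  have f': "(f has_derivative fderiv f (g x)) (at (g x))" if "x \<in> S" for x
    using Ck_on_SucD[OF Suc.prems(2)] Suc.prems(3)[OF that] .
  have "((\<lambda>x. f (g x)) has_derivative (\<lambda>v. \<Sum>b\<in>Basis. (fderiv g x v \<bullet> b) *\<^sub>R fderiv f (g x) b)) (at x)"
    if "x \<in> S" for x
  proof -
    have "linear (fderiv f (g x))" using f'[OF that] has_derivative_linear by blast
    then have "(\<lambda>v. fderiv f (g x) (fderiv g x v)) = (\<lambda>v. \<Sum>b\<in>Basis. (fderiv g x v \<bullet> b) *\<^sub>R fderiv f (g x) b)"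
      by (intro ext linear_euclidean_expansion)
    then show ?thesis
      using has_derivative_compose[OF g'[OF that] f'[OF that]] by metis
  qed
  moreover have "Ck_on k (\<lambda>x. \<Sum>b\<in>Basis. (fderiv g x v \<bullet> b) *\<^sub>R fderiv f (g x) b) S" for v
  proof (intro Ck_on_sum[OF assms(1)] Ck_on_bounded_bilinear[OF assms(1) bounded_bilinear_scaleR])
    fix b
    show "Ck_on k (\<lambda>x. fderiv g x v \<bullet> b) S"
      using Suc.prems(1) by (intro Ck_on_bounded_linear[OF assms(1) bounded_linear_inner_left]) auto
    show "Ck_on k (\<lambda>x. fderiv f (g x) b) S"
      using Suc.prems Ck_on_Suc_imp[OF Suc.prems(1)] by (intro Suc.IH) auto
  qed
  ultimately show ?case by (rule Ck_on_SucI[OF assms(1)])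
qed

lemma smooth_on_cong: "open S \<Longrightarrow> (\<And>x. x \<in> S \<Longrightarrow> f x = g x) \<Longrightarrow> smooth_on S f \<longleftrightarrow> smooth_on S g"
  unfolding smooth_on_def using Ck_on_cong by blast

lemma smooth_on_subset: "smooth_on S f \<Longrightarrow> T \<subseteq> S \<Longrightarrow> smooth_on T f"
  unfolding smooth_on_def using Ck_on_subset by blast

lemma smooth_on_local:
  assumes "\<And>x. x \<in> S \<Longrightarrow> \<exists>W. open W \<and> x \<in> W \<and> smooth_on W f"
  shows "smooth_on S f"
  using assms Ck_on_local unfolding smooth_on_def by metis

lemma smooth_on_const: "smooth_on S (\<lambda>x. c)"
  unfolding smooth_on_def using Ck_on_const by blast

lemma smooth_on_has_derivative:
  assumes "smooth_on S f" "x \<in> S" shows "(f has_derivative fderiv f x) (at x)"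
  using assms Ck_on_SucD unfolding smooth_on_def by metis

lemma smooth_on_fderiv: "smooth_on S f \<Longrightarrow> smooth_on S (\<lambda>x. fderiv f x v)"
  unfolding smooth_on_def by (metis Ck_on.simps(2))

lemma smooth_on_imp_continuous_on: "smooth_on S f \<Longrightarrow> continuous_on S f"
  unfolding smooth_on_def by (metis Ck_on.simps(1))

lemma smooth_on_linear_fderiv: "smooth_on S f \<Longrightarrow> x \<in> S \<Longrightarrow> linear (fderiv f x)"
  using smooth_on_has_derivative has_derivative_linear by blast

lemma smooth_on_sum: "open S \<Longrightarrow> (\<And>i. i \<in> I \<Longrightarrow> smooth_on S (f i)) \<Longrightarrow> smooth_on S (\<lambda>x. \<Sum>i\<in>I. f i x)"
  unfolding smooth_on_def using Ck_on_sum[of S I] by blast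

lemma smooth_on_bounded_linear:
  "open S \<Longrightarrow> bounded_linear L \<Longrightarrow> smooth_on S f \<Longrightarrow> smooth_on S (\<lambda>x. L (f x))"
  unfolding smooth_on_def using Ck_on_bounded_linear by blast

lemma smooth_on_scaleR:
  "open S \<Longrightarrow> smooth_on S f \<Longrightarrow> smooth_on S g \<Longrightarrow> smooth_on S (\<lambda>x. f x *\<^sub>R g x)"
  unfolding smooth_on_def using Ck_on_bounded_bilinear[OF _ bounded_bilinear_scaleR] by blast

lemma smooth_on_mult:
  fixes f g :: "'e::euclidean_space \<Rightarrow> real"
  shows "open S \<Longrightarrow> smooth_on S f \<Longrightarrow> smooth_on S g \<Longrightarrow> smooth_on S (\<lambda>x. f x * g x)"
  using smooth_on_scaleR[of S f g] by simp

lemma smooth_on_inner: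
  "open S \<Longrightarrow> smooth_on S f \<Longrightarrow> smooth_on S g \<Longrightarrow> smooth_on S (\<lambda>x. f x \<bullet> g x)"
  unfolding smooth_on_def using Ck_on_bounded_bilinear[OF _ bounded_bilinear_inner] by blast

lemma smooth_on_compose:
  fixes g :: "'e::euclidean_space \<Rightarrow> 'h::euclidean_space"
  shows "open S \<Longrightarrow> open T \<Longrightarrow> smooth_on S g \<Longrightarrow> smooth_on T f \<Longrightarrow> (\<And>x. x \<in> S \<Longrightarrow> g x \<in> T)
    \<Longrightarrow> smooth_on S (\<lambda>x. f (g x))"
  unfolding smooth_on_def using Ck_on_compose by blast

lemma smooth_on_ident:
  assumes "open S" shows "smooth_on S (\<lambda>x. x)"
proof -
  have "Ck_on k (\<lambda>x. x) S" for k
    by (cases k) (auto simp: frechet_derivative_ident Ck_on_const)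
  then show ?thesis unfolding smooth_on_def by blast
qed

lemma smooth_on_vec_nth:
  "open S \<Longrightarrow> smooth_on S f \<Longrightarrow> smooth_on S (\<lambda>x. (f x :: real ^ 'n::finite) $ i)"
  by (rule smooth_on_bounded_linear[OF _ bounded_linear_vec_nth])

lemma smooth_on_vecI:
  fixes f :: "'e::euclidean_space \<Rightarrow> real ^ 'n::finite"
  assumes "open S" "\<And>i. smooth_on S (\<lambda>x. f x $ i)"
  shows "smooth_on S f"
proof -
  have "smooth_on S (\<lambda>x. \<Sum>i\<in>UNIV. f x $ i *\<^sub>R (axis i 1 :: real ^ 'n))"
    using assms by (intro smooth_on_sum smooth_on_scaleR smooth_on_const) auto
  moreover have "(\<lambda>x. \<Sum>i\<in>UNIV. f x $ i *\<^sub>R (axis i 1 :: real ^ 'n)) = f"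
  proof
    fix x
    show "(\<Sum>i\<in>UNIV. f x $ i *\<^sub>R (axis i 1 :: real ^ 'n)) = f x"
      using basis_expansion[of "f x"] by (simp add: scalar_mult_eq_scaleR)
  qed
  ultimately show ?thesis by (simp only:)
qed

lemma smooth_on_fderiv_along:
  fixes f :: "real ^ 'n::finite \<Rightarrow> 'f::real_normed_vector"
  assumes "open S" "smooth_on S f" "smooth_on S a"
  shows "smooth_on S (\<lambda>x. fderiv f x (a x))"
proof -
  have "smooth_on S (\<lambda>x. \<Sum>b\<in>Basis. (a x \<bullet> b) *\<^sub>R fderiv f x b)"
    using assms by (intro smooth_on_sum smooth_on_scaleR smooth_on_inner smooth_on_const smooth_on_fderiv) auto
  moreover have "(\<Sum>b\<in>Basis. (a x \<bullet> b) *\<^sub>R fderiv f x b) = fderiv f x (a x)" if "x \<in> S" for x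
    using linear_euclidean_expansion[OF smooth_on_linear_fderiv[OF assms(2) that]] by metis
  ultimately show ?thesis using smooth_on_cong[OF assms(1)] by (metis (no_types, lifting))
qed

lemma smooth_on_powr: "smooth_on {0<..} (\<lambda>y::real. y powr a)"
proof -
  have "Ck_on k (\<lambda>y::real. y powr a) {0<..}" for k
  proof (induction k arbitrary: a)
    case 0
    show ?case by (auto intro!: continuous_intros)
  next
    case (Suc k)
    have "((\<lambda>y. y powr a) has_derivative (\<lambda>v. v *\<^sub>R (a *\<^sub>R x powr (a - 1)))) (at x)"
      if "x \<in> {0<..}" for x :: real
      using has_real_derivative_powr[of x a] that
      unfolding has_field_derivative_def by (auto elim!: has_derivative_eq_rhs)
    moreover have "Ck_on k (\<lambda>x. v *\<^sub>R (a *\<^sub>R x powr (a - 1))) {0<..}" for v :: real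
      by (intro Ck_on_bounded_linear[OF _ bounded_linear_scaleR_right] Suc) auto
    ultimately show ?case by (rule Ck_on_SucI[rotated]) auto
  qed
  then show ?thesis unfolding smooth_on_def by blast
qed

text \<open>Symmetry of second derivatives: for small \<open>s > 0\<close> the second difference of \<open>f\<close> over the
  parallelogram spanned by \<open>s v\<close> and \<open>s w\<close> equals, by the mean value theorem applied twice, \<open>s\<^sup>2\<close> times
  a value of \<open>D\<^sub>w D\<^sub>v f\<close> in that parallelogram; exchanging \<open>v\<close> and \<open>w\<close>, it is also \<open>s\<^sup>2\<close> times
  a value of \<open>D\<^sub>v D\<^sub>w f\<close>. Both values tend to the ones at \<open>x\<close>.\<close>

lemma second_difference_mean_value:
  fixes f :: "'e::euclidean_space \<Rightarrow> real"
  assumes sm: "smooth_on S f" and s: "s > 0"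
    and sub: "\<And>a b. 0 \<le> a \<Longrightarrow> a \<le> s \<Longrightarrow> 0 \<le> b \<Longrightarrow> b \<le> s \<Longrightarrow> x + a *\<^sub>R v + b *\<^sub>R w \<in> S"
  shows "\<exists>a b. 0 \<le> a \<and> a \<le> s \<and> 0 \<le> b \<and> b \<le> s \<and>
    f (x + s *\<^sub>R v + s *\<^sub>R w) - f (x + s *\<^sub>R v) - f (x + s *\<^sub>R w) + f x
      = s * (s * fderiv (\<lambda>y. fderiv f y v) (x + a *\<^sub>R v + b *\<^sub>R w) w)"
proof -
  have d1: "((\<lambda>a. h (x + a *\<^sub>R v + b *\<^sub>R w)) has_real_derivative fderiv h (x + a *\<^sub>R v + b *\<^sub>R w) v) (at a)"
    if "smooth_on S h" "0 \<le> a" "a \<le> s" "0 \<le> b" "b \<le> s" for a b h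
  proof -
    have *: "(h has_derivative fderiv h (x + a *\<^sub>R v + b *\<^sub>R w)) (at (x + a *\<^sub>R v + b *\<^sub>R w))"
      using smooth_on_has_derivative[OF that(1) sub] that by blast
    have "((\<lambda>a. x + a *\<^sub>R v + b *\<^sub>R w) has_derivative (\<lambda>t. t *\<^sub>R v)) (at a)"
      by (auto intro!: derivative_eq_intros)
    from has_derivative_compose[OF this *] show ?thesis
      unfolding has_field_derivative_def
      by (simp add: linear_cmul[OF has_derivative_linear[OF *]] mult.commute[of _ "fderiv h _ v"])
  qed
  have d2: "((\<lambda>b. h (x + a *\<^sub>R v + b *\<^sub>R w)) has_real_derivative fderiv h (x + a *\<^sub>R v + b *\<^sub>R w) w) (at b)"
    if "smooth_on S h" "0 \<le> a" "a \<le> s" "0 \<le> b" "b \<le> s" for a b h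
  proof -
    have *: "(h has_derivative fderiv h (x + a *\<^sub>R v + b *\<^sub>R w)) (at (x + a *\<^sub>R v + b *\<^sub>R w))"
      using smooth_on_has_derivative[OF that(1) sub] that by blast
    have "((\<lambda>b. x + a *\<^sub>R v + b *\<^sub>R w) has_derivative (\<lambda>t. t *\<^sub>R w)) (at b)"
      by (auto intro!: derivative_eq_intros)
    from has_derivative_compose[OF this *] show ?thesis
      unfolding has_field_derivative_def
      by (simp add: linear_cmul[OF has_derivative_linear[OF *]] mult.commute[of _ "fderiv h _ w"])
  qed
  have "((\<lambda>a. f (x + a *\<^sub>R v + s *\<^sub>R w) - f (x + a *\<^sub>R v + 0 *\<^sub>R w)) has_real_derivative
      fderiv f (x + a *\<^sub>R v + s *\<^sub>R w) v - fderiv f (x + a *\<^sub>R v + 0 *\<^sub>R w) v) (at a)"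
    if "0 \<le> a" "a \<le> s" for a
    using that s by (intro DERIV_diff d1[OF sm]) auto
  from MVT2[OF s this] obtain a where a: "0 < a" "a < s"
    and ea: "f (x + s *\<^sub>R v + s *\<^sub>R w) - f (x + s *\<^sub>R v) - (f (x + s *\<^sub>R w) - f x)
      = s * (fderiv f (x + a *\<^sub>R v + s *\<^sub>R w) v - fderiv f (x + a *\<^sub>R v + 0 *\<^sub>R w) v)"
    by auto
  have "((\<lambda>b. fderiv f (x + a *\<^sub>R v + b *\<^sub>R w) v) has_real_derivative
      fderiv (\<lambda>y. fderiv f y v) (x + a *\<^sub>R v + b *\<^sub>R w) w) (at b)"
    if "0 \<le> b" "b \<le> s" for b
    using that a by (intro d2 smooth_on_fderiv sm) auto
  from MVT2[OF s this] obtain b where b: "0 < b" "b < s"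
    and eb: "fderiv f (x + a *\<^sub>R v + s *\<^sub>R w) v - fderiv f (x + a *\<^sub>R v + 0 *\<^sub>R w) v
      = s * fderiv (\<lambda>y. fderiv f y v) (x + a *\<^sub>R v + b *\<^sub>R w) w"
    by auto
  have "f (x + s *\<^sub>R v + s *\<^sub>R w) - f (x + s *\<^sub>R v) - f (x + s *\<^sub>R w) + f x
      = s * (s * fderiv (\<lambda>y. fderiv f y v) (x + a *\<^sub>R v + b *\<^sub>R w) w)"
    using ea eb by simp
  then show ?thesis using a b by (intro exI[of _ a] exI[of _ b]) auto
qed

lemma fderiv_commute:
  fixes f :: "'e::euclidean_space \<Rightarrow> real"
  assumes "open S" and sm: "smooth_on S f" and x: "x \<in> S"
  shows "fderiv (\<lambda>y. fderiv f y v) x w = fderiv (\<lambda>y. fderiv f y w) x v"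
proof (rule ccontr)
  define F where "F v w y = fderiv (\<lambda>y. fderiv f y v) y w" for v w y
  assume "\<not> ?thesis"
  then have e: "\<bar>F v w x - F w v x\<bar> / 2 > 0" (is "?e > 0") by (simp add: F_def)
  have cont: "continuous_on S (F v w)" "continuous_on S (F w v)"
    unfolding F_def by (intro smooth_on_imp_continuous_on smooth_on_fderiv sm)+
  obtain d1 where d1: "d1 > 0" "\<And>y. y \<in> S \<Longrightarrow> dist y x < d1 \<Longrightarrow> dist (F v w y) (F v w x) < ?e"
    using cont(1) e x unfolding continuous_on_iff by metis
  obtain d2 where d2: "d2 > 0" "\<And>y. y \<in> S \<Longrightarrow> dist y x < d2 \<Longrightarrow> dist (F w v y) (F w v x) < ?e"
    using cont(2) e x unfolding continuous_on_iff by metis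
  obtain d3 where d3: "d3 > 0" "ball x d3 \<subseteq> S" using assms(1) x openE by blast
  define d where "d = min d1 (min d2 d3)"
  define s where "s = d / (2 * (norm v + norm w + 1))"
  have "d > 0" using d1 d2 d3 by (simp add: d_def)
  have nn: "norm v + norm w + 1 > 0" by (simp add: add_nonneg_pos)
  have s: "s > 0" using \<open>d > 0\<close> nn by (simp add: s_def)
  have sd: "s * (norm v + norm w) < d"
  proof -
    have "s * (norm v + norm w) \<le> s * (norm v + norm w + 1)" using s by simp
    also have "\<dots> = d / 2" using nn by (simp add: s_def field_simps)
    finally show ?thesis using \<open>d > 0\<close> by simp
  qed
  have near: "dist (x + (a *\<^sub>R v + b *\<^sub>R w)) x < d" if "0 \<le> a" "a \<le> s" "0 \<le> b" "b \<le> s" for a b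
  proof -
    have "norm (a *\<^sub>R v + b *\<^sub>R w) \<le> a * norm v + b * norm w"
      using norm_triangle_ineq[of "a *\<^sub>R v" "b *\<^sub>R w"] that by simp
    also have "\<dots> \<le> s * norm v + s * norm w" using that by (intro add_mono mult_right_mono) auto
    finally show ?thesis using sd by (simp add: dist_norm distrib_left)
  qed
  have mem: "x + (a *\<^sub>R v + b *\<^sub>R w) \<in> S" if "0 \<le> a" "a \<le> s" "0 \<le> b" "b \<le> s" for a b
  proof -
    have "dist (x + (a *\<^sub>R v + b *\<^sub>R w)) x < d3" using near[OF that] unfolding d_def by linarith
    then show ?thesis using d3 by (metis dist_commute mem_ball subsetD)
  qed
  have m1: "x + a *\<^sub>R v + b *\<^sub>R w \<in> S" if "0 \<le> a" "a \<le> s" "0 \<le> b" "b \<le> s" for a b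
    using mem[OF that] by (simp add: add.assoc)
  have m2: "x + b *\<^sub>R w + a *\<^sub>R v \<in> S" if "0 \<le> b" "b \<le> s" "0 \<le> a" "a \<le> s" for a b
    using m1[of a b] that by (simp add: add.assoc add.commute[of "a *\<^sub>R v"])
  obtain a b where ab: "0 \<le> a" "a \<le> s" "0 \<le> b" "b \<le> s"
    "f (x + s *\<^sub>R v + s *\<^sub>R w) - f (x + s *\<^sub>R v) - f (x + s *\<^sub>R w) + f x
      = s * (s * F v w (x + a *\<^sub>R v + b *\<^sub>R w))"
    using second_difference_mean_value[OF sm s m1] unfolding F_def by blast
  obtain a' b' where ab': "0 \<le> a'" "a' \<le> s" "0 \<le> b'" "b' \<le> s"
    "f (x + s *\<^sub>R w + s *\<^sub>R v) - f (x + s *\<^sub>R w) - f (x + s *\<^sub>R v) + f x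
      = s * (s * F w v (x + b' *\<^sub>R w + a' *\<^sub>R v))"
    using second_difference_mean_value[OF sm s m2] unfolding F_def by blast
  have "s * (s * F v w (x + a *\<^sub>R v + b *\<^sub>R w)) = s * (s * F w v (x + b' *\<^sub>R w + a' *\<^sub>R v))"
    using ab(5) ab'(5) by (simp add: algebra_simps)
  then have eq: "F v w (x + (a *\<^sub>R v + b *\<^sub>R w)) = F w v (x + (a' *\<^sub>R v + b' *\<^sub>R w))"
    using s by (simp add: algebra_simps)
  have "dist (F v w (x + (a *\<^sub>R v + b *\<^sub>R w))) (F v w x) < ?e"
    using near[OF ab(1-4)] mem[OF ab(1-4)] by (intro d1) (auto simp: d_def)
  moreover have "dist (F w v (x + (a' *\<^sub>R v + b' *\<^sub>R w))) (F w v x) < ?e"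
    using near[OF ab'(1-4)] mem[OF ab'(1-4)] by (intro d2) (auto simp: d_def)
  ultimately have "dist (F v w x) (F w v x) < ?e + ?e"
    using eq dist_triangle_half_r[of "F v w (x + (a *\<^sub>R v + b *\<^sub>R w))" "F v w x" "2 * ?e" "F w v x"]
    by simp
  then show False by (simp add: dist_real_def)
qed

section \<open>Completely integrable linear systems\<close>

definition ray :: "'e::real_vector \<Rightarrow> 'e \<Rightarrow> real \<Rightarrow> 'e" where
  "ray x0 x t = x0 + t *\<^sub>R (x - x0)"

text \<open>Along the ray from \<open>x0\<close> to \<open>x\<close>, a solution of \<open>Du(x) v = A(x)(v, u(x))\<close> with \<open>u(x0) = u0\<close> satisfies
  an ordinary linear differential equation; this is the Picard operator of its integral form at
  time \<open>1\<close>.\<close>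

definition picard ::
  "'e::euclidean_space \<Rightarrow> 'f::euclidean_space \<Rightarrow> ('e \<Rightarrow> 'e \<Rightarrow>\<^sub>L 'f \<Rightarrow>\<^sub>L 'f) \<Rightarrow> ('e \<Rightarrow> 'f) \<Rightarrow> 'e \<Rightarrow> 'f" where
  "picard x0 u0 A a x = u0 + integral {0..1} (\<lambda>t. A (ray x0 x t) (x - x0) (a (ray x0 x t)))"

lemma ray_in_convex: "convex S \<Longrightarrow> x0 \<in> S \<Longrightarrow> x \<in> S \<Longrightarrow> t \<in> {0..1} \<Longrightarrow> ray x0 x t \<in> S"
  using convexD_alt[of S x0 x t] by (simp add: ray_def algebra_simps)

lemma continuous_on_ray: "continuous_on T f \<Longrightarrow> continuous_on T g \<Longrightarrow> continuous_on T (\<lambda>z. ray x0 (f z) (g z))"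
  for f :: "_ \<Rightarrow> 'e::real_normed_vector"
  unfolding ray_def by (intro continuous_intros)

text \<open>Let \<open>E(y) v = Da(y) v - A(y)(v, a(y))\<close> measure how far \<open>a\<close> is from solving the system.
  Differentiating the Picard integral under the integral sign and subtracting the total
  \<open>t\<close>-derivative of \<open>t A(y)(v, a(y))\<close> along the ray \<open>y = ray x0 x t\<close>, the terms with a derivative of
  \<open>A\<close> combine by integrability into a commutator, and only the defect \<open>E\<close> of \<open>a\<close> survives.\<close>

lemma picard_has_derivative:
  fixes A :: "'e::euclidean_space \<Rightarrow> 'e \<Rightarrow>\<^sub>L 'f::euclidean_space \<Rightarrow>\<^sub>L 'f"
  assumes S: "open S" "convex S" "x0 \<in> S"
    and dA: "\<And>x. x \<in> S \<Longrightarrow> (A has_derivative blinfun_apply (A' x)) (at x)"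
    and cA': "continuous_on S A'"
    and integrable: "\<And>x v w u. x \<in> S \<Longrightarrow> A' x w v u + A x v (A x w u) = A' x v w u + A x w (A x v u)"
    and da: "\<And>x. x \<in> S \<Longrightarrow> (a has_derivative blinfun_apply (D x)) (at x)"
    and cD: "continuous_on S D"
  defines "E \<equiv> \<lambda>y v. D y v - A y v (a y)"
  shows "\<exists>D'. continuous_on S D' \<and>
    (\<forall>x\<in>S. (picard x0 u0 A a has_derivative blinfun_apply (D' x)) (at x)) \<and>
    (\<forall>x\<in>S. \<forall>v. D' x v - A x v (a x) =
       integral {0..1} (\<lambda>t. t *\<^sub>R (A (ray x0 x t) (x - x0) (E (ray x0 x t) v)
                               - A (ray x0 x t) v (E (ray x0 x t) (x - x0)))))"
proof -
  have cA: "continuous_on S A"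
    using dA by (meson continuous_at_imp_continuous_on has_derivative_continuous)
  have ca: "continuous_on S a"
    using da by (meson continuous_at_imp_continuous_on has_derivative_continuous)
  define G where "G x t v = t *\<^sub>R A' (ray x0 x t) v (x - x0) (a (ray x0 x t))
      + A (ray x0 x t) v (a (ray x0 x t)) + t *\<^sub>R A (ray x0 x t) (x - x0) (D (ray x0 x t) v)" for x t v
  have dG: "((\<lambda>x. A (ray x0 x t) (x - x0) (a (ray x0 x t))) has_derivative G x t) (at x)"
    if "x \<in> S" "t \<in> {0..1}" for x t
  proof -
    note y = ray_in_convex[OF S(2,3) that]
    have r: "((\<lambda>x. ray x0 x t) has_derivative (\<lambda>v. t *\<^sub>R v)) (at x)"
      unfolding ray_def by (auto intro!: derivative_eq_intros)
    have "((\<lambda>x. A (ray x0 x t)) has_derivative (\<lambda>v. A' (ray x0 x t) (t *\<^sub>R v))) (at x)"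
      using has_derivative_compose[OF r dA[OF y]] .
    moreover have "((\<lambda>x. a (ray x0 x t)) has_derivative (\<lambda>v. D (ray x0 x t) (t *\<^sub>R v))) (at x)"
      using has_derivative_compose[OF r da[OF y]] .
    moreover have "((\<lambda>x. x - x0) has_derivative (\<lambda>v. v)) (at x)"
      by (auto intro!: derivative_eq_intros)
    ultimately have "((\<lambda>x. A (ray x0 x t) (x - x0) (a (ray x0 x t))) has_derivative
       (\<lambda>v. (A (ray x0 x t) (x - x0)) (D (ray x0 x t) (t *\<^sub>R v))
          + (A (ray x0 x t) v + (A' (ray x0 x t) (t *\<^sub>R v)) (x - x0)) (a (ray x0 x t)))) (at x)"
      by (intro blinfun.FDERIV)
    moreover have "(\<lambda>v. (A (ray x0 x t) (x - x0)) (D (ray x0 x t) (t *\<^sub>R v))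
          + (A (ray x0 x t) v + (A' (ray x0 x t) (t *\<^sub>R v)) (x - x0)) (a (ray x0 x t))) = G x t"
      by (auto simp: G_def blinfun.bilinear_simps algebra_simps)
    ultimately show ?thesis by simp
  qed
  have blG: "bounded_linear (G x t)" if "x \<in> S" "t \<in> {0..1}" for x t
    using dG[OF that] has_derivative_bounded_linear by blast
  have mem: "ray x0 (fst z) (snd z) \<in> S" if "z \<in> S \<times> {0..1}" for z
    using that ray_in_convex[OF S(2,3)] by auto
  have cr: "continuous_on (S \<times> {0..1}) (\<lambda>z. ray x0 (fst z) (snd z))"
    by (intro continuous_on_ray continuous_intros)
  note cAr = continuous_on_compose2[OF cA cr] continuous_on_compose2[OF cA' cr]
    continuous_on_compose2[OF ca cr] continuous_on_compose2[OF cD cr]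
  have cG: "continuous_on (S \<times> {0..1}) (\<lambda>z. G (fst z) (snd z) v)" for v
    unfolding G_def using mem by (intro continuous_intros cAr) auto
  define fx where "fx x t = Blinfun (G x t)" for x t
  have fx: "blinfun_apply (fx x t) = G x t" if "x \<in> S" "t \<in> {0..1}" for x t
    unfolding fx_def by (rule bounded_linear_Blinfun_apply[OF blG[OF that]])
  have cfx: "continuous_on (S \<times> {0..1}) (\<lambda>z. fx (fst z) (snd z))"
  proof (rule continuous_on_blinfun_componentwise)
    fix i :: 'e
    show "continuous_on (S \<times> {0..1}) (\<lambda>z. fx (fst z) (snd z) i)"
      using cG[of i] by (rule continuous_on_eq) (auto simp: fx)
  qed
  define D' where "D' x = integral {0..1} (fx x)" for x
  have cD': "continuous_on S D'"
    using integral_continuous_on_param[of S 0 "1::real" fx] cfx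
    by (simp add: D'_def[abs_def] case_prod_beta)
  have crt: "continuous_on {0..1} (\<lambda>t. ray x0 x t)" for x
    by (intro continuous_on_ray continuous_intros)
  have memt: "ray x0 x ` {0..1} \<subseteq> S" if "x \<in> S" for x
    using ray_in_convex[OF S(2,3) that] by auto
  note cAt = continuous_on_compose2[OF cA crt memt] continuous_on_compose2[OF cA' crt memt]
    continuous_on_compose2[OF ca crt memt] continuous_on_compose2[OF cD crt memt]
  have int: "(\<lambda>t. A (ray x0 x t) (x - x0) (a (ray x0 x t))) integrable_on cbox 0 1" if "x \<in> S" for x
    using that by (simp, intro integrable_continuous_interval continuous_intros cAt)
  have der: "(picard x0 u0 A a has_derivative blinfun_apply (D' x)) (at x)" if "x \<in> S" for x
  proof -
    have "((\<lambda>x. integral (cbox 0 1) (\<lambda>t. A (ray x0 x t) (x - x0) (a (ray x0 x t)))) has_derivative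
        blinfun_apply (integral (cbox 0 1) (fx x))) (at x within S)"
    proof (rule leibniz_rule[OF _ int _ that S(2)])
      fix x and t :: real assume "x \<in> S" "t \<in> cbox 0 1"
      then show "((\<lambda>x. A (ray x0 x t) (x - x0) (a (ray x0 x t))) has_derivative blinfun_apply (fx x t)) (at x within S)"
        using dG[of x t] fx[of x t] by (simp add: has_derivative_at_withinI)
    next
      show "continuous_on (S \<times> cbox 0 1) (\<lambda>(x, t). fx x t)" using cfx by (simp add: case_prod_beta)
    qed
    then have "((\<lambda>x. u0 + integral {0..1} (\<lambda>t. A (ray x0 x t) (x - x0) (a (ray x0 x t)))) has_derivative
        blinfun_apply (D' x)) (at x within S)"
      unfolding D'_def by (auto intro!: derivative_eq_intros)
    then show ?thesis
      using at_within_open[OF that S(1)] by (simp add: picard_def[abs_def])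
  qed
  have formula: "D' x v - A x v (a x) =
       integral {0..1} (\<lambda>t. t *\<^sub>R (A (ray x0 x t) (x - x0) (E (ray x0 x t) v)
                               - A (ray x0 x t) v (E (ray x0 x t) (x - x0))))"
    if x: "x \<in> S" for x v
  proof -
    let ?h = "x - x0"
    define T where "T t = A (ray x0 x t) v (a (ray x0 x t)) + t *\<^sub>R (A' (ray x0 x t) ?h v (a (ray x0 x t))
        + A (ray x0 x t) v (D (ray x0 x t) ?h))" for t
    have "((\<lambda>t. t *\<^sub>R A (ray x0 x t) v (a (ray x0 x t))) has_vector_derivative T t) (at t within {0..1})"
      if "t \<in> {0..1}" for t
    proof -
      note y = ray_in_convex[OF S(2,3) x that]
      have r: "(ray x0 x has_derivative (\<lambda>s. s *\<^sub>R ?h)) (at t)"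
        unfolding ray_def by (auto intro!: derivative_eq_intros)
      have dd: "((\<lambda>t. A (ray x0 x t)) has_derivative (\<lambda>s. A' (ray x0 x t) (s *\<^sub>R ?h))) (at t)"
        "((\<lambda>t. a (ray x0 x t)) has_derivative (\<lambda>s. D (ray x0 x t) (s *\<^sub>R ?h))) (at t)"
        using has_derivative_compose[OF r dA[OF y]] has_derivative_compose[OF r da[OF y]] by auto
      have "((\<lambda>t. t *\<^sub>R A (ray x0 x t) v (a (ray x0 x t))) has_derivative
        (\<lambda>s. t *\<^sub>R (A (ray x0 x t) v (D (ray x0 x t) (s *\<^sub>R ?h))
           + (A (ray x0 x t) 0 + A' (ray x0 x t) (s *\<^sub>R ?h) v) (a (ray x0 x t)))
           + s *\<^sub>R A (ray x0 x t) v (a (ray x0 x t)))) (at t)"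
        by (rule has_derivative_scaleR[OF has_derivative_ident])
          (intro blinfun.FDERIV dd has_derivative_const)
      then show ?thesis
        unfolding has_vector_derivative_def T_def
        by (rule has_derivative_at_withinI[OF has_derivative_eq_rhs])
          (auto simp: blinfun.bilinear_simps algebra_simps)
    qed
    then have T: "(T has_integral (A x v (a x))) {0..1}"
      using fundamental_theorem_of_calculus[of 0 1 "\<lambda>t. t *\<^sub>R A (ray x0 x t) v (a (ray x0 x t))" T]
      by (simp add: ray_def)
    have cfxx: "continuous_on {0..1} (fx x)"
      using continuous_on_compose2[OF cfx, of "{0..1}" "\<lambda>t. (x, t)"] x
        continuous_on_Pair[OF continuous_on_const[of "{0..1}" x] continuous_on_id[of "{0..1::real}"]] by auto
    then have "blinfun_apply (D' x) v = integral {0..1} (\<lambda>t. fx x t v)"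
      unfolding D'_def by (intro blinfun_apply_integral integrable_continuous_interval)
    moreover have "((\<lambda>t. fx x t v) has_integral integral {0..1} (\<lambda>t. fx x t v)) {0..1}"
      using cfxx by (intro integrable_integral integrable_continuous_interval continuous_intros)
    ultimately have "((\<lambda>t. fx x t v - T t) has_integral (D' x v - A x v (a x))) {0..1}"
      using has_integral_diff[OF _ T] by auto
    moreover have "fx x t v - T t = t *\<^sub>R (A (ray x0 x t) ?h (E (ray x0 x t) v)
                               - A (ray x0 x t) v (E (ray x0 x t) ?h))" if "t \<in> {0..1}" for t
    proof -
      note y = ray_in_convex[OF S(2,3) x that]
      have "A' (ray x0 x t) v ?h (a (ray x0 x t)) - A' (ray x0 x t) ?h v (a (ray x0 x t))
        = A (ray x0 x t) v (A (ray x0 x t) ?h (a (ray x0 x t))) - A (ray x0 x t) ?h (A (ray x0 x t) v (a (ray x0 x t)))"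
        using integrable[OF y, of ?h v "a (ray x0 x t)"] by (simp add: algebra_simps)
      moreover have "fx x t v - T t = t *\<^sub>R ((A' (ray x0 x t) v ?h (a (ray x0 x t)) - A' (ray x0 x t) ?h v (a (ray x0 x t)))
         + (A (ray x0 x t) ?h (D (ray x0 x t) v) - A (ray x0 x t) v (D (ray x0 x t) ?h)))"
        by (simp add: fx[OF x that] G_def T_def algebra_simps)
      ultimately have "fx x t v - T t = t *\<^sub>R ((A (ray x0 x t) v (A (ray x0 x t) ?h (a (ray x0 x t)))
            - A (ray x0 x t) ?h (A (ray x0 x t) v (a (ray x0 x t))))
         + (A (ray x0 x t) ?h (D (ray x0 x t) v) - A (ray x0 x t) v (D (ray x0 x t) ?h)))"
        by (simp only:)
      then show ?thesis
        by (simp add: E_def blinfun.bilinear_simps algebra_simps)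
    qed
    ultimately have "((\<lambda>t. t *\<^sub>R (A (ray x0 x t) ?h (E (ray x0 x t) v)
                               - A (ray x0 x t) v (E (ray x0 x t) ?h))) has_integral (D' x v - A x v (a x))) {0..1}"
      by (rule has_integral_eq[rotated]) auto
    then show ?thesis by (simp add: integral_unique)
  qed
  show ?thesis using cD' der formula by blast
qed

lemma blinfun_apply2_bound:
  fixes B :: "'e::real_normed_vector \<Rightarrow>\<^sub>L 'f::real_normed_vector \<Rightarrow>\<^sub>L 'h::real_normed_vector"
  assumes "norm B \<le> C" "norm v \<le> a" "norm u \<le> b"
  shows "norm (B v u) \<le> C * a * b"
proof -
  have pos: "0 \<le> C" "0 \<le> a" "0 \<le> b" using assms norm_ge_zero order_trans by blast+
  have "norm (B v u) \<le> norm (B v) * norm u" by (rule norm_blinfun)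
  also have "\<dots> \<le> (norm B * norm v) * norm u" by (intro mult_right_mono norm_blinfun) auto
  also have "\<dots> \<le> (C * a) * b"
    using assms pos by (intro mult_mono) auto
  finally show ?thesis .
qed

text \<open>On a ball so small that \<open>\<parallel>A\<parallel> r \<le> 1/8\<close>, each Picard step contracts both the increments and the
  defects of the iterates. So the iterates converge uniformly, and their derivatives converge
  uniformly to \<open>A(x)(v, u(x))\<close>, where \<open>u\<close> is their limit.\<close>

theorem integrable_linear_system_C1:
  fixes A :: "'e::euclidean_space \<Rightarrow> 'e \<Rightarrow>\<^sub>L 'f::euclidean_space \<Rightarrow>\<^sub>L 'f"
  assumes S: "open S" "x0 \<in> S"
    and dA: "\<And>x. x \<in> S \<Longrightarrow> (A has_derivative blinfun_apply (A' x)) (at x)"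
    and cA': "continuous_on S A'"
    and integrable: "\<And>x v w u. x \<in> S \<Longrightarrow> A' x w v u + A x v (A x w u) = A' x v w u + A x w (A x v u)"
  shows "\<exists>r>0. ball x0 r \<subseteq> S \<and> (\<forall>u0. \<exists>u. u x0 = u0 \<and>
    (\<forall>x\<in>ball x0 r. (u has_derivative (\<lambda>v. A x v (u x))) (at x)))"
proof -
  have cA: "continuous_on S A"
    using dA by (meson continuous_at_imp_continuous_on has_derivative_continuous)
  obtain R where R: "R > 0" "cball x0 R \<subseteq> S" using S open_contains_cball by blast
  have "bounded (A ` cball x0 R)"
    by (intro compact_imp_bounded compact_continuous_image continuous_on_subset[OF cA R(2)]) simp
  then obtain C where C: "C > 0" "\<And>x. x \<in> cball x0 R \<Longrightarrow> norm (A x) \<le> C"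
    unfolding bounded_pos by auto
  define r where "r = min R (1 / (8 * C))"
  have r: "r > 0" "r \<le> R" "C * r \<le> 1/8"
    using R C by (auto simp: r_def min_def field_simps)
  define B where "B = ball x0 r"
  have B: "open B" "convex B" "x0 \<in> B" "B \<subseteq> S"
    using r R by (auto simp: B_def)
  have AC: "norm (A x) \<le> C" if "x \<in> B" for x using that r C by (auto simp: B_def)
  have Bh: "norm (x - x0) \<le> r" if "x \<in> B" for x
    using that by (simp add: B_def dist_norm norm_minus_commute)
  have "\<exists>u. u x0 = u0 \<and> (\<forall>x\<in>B. (u has_derivative (\<lambda>v. A x v (u x))) (at x))" for u0
  proof -
    define a where "a k = (picard x0 u0 A ^^ k) (\<lambda>x. u0)" for k
    define E where "E k x v = fderiv (a k) x v - A x v (a k x)" for k x v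
    have a0: "a 0 = (\<lambda>x. u0)" and aS: "a (Suc k) = picard x0 u0 A (a k)" for k
      by (simp_all add: a_def)
    have step: "\<exists>D'. continuous_on B D' \<and>
      (\<forall>x\<in>B. (a (Suc k) has_derivative blinfun_apply (D' x)) (at x)) \<and>
      (\<forall>x\<in>B. \<forall>v. D' x v - A x v (a k x) =
       integral {0..1} (\<lambda>t. t *\<^sub>R (A (ray x0 x t) (x - x0) (E k (ray x0 x t) v)
                               - A (ray x0 x t) v (E k (ray x0 x t) (x - x0)))))"
      if D: "continuous_on B D" "\<forall>x\<in>B. (a k has_derivative blinfun_apply (D x)) (at x)" for k D
    proof -
      have fd: "E k y v = D y v - A y v (a k y)" if "y \<in> B" for y v
        using fderiv_eq[of "a k" "blinfun_apply (D y)" y] D(2) that by (simp add: E_def)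
      obtain D' where D': "continuous_on B D'"
        "\<forall>x\<in>B. (a (Suc k) has_derivative blinfun_apply (D' x)) (at x)"
        "\<forall>x\<in>B. \<forall>v. D' x v - A x v (a k x) = integral {0..1}
         (\<lambda>t. t *\<^sub>R (A (ray x0 x t) (x - x0) (D (ray x0 x t) v - A (ray x0 x t) v (a k (ray x0 x t)))
            - A (ray x0 x t) v (D (ray x0 x t) (x - x0) - A (ray x0 x t) (x - x0) (a k (ray x0 x t)))))"
        using picard_has_derivative[OF B(1-3) dA[OF subsetD[OF B(4)]] continuous_on_subset[OF cA' B(4)]
            integrable[OF subsetD[OF B(4)]] D(2)[rule_format] D(1), of u0]
        unfolding aS by blast
      have "D' x v - A x v (a k x) = integral {0..1} (\<lambda>t. t *\<^sub>R (A (ray x0 x t) (x - x0) (E k (ray x0 x t) v)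
                               - A (ray x0 x t) v (E k (ray x0 x t) (x - x0))))" if "x \<in> B" for x v
        unfolding D'(3)[rule_format, OF that]
        by (rule integral_cong) (simp add: fd ray_in_convex[OF B(2,3) that])
      then show ?thesis using D' by blast
    qed
    have C1: "\<exists>D. continuous_on B D \<and> (\<forall>x\<in>B. (a k has_derivative blinfun_apply (D x)) (at x))" for k
    proof (induction k)
      case 0
      show ?case unfolding a0 by (rule exI[of _ "\<lambda>x. 0"]) (auto intro: derivative_eq_intros)
    next
      case (Suc k)
      then show ?case using step by meson
    qed
    have ca: "continuous_on B (a k)" for k
      using C1[of k] by (meson continuous_at_imp_continuous_on has_derivative_continuous)
    have da: "(a k has_derivative fderiv (a k) x) (at x)" if "x \<in> B" for k x
      using C1[of k] that frechet_derivative_works by (meson differentiableI)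
    have cE: "continuous_on B (\<lambda>x. E k x v)" for k v
    proof -
      obtain D where D: "continuous_on B D" "\<forall>x\<in>B. (a k has_derivative blinfun_apply (D x)) (at x)"
        using C1 by blast
      have "continuous_on B (\<lambda>x. D x v - A x v (a k x))"
        by (intro continuous_intros D ca continuous_on_subset[OF cA B(4)])
      then show ?thesis
        by (rule continuous_on_eq) (use D(2) fderiv_eq in \<open>fastforce simp: E_def\<close>)
    qed
    have E_step: "E (Suc k) x v = A x v (a k x - a (Suc k) x) + integral {0..1}
       (\<lambda>t. t *\<^sub>R (A (ray x0 x t) (x - x0) (E k (ray x0 x t) v)
               - A (ray x0 x t) v (E k (ray x0 x t) (x - x0))))" if "x \<in> B" for k x v
    proof -
      obtain D where "continuous_on B D" "\<forall>x\<in>B. (a k has_derivative blinfun_apply (D x)) (at x)"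
        using C1 by blast
      from step[OF this] obtain D' where D':
        "\<forall>x\<in>B. (a (Suc k) has_derivative blinfun_apply (D' x)) (at x)"
        "\<forall>x\<in>B. \<forall>v. D' x v - A x v (a k x) =
         integral {0..1} (\<lambda>t. t *\<^sub>R (A (ray x0 x t) (x - x0) (E k (ray x0 x t) v)
                               - A (ray x0 x t) v (E k (ray x0 x t) (x - x0))))" by blast
      have "fderiv (a (Suc k)) x v = D' x v" using D'(1) that fderiv_eq by metis
      then show ?thesis using D'(2) that by (simp add: E_def blinfun.bilinear_simps algebra_simps)
    qed
    have crt: "continuous_on {0..1} (\<lambda>t. ray x0 x t)" for x
      by (intro continuous_on_ray continuous_intros)
    have memt: "ray x0 x ` {0..1} \<subseteq> B" if "x \<in> B" for x
      using ray_in_convex[OF B(2,3) that] by auto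
    note cAt = continuous_on_compose2[OF continuous_on_subset[OF cA B(4)] crt memt]
    define K where "K = norm u0"
    have K: "K \<ge> 0" by (simp add: K_def)
    have delta: "norm (a (Suc k) x - a k x) \<le> K * (1/2) ^ k" if "x \<in> B" for k x
      using that
    proof (induction k arbitrary: x)
      case 0
      have "norm (integral {0..1} (\<lambda>t. A (ray x0 x t) (x - x0) u0)) \<le> (C * r * K) * (1 - 0)"
      proof (rule integral_bound)
        show "continuous_on {0..1} (\<lambda>t. A (ray x0 x t) (x - x0) u0)"
          by (intro continuous_intros cAt 0)
        fix t :: real assume "t \<in> {0..1}"
        then show "norm (A (ray x0 x t) (x - x0) u0) \<le> C * r * K"
          using ray_in_convex[OF B(2,3) 0] by (intro blinfun_apply2_bound AC Bh 0) (auto simp: K_def)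
      qed simp
      also have "\<dots> \<le> 1 * K" using mult_right_mono[of "C * r" 1 K] r K by simp
      finally show ?case by (simp add: aS a0 picard_def)
    next
      case (Suc k)
      have ci: "continuous_on {0..1} (\<lambda>t. A (ray x0 x t) (x - x0) (a k (ray x0 x t)))" for k
        by (intro continuous_intros cAt Suc continuous_on_compose2[OF ca crt memt])
      then have "a (Suc (Suc k)) x - a (Suc k) x = integral {0..1}
          (\<lambda>t. A (ray x0 x t) (x - x0) (a (Suc k) (ray x0 x t)) - A (ray x0 x t) (x - x0) (a k (ray x0 x t)))"
        unfolding aS[of "Suc k"] by (subst (2) aS)
          (simp add: picard_def integral_diff integrable_continuous_interval)
      also have "norm \<dots> \<le> (C * r * (K * (1/2) ^ k)) * (1 - 0)"
      proof (rule integral_bound)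
        fix t :: real assume t: "t \<in> {0..1}"
        have "A (ray x0 x t) (x - x0) (a (Suc k) (ray x0 x t)) - A (ray x0 x t) (x - x0) (a k (ray x0 x t))
          = A (ray x0 x t) (x - x0) (a (Suc k) (ray x0 x t) - a k (ray x0 x t))"
          by (simp add: blinfun.bilinear_simps)
        then show "norm (A (ray x0 x t) (x - x0) (a (Suc k) (ray x0 x t)) - A (ray x0 x t) (x - x0) (a k (ray x0 x t)))
          \<le> C * r * (K * (1/2) ^ k)"
          using ray_in_convex[OF B(2,3) Suc.prems t] Suc by (auto intro!: blinfun_apply2_bound AC Bh)
      qed (auto intro!: continuous_on_diff ci)
      also have "\<dots> \<le> (1/2) * (K * (1/2) ^ k)"
        using mult_right_mono[of "C * r" "1/2" "K * (1/2) ^ k"] r K by simp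
      finally show ?case by simp
    qed
    \<comment> \<open>A defect bound \<open>L/2\<^sup>k\<close> reproduces itself: a step leaves at most \<open>1/4\<close> of it and adds at most
      \<open>C K/2\<^sup>k\<close> from the increment, which is \<open>1/5\<close> of it for this \<open>L\<close>.\<close>
    define L where "L = 5 * C * K"
    have L: "L \<ge> 0" using C K by (simp add: L_def)
    have defect: "norm (E k x v) \<le> L * (1/2) ^ k * norm v" if "x \<in> B" for k x v
      using that
    proof (induction k arbitrary: x v)
      case 0
      have "norm (A x v u0) \<le> C * norm v * K" by (intro blinfun_apply2_bound AC 0) (auto simp: K_def)
      also have "\<dots> \<le> L * norm v" using C K by (simp add: L_def mult.commute mult.left_commute mult_left_mono)
      finally show ?case by (simp add: E_def a0 frechet_derivative_const)
    next
      case (Suc k)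
      let ?e = "L * (1/2) ^ k"
      let ?I = "\<lambda>t. t *\<^sub>R (A (ray x0 x t) (x - x0) (E k (ray x0 x t) v)
               - A (ray x0 x t) v (E k (ray x0 x t) (x - x0)))"
      have "norm (integral {0..1} ?I) \<le> (2 * (C * r * (?e * norm v))) * (1 - 0)"
      proof (rule integral_bound)
        show "continuous_on {0..1} ?I"
          by (intro continuous_intros cAt Suc continuous_on_compose2[OF cE crt memt])
        fix t :: real assume t: "t \<in> {0..1}"
        note y = ray_in_convex[OF B(2,3) Suc.prems t]
        have "norm (A (ray x0 x t) (x - x0) (E k (ray x0 x t) v)) \<le> C * r * (?e * norm v)"
          by (intro blinfun_apply2_bound AC y Bh Suc)
        moreover have "norm (A (ray x0 x t) v (E k (ray x0 x t) (x - x0))) \<le> C * norm v * (?e * r)"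
        proof (intro blinfun_apply2_bound AC y order_refl)
          have "norm (E k (ray x0 x t) (x - x0)) \<le> ?e * norm (x - x0)" by (rule Suc.IH[OF y])
          also have "\<dots> \<le> ?e * r" using L Bh[OF Suc.prems] by (intro mult_left_mono) auto
          finally show "norm (E k (ray x0 x t) (x - x0)) \<le> ?e * r" .
        qed
        ultimately have *: "norm (A (ray x0 x t) (x - x0) (E k (ray x0 x t) v)
               - A (ray x0 x t) v (E k (ray x0 x t) (x - x0))) \<le> 2 * (C * r * (?e * norm v))"
          by (intro order_trans[OF norm_triangle_ineq4]) (simp add: algebra_simps)
        have "norm (?I t) \<le> 1 * norm (A (ray x0 x t) (x - x0) (E k (ray x0 x t) v)
               - A (ray x0 x t) v (E k (ray x0 x t) (x - x0)))"
          using t by (simp add: mult_left_le_one_le)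
        then show "norm (?I t) \<le> 2 * (C * r * (?e * norm v))" using * by simp
      qed simp
      also have "\<dots> \<le> 2 * (1/8 * (?e * norm v))" using mult_right_mono[OF r(3), of "?e * norm v"] L by (simp add: mult_ac)
      finally have I: "norm (integral {0..1} ?I) \<le> 1/4 * (?e * norm v)" by (simp add: mult_ac)
      have J: "norm (A x v (a k x - a (Suc k) x)) \<le> C * norm v * (K * (1/2) ^ k)"
        using delta[OF Suc.prems, of k] by (intro blinfun_apply2_bound AC Suc) (auto simp: norm_minus_commute)
      also have "\<dots> = 1/5 * (?e * norm v)" by (simp add: L_def)
      finally have "norm (E (Suc k) x v) \<le> 1/5 * (?e * norm v) + 1/4 * (?e * norm v)"
        unfolding E_step[OF Suc.prems] using I by (intro norm_triangle_mono)
      also have "\<dots> \<le> 1/2 * (?e * norm v)" using L by (simp add: algebra_simps)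
      finally show ?case by simp
    qed
    have tail: "norm (a (n + j) x - a n x) \<le> 2 * K * (1/2) ^ n * (1 - (1/2) ^ j)" if "x \<in> B" for n j x
    proof (induction j)
      case (Suc j)
      have "norm (a (n + Suc j) x - a n x) \<le> norm (a (Suc (n + j)) x - a (n + j) x) + norm (a (n + j) x - a n x)"
        using norm_triangle_ineq[of "a (Suc (n + j)) x - a (n + j) x" "a (n + j) x - a n x"] by simp
      also have "\<dots> \<le> K * (1/2) ^ (n + j) + 2 * K * (1/2) ^ n * (1 - (1/2) ^ j)"
        using delta[OF that] Suc by (intro add_mono)
      finally show ?case by (simp add: power_add algebra_simps)
    qed simp
    have tail': "norm (a (n + j) x - a n x) \<le> 2 * K * (1/2) ^ n" if "x \<in> B" for n j x
    proof -
      have "2 * K * (1/2) ^ n * (1 - (1/2) ^ j) \<le> 2 * K * (1/2) ^ n * 1"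
        using K by (intro mult_left_mono) auto
      then show ?thesis using tail[OF that, of n j] by simp
    qed
    have small: "\<exists>n. \<forall>m\<ge>n. c * (1/2) ^ m < e" if "e > 0" for c e :: real
    proof -
      have "(\<lambda>m. c * (1/2) ^ m) \<longlonglongrightarrow> c * 0" by (intro tendsto_intros LIMSEQ_power_zero) auto
      then show ?thesis using order_tendstoD(2)[of _ "c * 0" sequentially e] that
        unfolding eventually_sequentially by simp
    qed
    have "\<exists>l. (\<lambda>n. a n x) \<longlonglongrightarrow> l" if "x \<in> B" for x
    proof -
      have "Cauchy (\<lambda>n. a n x)"
      proof (rule CauchyI')
        fix e :: real assume "e > 0"
        then obtain n where n: "\<forall>m\<ge>n. 2 * K * (1/2) ^ m < e" using small by blast
        show "\<exists>M. \<forall>m\<ge>M. \<forall>n>m. dist (a m x) (a n x) < e"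
        proof (intro exI allI impI)
          fix m k assume "m \<ge> n" "k > m"
          then show "dist (a m x) (a k x) < e"
            using tail'[OF that, of m "k - m"] n by (auto simp: dist_norm norm_minus_commute intro: le_less_trans)
        qed
      qed
      then show ?thesis using convergent_def Cauchy_convergent_iff by blast
    qed
    then obtain u where u: "\<And>x. x \<in> B \<Longrightarrow> (\<lambda>n. a n x) \<longlonglongrightarrow> u x" by metis
    have near: "norm (a n x - u x) \<le> 2 * K * (1/2) ^ n" if "x \<in> B" for n x
    proof (rule LIMSEQ_le_const2)
      show "(\<lambda>m. norm (a n x - a m x)) \<longlonglongrightarrow> norm (a n x - u x)" by (intro tendsto_intros u that)
      show "\<exists>N. \<forall>m\<ge>N. norm (a n x - a m x) \<le> 2 * K * (1/2) ^ n"
      proof (intro exI[of _ n] allI impI)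
        fix m assume "m \<ge> n"
        then show "norm (a n x - a m x) \<le> 2 * K * (1/2) ^ n"
          using tail'[OF that, of n "m - n"] by (simp add: norm_minus_commute)
      qed
    qed
    have ax0: "a n x0 = u0" for n by (cases n) (simp_all add: a0 aS picard_def)
    have "\<exists>g. \<forall>x\<in>B. (\<lambda>n. a n x) \<longlonglongrightarrow> g x \<and> (g has_derivative (\<lambda>v. A x v (u x))) (at x within B)"
    proof (rule has_derivative_sequence[where f = a and f' = "\<lambda>n. fderiv (a n)", OF B(2) _ _ B(3) u[OF B(3)]])
      fix n x assume "x \<in> B"
      then show "(a n has_derivative fderiv (a n) x) (at x within B)"
        using da has_derivative_at_withinI by blast
    next
      fix e :: real assume "e > 0"
      then obtain n where n: "\<forall>m\<ge>n. (L + C * (2 * K)) * (1/2) ^ m < e" using small by blast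
      show "\<forall>\<^sub>F n in sequentially. \<forall>x\<in>B. \<forall>h. norm (fderiv (a n) x h - A x h (u x)) \<le> e * norm h"
        unfolding eventually_sequentially
      proof (intro exI[of _ n] allI impI ballI)
        fix m x h assume m: "n \<le> m" and x: "x \<in> B"
        have "fderiv (a m) x h - A x h (u x) = E m x h + A x h (a m x - u x)"
          by (simp add: E_def blinfun.bilinear_simps)
        also have "norm \<dots> \<le> L * (1/2) ^ m * norm h + C * norm h * (2 * K * (1/2) ^ m)"
          by (intro norm_triangle_mono defect x blinfun_apply2_bound AC near) auto
        also have "\<dots> = (L + C * (2 * K)) * (1/2) ^ m * norm h" by (simp add: algebra_simps)
        also have "\<dots> \<le> e * norm h" using n m by (intro mult_right_mono) (auto intro: less_imp_le)
        finally show "norm (fderiv (a m) x h - A x h (u x)) \<le> e * norm h" .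
      qed
    qed
    then obtain g where g: "\<And>x. x \<in> B \<Longrightarrow> (\<lambda>n. a n x) \<longlonglongrightarrow> g x"
      "\<And>x. x \<in> B \<Longrightarrow> (g has_derivative (\<lambda>v. A x v (u x))) (at x within B)" by blast
    have gu: "g x = u x" if "x \<in> B" for x using LIMSEQ_unique[OF g(1) u] that by blast
    have "g x0 = u0" using LIMSEQ_unique[OF g(1)[OF B(3)]] by (simp add: ax0)
    moreover have "(g has_derivative (\<lambda>v. A x v (g x))) (at x)" if "x \<in> B" for x
      using g(2)[OF that] gu[OF that] at_within_open[OF that B(1)] by simp
    ultimately show ?thesis by blast
  qed
  then show ?thesis using r(1) B(4) unfolding B_def by blast
qed

text \<open>The bilinear map \<open>b\<^sup>* \<otimes> c\<^sup>* \<otimes> w\<close>. It depends linearly on \<open>w\<close>, so that an operator-valued function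
  inherits smoothness from its components.\<close>

definition tensor_blinfun :: "'e::euclidean_space \<Rightarrow> 'f::euclidean_space \<Rightarrow> 'f \<Rightarrow> 'e \<Rightarrow>\<^sub>L 'f \<Rightarrow>\<^sub>L 'f" where
  "tensor_blinfun b c w =
     blinfun_scaleR_left (blinfun_scaleR_left w o\<^sub>L blinfun_inner_left c) o\<^sub>L blinfun_inner_left b"

lemma tensor_blinfun_apply: "tensor_blinfun b c w v u = ((v \<bullet> b) * (u \<bullet> c)) *\<^sub>R w"
  by (simp add: tensor_blinfun_def blinfun.bilinear_simps inner_commute)

lemma bounded_linear_tensor_blinfun: "bounded_linear (tensor_blinfun b c)"
proof -
  have "bounded_linear (\<lambda>w. blinfun_scaleR_left w o\<^sub>L blinfun_inner_left c)"
    by (intro bounded_linear_compose[OF bounded_bilinear.bounded_linear_left[OF bounded_bilinear_blinfun_compose]]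
        bounded_linear_blinfun_scaleR_left)
  then have "bounded_linear (\<lambda>w. blinfun_scaleR_left (blinfun_scaleR_left w o\<^sub>L blinfun_inner_left c))"
    by (rule bounded_linear_compose[OF bounded_linear_blinfun_scaleR_left])
  then show ?thesis unfolding tensor_blinfun_def[abs_def]
    by (rule bounded_linear_compose[OF bounded_bilinear.bounded_linear_left[OF bounded_bilinear_blinfun_compose]])
qed

text \<open>The coefficients are repackaged as an operator-valued function. A differentiable solution of the
  system is automatically smooth, since its derivatives are smooth functions of the point and of
  the solution itself.\<close>

theorem integrable_linear_system:
  fixes A :: "'e::euclidean_space \<Rightarrow> 'e \<Rightarrow> 'f::euclidean_space \<Rightarrow> 'f"
  assumes S: "open S" "x0 \<in> S"
    and bil: "\<And>x. x \<in> S \<Longrightarrow> bilinear (A x)"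
    and sm: "\<And>v u. smooth_on S (\<lambda>x. A x v u)"
    and integrable: "\<And>x v w u. x \<in> S \<Longrightarrow>
      fderiv (\<lambda>y. A y v u) x w + A x v (A x w u) = fderiv (\<lambda>y. A y w u) x v + A x w (A x v u)"
  shows "\<exists>r>0. ball x0 r \<subseteq> S \<and> (\<forall>u0. \<exists>u. u x0 = u0 \<and> smooth_on (ball x0 r) u \<and>
    (\<forall>x\<in>ball x0 r. (u has_derivative (\<lambda>v. A x v (u x))) (at x)))"
proof -
  define AA where "AA x = (\<Sum>b\<in>Basis. \<Sum>c\<in>Basis. tensor_blinfun b c (A x b c))" for x
  define AA' where "AA' x = Blinfun (\<lambda>w. \<Sum>b\<in>Basis. \<Sum>c\<in>Basis. tensor_blinfun b c (fderiv (\<lambda>y. A y b c) x w))" for x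
  have expand: "A x v u = (\<Sum>b\<in>Basis. \<Sum>c\<in>Basis. ((v \<bullet> b) * (u \<bullet> c)) *\<^sub>R A x b c)" if "x \<in> S" for x v u
  proof -
    have "A x v u = (\<Sum>b\<in>Basis. (v \<bullet> b) *\<^sub>R A x b u)"
      using bil[OF that] linear_euclidean_expansion[of "\<lambda>v. A x v u" v] by (simp add: bilinear_def)
    also have "\<dots> = (\<Sum>b\<in>Basis. (v \<bullet> b) *\<^sub>R (\<Sum>c\<in>Basis. (u \<bullet> c) *\<^sub>R A x b c))"
      using bil[OF that] linear_euclidean_expansion[of "A x _" u] by (simp add: bilinear_def)
    finally show ?thesis by (simp add: scaleR_sum_right)
  qed
  have AA: "blinfun_apply (blinfun_apply (AA x) v) u = A x v u" if "x \<in> S" for x v u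
    unfolding expand[OF that, of v u] by (simp add: AA_def blinfun.sum_left tensor_blinfun_apply)
  have dd: "(AA has_derivative (\<lambda>w. \<Sum>b\<in>Basis. \<Sum>c\<in>Basis. tensor_blinfun b c (fderiv (\<lambda>y. A y b c) x w))) (at x)"
    if "x \<in> S" for x
    unfolding AA_def[abs_def]
    by (intro has_derivative_sum bounded_linear.has_derivative[OF bounded_linear_tensor_blinfun]
        smooth_on_has_derivative[OF sm that])
  have AA': "blinfun_apply (AA' x) = (\<lambda>w. \<Sum>b\<in>Basis. \<Sum>c\<in>Basis. tensor_blinfun b c (fderiv (\<lambda>y. A y b c) x w))"
    if "x \<in> S" for x
    unfolding AA'_def by (rule bounded_linear_Blinfun_apply[OF has_derivative_bounded_linear[OF dd[OF that]]])
  have cont: "continuous_on S AA'"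
  proof (rule continuous_on_blinfun_componentwise)
    fix w :: 'e
    have "continuous_on S (\<lambda>x. \<Sum>b\<in>Basis. \<Sum>c\<in>Basis. tensor_blinfun b c (fderiv (\<lambda>y. A y b c) x w))"
      by (intro continuous_on_sum bounded_linear.continuous_on[OF bounded_linear_tensor_blinfun]
          smooth_on_imp_continuous_on smooth_on_fderiv sm)
    then show "continuous_on S (\<lambda>x. AA' x w)" by (rule continuous_on_eq) (simp add: AA')
  qed
  have AA'_apply: "AA' x w v u = fderiv (\<lambda>y. A y v u) x w" if "x \<in> S" for x w v u
  proof -
    have "((\<lambda>y. AA y v u) has_derivative (\<lambda>w. AA' x w v u)) (at x)"
      using dd[OF that] unfolding AA'[OF that, symmetric]
      by (auto intro!: derivative_eq_intros simp: blinfun.bilinear_simps)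
    then have "((\<lambda>y. A y v u) has_derivative (\<lambda>w. AA' x w v u)) (at x)"
      by (rule has_derivative_transform_within_open[OF _ S(1) that]) (simp add: AA)
    then show ?thesis using fderiv_eq by metis
  qed
  obtain r where r: "r > 0" "ball x0 r \<subseteq> S"
    and sol: "\<And>u0. \<exists>u. u x0 = u0 \<and> (\<forall>x\<in>ball x0 r. (u has_derivative (\<lambda>v. AA x v (u x))) (at x))"
  proof -
    have "\<exists>r>0. ball x0 r \<subseteq> S \<and> (\<forall>u0. \<exists>u. u x0 = u0 \<and>
      (\<forall>x\<in>ball x0 r. (u has_derivative (\<lambda>v. AA x v (u x))) (at x)))"
    proof (rule integrable_linear_system_C1[OF S _ cont])
      fix x assume x: "x \<in> S"
      show "(AA has_derivative blinfun_apply (AA' x)) (at x)"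
        using dd[OF x] by (simp only: AA'[OF x])
      show "AA' x w v u + AA x v (AA x w u) = AA' x v w u + AA x w (AA x v u)" for v w u
        by (simp only: AA[OF x] AA'_apply[OF x] integrable[OF x])
    qed
    then show ?thesis using that by blast
  qed
  have "\<exists>u. u x0 = u0 \<and> smooth_on (ball x0 r) u \<and>
    (\<forall>x\<in>ball x0 r. (u has_derivative (\<lambda>v. A x v (u x))) (at x))" for u0
  proof -
    obtain u where u: "u x0 = u0" and du: "\<forall>x\<in>ball x0 r. (u has_derivative (\<lambda>v. AA x v (u x))) (at x)"
      using sol by blast
    have "Ck_on k u (ball x0 r)" for k
    proof (induction k)
      case 0
      show ?case using du by (auto intro!: continuous_at_imp_continuous_on has_derivative_continuous)
    next
      case (Suc k)
      show ?case
      proof (rule Ck_on_SucI)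
        fix v
        have sk: "Ck_on k (\<lambda>x. A x b c) (ball x0 r)" for b c
          using sm[of b c] Ck_on_subset[OF _ r(2)] unfolding smooth_on_def by blast
        have "Ck_on k (\<lambda>x. \<Sum>b\<in>Basis. \<Sum>c\<in>Basis. ((v \<bullet> b) *\<^sub>R (u x \<bullet> c)) *\<^sub>R A x b c) (ball x0 r)"
          by (intro Ck_on_sum Ck_on_bounded_bilinear[OF _ bounded_bilinear_scaleR] sk Ck_on_const
              Ck_on_bounded_linear[OF _ bounded_linear_inner_left] Suc open_ball)
        then show "Ck_on k (\<lambda>x. AA x v (u x)) (ball x0 r)"
          by (rule Ck_on_cong[THEN iffD1, rotated -1]) (use r(2) in \<open>auto simp: AA expand[of _ v]\<close>)
      qed (use du in auto)
    qed
    moreover have "(u has_derivative (\<lambda>v. A x v (u x))) (at x)" if "x \<in> ball x0 r" for x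
    proof -
      have "x \<in> S" using that r(2) by blast
      then have "(\<lambda>v. AA x v (u x)) = (\<lambda>v. A x v (u x))" by (simp add: AA)
      then show ?thesis using du that by (metis (no_types, lifting))
    qed
    ultimately show ?thesis using u unfolding smooth_on_def by blast
  qed
  then show ?thesis using r by blast
qed

section \<open>Functions and vector fields in a coordinate chart\<close>

lemma chart_openin: "is_chart T c \<Longrightarrow> openin T (fst c)"
  and chart_open_image: "is_chart T c \<Longrightarrow> open (snd c ` fst c)"
  by (simp_all add: is_chart_def)

lemma chart_topspace: "is_chart T c \<Longrightarrow> topspace (subtopology T (fst c)) = fst c"
  using openin_subset[OF chart_openin[of T c]] by (simp add: topspace_subtopology Int_absorb1)

lemma chart_inj: assumes "is_chart T c" shows "inj_on (snd c) (fst c)"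
proof -
  have "inj_on (snd c) (topspace (subtopology T (fst c)))"
    using assms homeomorphic_imp_injective_map unfolding is_chart_def by blast
  then show ?thesis using chart_topspace[OF assms] by simp
qed

lemma chart_inv_snd: "is_chart T c \<Longrightarrow> q \<in> fst c \<Longrightarrow> chart_inv c (snd c q) = q"
  by (simp add: chart_inv_def chart_inj)

lemma snd_chart_inv: "y \<in> snd c ` fst c \<Longrightarrow> snd c (chart_inv c y) = y"
  by (simp add: chart_inv_def f_inv_into_f)

lemma chart_inv_in: "y \<in> snd c ` fst c \<Longrightarrow> chart_inv c y \<in> fst c"
  by (simp add: chart_inv_def inv_into_into)

lemma chart_image_open:
  assumes "is_chart T c" "openin T V" "V \<subseteq> fst c"
  shows "open (snd c ` V)"
proof -
  have "open_map (subtopology T (fst c)) (top_of_set (snd c ` fst c)) (snd c)"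
    using assms(1) homeomorphic_imp_open_map unfolding is_chart_def by blast
  moreover have "openin (subtopology T (fst c)) V"
    using assms by (simp add: openin_open_subtopology chart_openin)
  ultimately have "openin (top_of_set (snd c ` fst c)) (snd c ` V)" by (simp add: open_map_def)
  then show ?thesis using chart_open_image[OF assms(1)] by (simp add: openin_open_eq)
qed

lemma chart_inv_image_openin:
  assumes "is_chart T c" "open W" "W \<subseteq> snd c ` fst c"
  shows "openin T (chart_inv c ` W)"
proof -
  have cont: "continuous_map (subtopology T (fst c)) (top_of_set (snd c ` fst c)) (snd c)"
    using assms(1) homeomorphic_imp_continuous_map unfolding is_chart_def by blast
  have "openin (top_of_set (snd c ` fst c)) W"
    using assms chart_open_image[OF assms(1)] by (simp add: openin_open_eq)
  from openin_continuous_map_preimage[OF cont this]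
  have "openin (subtopology T (fst c)) {q \<in> fst c. snd c q \<in> W}"
    unfolding chart_topspace[OF assms(1)] .
  moreover have "{q \<in> fst c. snd c q \<in> W} = chart_inv c ` W"
    using assms(3) chart_inv_snd[OF assms(1)] snd_chart_inv[of _ c] chart_inv_in[of _ c]
    by (force simp: image_iff)
  ultimately show ?thesis
    using assms(1) by (simp add: openin_open_subtopology chart_openin)
qed

lemma chart_image_inv_image:
  assumes "W \<subseteq> snd c ` fst c" shows "snd c ` chart_inv c ` W = W"
proof -
  have "(\<lambda>y. snd c (chart_inv c y)) ` W = (\<lambda>y. y) ` W"
    by (rule image_cong) (use assms snd_chart_inv[of _ c] in auto)
  then show ?thesis by (simp add: image_image)
qed

lemma smooth_fun_subset:
  assumes "smooth_fun M V f" "openin (mtop M) W" "W \<subseteq> V"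
  shows "smooth_fun M W f"
  unfolding smooth_fun_def
proof (intro conjI ballI assms(2))
  fix d assume "d \<in> atlas M"
  then have "smooth_on (snd d ` (fst d \<inter> V)) (f \<circ> chart_inv d)" using assms(1) by (simp add: smooth_fun_def)
  then show "smooth_on (snd d ` (fst d \<inter> W)) (f \<circ> chart_inv d)"
    by (rule smooth_on_subset) (use assms(3) in auto)
qed

lemma smooth_vf_subset:
  "smooth_vf M V X \<Longrightarrow> openin (mtop M) W \<Longrightarrow> W \<subseteq> V \<Longrightarrow> smooth_vf M W X"
  unfolding smooth_vf_def by blast

lemma smooth_fun_imp_smooth_at: "smooth_fun M V f \<Longrightarrow> q \<in> V \<Longrightarrow> smooth_at M q f"
  unfolding smooth_at_def by blast

lemma atlas_local_coordinates:
  assumes "smooth_manifold M" "c \<in> atlas M" shows "local_coordinates M c"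
  using assms unfolding local_coordinates_def smooth_manifold_def by blast

locale local_chart =
  fixes M :: "('a, 'm::finite) manifold" and c :: "('a, 'm) chart"
  assumes manifold: "smooth_manifold M" and coords: "local_coordinates M c"
begin

abbreviation "U \<equiv> fst c"
abbreviation "x \<equiv> snd c"
abbreviation "\<Omega> \<equiv> snd c ` fst c"
abbreviation "pt \<equiv> chart_inv c"
abbreviation "cvec \<equiv> coord_vec M c"

text \<open>Vector fields on the chart domain are handled through their components, which are functions
  on coordinate space.\<close>

definition cfield :: "(real ^ 'm \<Rightarrow> real ^ 'm) \<Rightarrow> 'a vfield" where
  "cfield a q = cvec (a (x q)) q"

lemma chart: "is_chart (mtop M) c"
  using coords by (simp add: local_coordinates_def)

lemmas openU = chart_openin[OF chart]
  and open_image = chart_image_open[OF chart]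
  and pt_x[simp] = chart_inv_snd[OF chart]
  and x_pt[simp] = snd_chart_inv[of _ c]
  and pt_in[simp] = chart_inv_in[of _ c]
  and open\<Omega> = chart_open_image[OF chart]

lemma compatible: "d \<in> atlas M \<Longrightarrow> compatible_charts c d"
  using coords by (simp add: local_coordinates_def)

text \<open>Smoothness is defined by the charts of the atlas, but by compatibility it can be tested in any
  chart of the maximal atlas.\<close>

lemma smooth_fun_iff:
  assumes V: "openin (mtop M) V" "V \<subseteq> U"
  shows "smooth_fun M V f \<longleftrightarrow> smooth_on (x ` V) (f \<circ> pt)"
proof
  assume f: "smooth_fun M V f"
  show "smooth_on (x ` V) (f \<circ> pt)"
  proof (rule smooth_on_local)
    fix y assume "y \<in> x ` V"
    then obtain q where q: "q \<in> V" "y = x q" by auto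
    then have "q \<in> (\<Union>c\<in>atlas M. fst c)"
      using manifold openin_subset[OF V(1)] unfolding smooth_manifold_def by auto
    then obtain d where d: "d \<in> atlas M" "q \<in> fst d" by blast
    have cd: "is_chart (mtop M) d" using d manifold by (simp add: smooth_manifold_def)
    define W where "W = x ` (U \<inter> fst d \<inter> V)"
    have W: "open W" unfolding W_def
      by (rule open_image) (use V openU chart_openin[OF cd] in auto)
    have oD: "open (snd d ` (fst d \<inter> V))"
      by (rule chart_image_open[OF cd]) (use V chart_openin[OF cd] in auto)
    have "smooth_on W (\<lambda>y. (f \<circ> chart_inv d) ((snd d \<circ> pt) y))"
    proof (rule smooth_on_compose[OF W oD])
      show "smooth_on W (snd d \<circ> pt)"
        using compatible[OF d(1)] unfolding compatible_charts_def W_def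
        by (auto elim!: smooth_on_subset)
      show "smooth_on (snd d ` (fst d \<inter> V)) (f \<circ> chart_inv d)"
        using f d by (simp add: smooth_fun_def)
      show "(snd d \<circ> pt) y \<in> snd d ` (fst d \<inter> V)" if "y \<in> W" for y
        using that V by (auto simp: W_def)
    qed
    moreover have "(f \<circ> chart_inv d) ((snd d \<circ> pt) y) = (f \<circ> pt) y" if "y \<in> W" for y
      using that chart_inv_snd[OF cd] by (auto simp: W_def)
    ultimately have "smooth_on W (f \<circ> pt)"
      using smooth_on_cong[OF W] by (metis (no_types, lifting))
    moreover have "y \<in> W" using q d V by (auto simp: W_def)
    ultimately show "\<exists>W. open W \<and> y \<in> W \<and> smooth_on W (f \<circ> pt)" using W by blast
  qed
next
  assume f: "smooth_on (x ` V) (f \<circ> pt)"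
  show "smooth_fun M V f"
    unfolding smooth_fun_def
  proof (intro conjI ballI V)
    fix d assume d: "d \<in> atlas M"
    have cd: "is_chart (mtop M) d" using d manifold by (simp add: smooth_manifold_def)
    have oD: "open (snd d ` (fst d \<inter> V))"
      by (rule chart_image_open[OF cd]) (use V chart_openin[OF cd] in auto)
    have "smooth_on (snd d ` (fst d \<inter> V)) (\<lambda>y. (f \<circ> pt) ((x \<circ> chart_inv d) y))"
    proof (rule smooth_on_compose[OF oD open_image[OF V] _ f])
      show "smooth_on (snd d ` (fst d \<inter> V)) (x \<circ> chart_inv d)"
        using compatible[OF d] V unfolding compatible_charts_def
        by (auto elim!: smooth_on_subset)
      show "(x \<circ> chart_inv d) y \<in> x ` V" if "y \<in> snd d ` (fst d \<inter> V)" for y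
        using that chart_inv_snd[OF cd] by auto
    qed
    moreover have "(f \<circ> pt) ((x \<circ> chart_inv d) y) = (f \<circ> chart_inv d) y" if "y \<in> snd d ` (fst d \<inter> V)" for y
      using that V chart_inv_snd[OF cd] by (auto simp: subset_iff)
    ultimately show "smooth_on (snd d ` (fst d \<inter> V)) (f \<circ> chart_inv d)"
      using smooth_on_cong[OF oD] by (metis (no_types, lifting))
  qed
qed

lemma smooth_funI:
  assumes "openin (mtop M) V" "V \<subseteq> U" "smooth_on (x ` V) F" "\<And>q. q \<in> V \<Longrightarrow> f q = F (x q)"
  shows "smooth_fun M V f"
proof -
  have "smooth_on (x ` V) (f \<circ> pt) \<longleftrightarrow> smooth_on (x ` V) F"
    by (rule smooth_on_cong[OF open_image[OF assms(1,2)]]) (use assms(2,4) in \<open>auto simp: subset_iff\<close>)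
  then show ?thesis using assms smooth_fun_iff by simp
qed

lemma smooth_at_nbhd:
  assumes "smooth_at M q f" "q \<in> U"
  obtains V where "openin (mtop M) V" "V \<subseteq> U" "q \<in> V" "smooth_fun M V f"
proof -
  obtain W where "q \<in> W" "smooth_fun M W f" using assms(1) unfolding smooth_at_def by blast
  moreover have "openin (mtop M) (W \<inter> U)"
    using \<open>smooth_fun M W f\<close> openU by (auto simp: smooth_fun_def)
  ultimately show ?thesis using assms(2) by (intro that[of "W \<inter> U"]) (auto intro: smooth_fun_subset)
qed

lemma smooth_at_has_derivative:
  assumes "smooth_at M q f" "q \<in> U"
  shows "(f \<circ> pt has_derivative fderiv (f \<circ> pt) (x q)) (at (x q))"
  using smooth_at_nbhd[OF assms] smooth_fun_iff smooth_on_has_derivative by (metis imageI)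

lemma cvec_apply:
  assumes "smooth_fun M V f" "V \<subseteq> U" "q \<in> V" "\<And>r. r \<in> V \<Longrightarrow> f r = F (x r)"
  shows "cvec a q f = fderiv F (x q) a"
proof -
  have "openin (mtop M) V" using assms(1) by (simp add: smooth_fun_def)
  then have "open (x ` V)" using assms(2) open_image by blast
  then have "fderiv (f \<circ> pt) (x q) = fderiv F (x q)"
    by (rule fderiv_cong_open) (use assms in \<open>auto simp: subset_iff\<close>)
  then show ?thesis
    using smooth_fun_imp_smooth_at[OF assms(1,3)] by (simp add: coord_vec_def)
qed

lemma coord_smooth: "smooth_fun M U (coord c i)"
  by (rule smooth_funI[OF openU, of "\<lambda>y. y $ i"])
    (auto simp: coord_def intro!: smooth_on_vec_nth smooth_on_ident open\<Omega>)

text \<open>Evaluation on the coordinate functions recovers the components of a tangent vector, and so makes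
  the parametrisation of tangent vectors by their components injective.\<close>

lemma cvec_coord: "q \<in> U \<Longrightarrow> cvec a q (coord c i) = a $ i"
proof -
  assume "q \<in> U"
  then have "cvec a q (coord c i) = fderiv (\<lambda>y. y $ i) (x q) a"
    by (intro cvec_apply[OF coord_smooth]) (auto simp: coord_def)
  also have "\<dots> = a $ i"
    using fderiv_eq[OF bounded_linear_imp_has_derivative[OF bounded_linear_vec_nth[of i]]] by metis
  finally show ?thesis .
qed

lemma cvec_inject: "q \<in> U \<Longrightarrow> cvec a q = cvec b q \<longleftrightarrow> a = b"
  by (metis cvec_coord vec_eq_iff)

lemma cvec_add: "q \<in> U \<Longrightarrow> cvec (a + b) q = (\<lambda>f. cvec a q f + cvec b q f)"
  using smooth_at_has_derivative[THEN has_derivative_linear]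
  by (auto simp: coord_vec_def linear_add)

lemma cvec_scaleR: "q \<in> U \<Longrightarrow> cvec (s *\<^sub>R a) q = (\<lambda>f. s * cvec a q f)"
  using smooth_at_has_derivative[THEN has_derivative_linear]
  by (auto simp: coord_vec_def linear_cmul)

lemma cvec_0: "q \<in> U \<Longrightarrow> cvec 0 q = zero_tvec"
  using cvec_scaleR[of q 0 0] by (auto simp: zero_tvec_def)

lemma cvec_eq_zero: "q \<in> U \<Longrightarrow> cvec a q = zero_tvec \<longleftrightarrow> a = 0"
  using cvec_0 cvec_inject by metis

lemma cvec_sum: "q \<in> U \<Longrightarrow> cvec (\<Sum>i\<in>I. h i *\<^sub>R w i) q = (\<lambda>f. \<Sum>i\<in>I. h i * cvec (w i) q f)"
  by (induction I rule: infinite_finite_induct) (auto simp: cvec_0 cvec_add cvec_scaleR zero_tvec_def)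

lemma coord_field_cfield: "coord_field M c i = cfield (\<lambda>_. axis i 1)"
  by (simp add: fun_eq_iff coord_field_def cfield_def)

lemma sum_axis: "(\<Sum>i\<in>UNIV. v $ i *\<^sub>R axis i 1) = (v :: real ^ 'm)"
  using basis_expansion[of v] by (simp add: scalar_mult_eq_scaleR)

lemma euler_field_eq: "q \<in> U \<Longrightarrow> euler_field M c q = cvec (x q) q"
  using cvec_sum[of q "\<lambda>i. x q $ i" "\<lambda>i. axis i 1" UNIV]
  by (simp add: euler_field_def coord_field_def coord_def sum_axis)

end

lemma coord_vec_change:
  assumes "local_chart M c" "local_chart M d" and q: "q \<in> fst c" "q \<in> fst d"
    and sm: "smooth_on (snd d ` (fst c \<inter> fst d)) (snd c \<circ> chart_inv d)"
  shows "coord_vec M d a q = coord_vec M c (fderiv (snd c \<circ> chart_inv d) (snd d q) a) q"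
proof
  interpret c: local_chart M c by fact
  interpret d: local_chart M d by fact
  fix f
  show "coord_vec M d a q f = coord_vec M c (fderiv (snd c \<circ> chart_inv d) (snd d q) a) q f"
  proof (cases "smooth_at M q f")
    case True
    have tr: "(snd c \<circ> chart_inv d) (snd d q) = snd c q" using q by simp
    have "(snd c \<circ> chart_inv d has_derivative fderiv (snd c \<circ> chart_inv d) (snd d q)) (at (snd d q))"
      by (rule smooth_on_has_derivative[OF sm]) (use q in auto)
    moreover have "(f \<circ> c.pt has_derivative fderiv (f \<circ> c.pt) (snd c q)) (at ((snd c \<circ> chart_inv d) (snd d q)))"
      unfolding tr by (rule c.smooth_at_has_derivative[OF True q(1)])
    ultimately have "((\<lambda>y. (f \<circ> c.pt) ((snd c \<circ> chart_inv d) y)) has_derivative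
       (\<lambda>v. fderiv (f \<circ> c.pt) (snd c q) (fderiv (snd c \<circ> chart_inv d) (snd d q) v))) (at (snd d q))"
      by (rule has_derivative_compose)
    from fderiv_eq[OF this]
    have "fderiv (\<lambda>y. (f \<circ> c.pt) ((snd c \<circ> chart_inv d) y)) (snd d q) a
      = fderiv (f \<circ> c.pt) (snd c q) (fderiv (snd c \<circ> chart_inv d) (snd d q) a)" by simp
    moreover have "fderiv (\<lambda>y. (f \<circ> c.pt) ((snd c \<circ> chart_inv d) y)) (snd d q) = fderiv (f \<circ> d.pt) (snd d q)"
    proof (rule fderiv_cong_open)
      show "open (snd d ` (fst c \<inter> fst d))"
        by (rule d.open_image) (use c.openU d.openU in auto)
    qed (use q in auto)
    ultimately show ?thesis by (simp add: coord_vec_def True)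
  qed (simp add: coord_vec_def)
qed

context local_chart
begin

lemma tangent_space_eq: "q \<in> U \<Longrightarrow> tangent_space M q = range (\<lambda>a. cvec a q)"
proof -
  assume q: "q \<in> U"
  have self: "local_chart M c" by unfold_locales
  have at: "local_chart M d" if "d \<in> atlas M" for d
    using atlas_local_coordinates[OF manifold that] manifold by unfold_locales
  have sub: "coord_vec M d a q \<in> range (\<lambda>a. cvec a q)" if "d \<in> atlas M" "q \<in> fst d" for d a
    using coord_vec_change[OF self at[OF that(1)] q that(2), of a] compatible[OF that(1)]
    by (auto simp: compatible_charts_def)
  have "q \<in> (\<Union>c\<in>atlas M. fst c)"
    using manifold openin_subset[OF openU] q unfolding smooth_manifold_def by auto
  then obtain d where d: "d \<in> atlas M" "q \<in> fst d" by blast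
  have "cvec a q = coord_vec M d (fderiv (snd d \<circ> pt) (x q) a) q" for a
    using coord_vec_change[OF at[OF d(1)] self d(2) q, of a] compatible[OF d(1)]
    by (simp add: compatible_charts_def Int_commute)
  then show ?thesis using d sub unfolding tangent_space_def by fast
qed

lemma smooth_vf_cfield:
  assumes "openin (mtop M) V" "V \<subseteq> U" "smooth_on (x ` V) a" "\<And>q. q \<in> V \<Longrightarrow> X q = cfield a q"
  shows "smooth_vf M V X"
  unfolding smooth_vf_def
proof (intro conjI ballI allI impI)
  fix q assume "q \<in> V"
  then show "X q \<in> tangent_space M q"
    using assms(2,4) tangent_space_eq[of q] by (auto simp: cfield_def)
next
  fix W f assume W: "W \<subseteq> V" "smooth_fun M W f"
  have oW: "openin (mtop M) W" and WU: "W \<subseteq> U" using W assms(2) by (auto simp: smooth_fun_def)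
  show "smooth_fun M W (\<lambda>q. X q f)"
  proof (rule smooth_funI[OF oW WU])
    show "smooth_on (x ` W) (\<lambda>y. fderiv (f \<circ> pt) y (a y))"
      using W oW WU smooth_fun_iff[OF oW WU] assms(3)
      by (intro smooth_on_fderiv_along open_image) (auto elim!: smooth_on_subset)
    show "X q f = fderiv (f \<circ> pt) (x q) (a (x q))" if "q \<in> W" for q
      using that W assms(4) WU smooth_fun_imp_smooth_at[OF W(2) that]
      by (auto simp: cfield_def coord_vec_def)
  qed
qed (fact assms(1))

text \<open>The components of a smooth vector field are its derivatives of the coordinate functions, which
  are smooth on the chart domain.\<close>

lemma smooth_vf_obtain:
  assumes "smooth_vf M V X" "V \<subseteq> U"
  obtains a where "smooth_on (x ` V) a" "\<And>q. q \<in> V \<Longrightarrow> X q = cfield a q"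
proof
  define a where "a y = (\<chi> i. X (pt y) (coord c i))" for y
  have V: "openin (mtop M) V" using assms(1) by (simp add: smooth_vf_def)
  show "smooth_on (x ` V) a"
  proof (rule smooth_on_vecI[OF open_image[OF V assms(2)]])
    fix i
    have "smooth_fun M V (\<lambda>q. X q (coord c i))"
      using assms(1) smooth_fun_subset[OF coord_smooth V assms(2)] unfolding smooth_vf_def by blast
    then show "smooth_on (x ` V) (\<lambda>y. a y $ i)"
      using smooth_fun_iff[OF V assms(2)] by (simp add: a_def o_def)
  qed
  fix q assume q: "q \<in> V"
  then obtain b where "X q = cvec b q"
    using assms tangent_space_eq[of q] unfolding smooth_vf_def by blast
  moreover have "a (x q) = b"
    using q assms(2) calculation by (auto simp: a_def vec_eq_iff cvec_coord subset_iff)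
  ultimately show "X q = cfield a q" by (simp add: cfield_def)
qed

lemma cfield_const_smooth: "openin (mtop M) V \<Longrightarrow> V \<subseteq> U \<Longrightarrow> smooth_vf M V (cfield (\<lambda>_. v))"
  by (rule smooth_vf_cfield) (auto intro: smooth_on_const)

text \<open>Constant fields commute because second derivatives do.\<close>

lemma lie_bracket_const:
  assumes q: "q \<in> U"
  shows "lie_bracket M (cfield (\<lambda>_. v)) (cfield (\<lambda>_. w)) q = zero_tvec"
proof
  fix f
  show "lie_bracket M (cfield (\<lambda>_. v)) (cfield (\<lambda>_. w)) q f = zero_tvec f"
  proof (cases "smooth_at M q f")
    case True
    obtain V where V: "openin (mtop M) V" "V \<subseteq> U" "q \<in> V" "smooth_fun M V f"
      using smooth_at_nbhd[OF True q] .
    have sm: "smooth_on (x ` V) (f \<circ> pt)" using smooth_fun_iff[OF V(1,2)] V(4) by simp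
    have *: "cvec a q (\<lambda>r. cfield (\<lambda>_. b) r f) = fderiv (\<lambda>y. fderiv (f \<circ> pt) y b) (x q) a" for a b
    proof (rule cvec_apply[OF _ V(2,3)])
      show "smooth_fun M V (\<lambda>r. cfield (\<lambda>_. b) r f)"
        using cfield_const_smooth[OF V(1,2)] V(4) unfolding smooth_vf_def by blast
      show "cfield (\<lambda>_. b) r f = fderiv (f \<circ> pt) (x r) b" if "r \<in> V" for r
        using that smooth_fun_imp_smooth_at[OF V(4)] by (simp add: cfield_def coord_vec_def)
    qed
    have "fderiv (\<lambda>y. fderiv (f \<circ> pt) y w) (x q) v = fderiv (\<lambda>y. fderiv (f \<circ> pt) y v) (x q) w"
      by (rule fderiv_commute[OF open_image[OF V(1,2)] sm]) (use V in auto)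
    then have "cvec v q (\<lambda>r. cfield (\<lambda>_. w) r f) = cvec w q (\<lambda>r. cfield (\<lambda>_. v) r f)"
      by (simp only: *)
    then show ?thesis
      by (simp add: lie_bracket_def zero_tvec_def cfield_def[of _ q])
  qed (simp add: lie_bracket_def zero_tvec_def)
qed

text \<open>With this lemma, new coordinates can be constructed by analysis in coordinate space alone.\<close>

lemma reparametrise:
  assumes W: "open W" "W \<subseteq> \<Omega>" and F: "smooth_on W F" "open (F ` W)"
    and G: "smooth_on (F ` W) G" "\<And>y. y \<in> W \<Longrightarrow> G (F y) = y"
  defines "d \<equiv> (pt ` W, F \<circ> x)"
  shows "local_coordinates M d" "snd d ` fst d = F ` W"
    "\<And>z. z \<in> F ` W \<Longrightarrow> chart_inv d z = pt (G z)"
proof -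
  have injF: "inj_on F W" by (rule inj_on_inverseI) (rule G)
  have oV: "openin (mtop M) (pt ` W)" by (rule chart_inv_image_openin[OF chart W])
  have VU: "pt ` W \<subseteq> U" using W by auto
  have xV: "x ` pt ` W = W" by (rule chart_image_inv_image[OF W(2)])
  show im: "snd d ` fst d = F ` W" by (simp only: d_def fst_conv snd_conv image_comp[symmetric] xV)
  have inj: "inj_on (snd d) (fst d)"
    using injF VU chart_inj[OF chart] by (simp add: d_def comp_inj_on_iff[symmetric] xV inj_on_subset)
  show inv: "chart_inv d z = pt (G z)" if "z \<in> F ` W" for z
  proof -
    obtain y where y: "y \<in> W" "z = F y" using \<open>z \<in> F ` W\<close> by blast
    then have "pt y \<in> fst d" "snd d (pt y) = z" using W by (auto simp: d_def)
    then have "chart_inv d z = pt y" using inv_into_f_f[OF inj] unfolding chart_inv_def by metis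
    then show ?thesis using y G by simp
  qed
  have ch: "is_chart (mtop M) d"
    unfolding is_chart_def
  proof (intro conjI)
    show "openin (mtop M) (fst d)" using oV by (simp add: d_def)
    show "open (snd d ` fst d)" using F(2) im by simp
    have "homeomorphic_map (subtopology (subtopology (mtop M) U) (pt ` W)) (subtopology (top_of_set \<Omega>) W) x"
    proof (rule homeomorphic_map_subtopologies)
      show "homeomorphic_map (subtopology (mtop M) U) (top_of_set \<Omega>) x" using chart by (simp add: is_chart_def)
      have "topspace (subtopology (mtop M) U) \<inter> pt ` W = pt ` W"
        using VU chart_topspace[OF chart] by auto
      moreover have "topspace (top_of_set \<Omega>) \<inter> W = W" using W by auto
      ultimately show "x ` (topspace (subtopology (mtop M) U) \<inter> pt ` W) = topspace (top_of_set \<Omega>) \<inter> W"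
        using xV by simp
    qed
    then have 1: "homeomorphic_map (subtopology (mtop M) (pt ` W)) (top_of_set W) x"
      using VU W by (simp add: subtopology_subtopology Int_absorb1)
    have "homeomorphic_maps (top_of_set W) (top_of_set (F ` W)) F G"
      using smooth_on_imp_continuous_on[OF F(1)] smooth_on_imp_continuous_on[OF G(1)] G(2)
      by (auto simp: homeomorphic_maps_def)
    then have 2: "homeomorphic_map (top_of_set W) (top_of_set (F ` W)) F"
      using homeomorphic_map_maps by blast
    show "homeomorphic_map (subtopology (mtop M) (fst d)) (top_of_set (snd d ` fst d)) (snd d)"
      using homeomorphic_map_compose[OF 1 2] im by (simp add: d_def)
  qed
  show "local_coordinates M d"
    unfolding local_coordinates_def
  proof (intro conjI ballI ch)
    fix e assume e: "e \<in> atlas M"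
    have ce: "is_chart (mtop M) e" using e manifold by (simp add: smooth_manifold_def)
    note comp = compatible[OF e, unfolded compatible_charts_def]
    have o: "openin (mtop M) (fst d \<inter> fst e)" using oV chart_openin[OF ce] by (auto simp: d_def)
    have o1: "open (snd d ` (fst d \<inter> fst e))" by (rule chart_image_open[OF ch o]) auto
    have o2: "open (snd e ` (fst d \<inter> fst e))" by (rule chart_image_open[OF ce o]) auto
    have o3: "open (x ` (U \<inter> fst e))" by (rule open_image) (use openU chart_openin[OF ce] in auto)
    have s1: "snd d ` (fst d \<inter> fst e) \<subseteq> F ` W" using im by blast
    have dU: "fst d \<subseteq> U" using VU by (simp add: d_def)
    have Gx: "G (snd d q) = x q" if "q \<in> fst d" for q
      using that W G(2) by (auto simp: d_def)
    have "smooth_on (snd d ` (fst d \<inter> fst e)) (\<lambda>z. (snd e \<circ> pt) (G z))"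
    proof (rule smooth_on_compose[OF o1 o3 smooth_on_subset[OF G(1) s1]])
      show "smooth_on (x ` (U \<inter> fst e)) (snd e \<circ> pt)" using comp by blast
      show "G z \<in> x ` (U \<inter> fst e)" if "z \<in> snd d ` (fst d \<inter> fst e)" for z
        using that Gx dU by auto
    qed
    then have A: "smooth_on (snd d ` (fst d \<inter> fst e)) (snd e \<circ> chart_inv d)"
      by (rule smooth_on_cong[OF o1, THEN iffD1, rotated]) (use inv s1 in auto)
    have "smooth_on (snd e ` (fst d \<inter> fst e)) (\<lambda>z. F ((x \<circ> chart_inv e) z))"
    proof (rule smooth_on_compose[OF o2 W(1) _ F(1)])
      show "smooth_on (snd e ` (fst d \<inter> fst e)) (x \<circ> chart_inv e)"
        using comp dU by (auto elim!: smooth_on_subset)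
      show "(x \<circ> chart_inv e) z \<in> W" if "z \<in> snd e ` (fst d \<inter> fst e)" for z
        using that chart_inv_snd[OF ce] xV by (auto simp: d_def)
    qed
    then have "smooth_on (snd e ` (fst d \<inter> fst e)) (snd d \<circ> chart_inv e)"
      by (simp add: d_def o_def)
    then show "compatible_charts d e" using A by (simp add: compatible_charts_def)
  qed
qed

end

section \<open>Connections in a chart\<close>

locale affine_chart = local_chart M c
  for M :: "('a, 'm::finite) manifold" and c :: "('a, 'm) chart" +
  fixes nabla :: "'a vfield \<Rightarrow> 'a vfield \<Rightarrow> 'a vfield"
  assumes connection: "affine_connection M nabla"
begin

lemmas connection_axioms = connection[unfolded affine_connection_def]
lemmas nabla_smooth = connection_axioms[THEN conjunct1, rule_format]
lemmas nabla_cong =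
  connection_axioms[THEN conjunct2, THEN conjunct1, rule_format]
lemmas nabla_add_left =
  connection_axioms[THEN conjunct2, THEN conjunct2, THEN conjunct1, rule_format]
lemmas nabla_mult_left =
  connection_axioms[THEN conjunct2, THEN conjunct2, THEN conjunct2, THEN conjunct1, rule_format]
lemmas nabla_add_right =
  connection_axioms[THEN conjunct2, THEN conjunct2, THEN conjunct2, THEN conjunct2, THEN conjunct1, rule_format]
lemmas nabla_mult_right =
  connection_axioms[THEN conjunct2, THEN conjunct2, THEN conjunct2, THEN conjunct2, THEN conjunct2, rule_format]

lemma smooth_fun_coord:
  assumes "openin (mtop M) V" "V \<subseteq> U" "smooth_on (x ` V) h"
  shows "smooth_fun M V (\<lambda>r. h (x r))"
  using assms by (rule smooth_funI) simp

lemma cvec_apply_coord: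
  assumes "openin (mtop M) V" "V \<subseteq> U" "smooth_on (x ` V) h" "q \<in> V"
  shows "cvec a q (\<lambda>r. h (x r)) = fderiv h (x q) a"
  by (rule cvec_apply[OF smooth_fun_coord[OF assms(1-3)] assms(2,4)]) simp

text \<open>The axioms of a connection are about sums and multiples of vector fields as total functions, while
  the component description of a field is valid only at the points of \<open>V\<close>. The compatibility of a
  connection with restriction, \<open>nabla_cong\<close>, mediates between the two in the following lemmas.\<close>

lemma nabla_sum_left:
  assumes V: "openin (mtop M) V" "V \<subseteq> U" and q: "q \<in> V" and Y: "smooth_vf M V Y"
    and h: "\<And>i. smooth_on (x ` V) (h i)" and "finite I"
  shows "nabla (cfield (\<lambda>y. \<Sum>i\<in>I. h i y *\<^sub>R w i)) Y q
    = (\<lambda>f. \<Sum>i\<in>I. h i (x q) * nabla (cfield (\<lambda>_. w i)) Y q f)"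
proof -
  have oV: "open (x ` V)" by (rule open_image[OF V])
  note const = cfield_const_smooth[OF V]
  show ?thesis using \<open>finite I\<close>
  proof (induction I rule: finite_induct)
    case empty
    have "nabla (cfield (\<lambda>y. 0)) Y q = nabla (\<lambda>r f. 0 * cfield (\<lambda>_. 0) r f) Y q"
    proof (rule nabla_cong[where U = V])
      show "smooth_vf M V (\<lambda>r f. 0 * cfield (\<lambda>_. 0) r f)"
        by (rule smooth_vf_cfield[OF V smooth_on_const[of _ 0]])
          (use V in \<open>auto simp: cfield_def cvec_0 zero_tvec_def subset_iff\<close>)
      show "cfield (\<lambda>y. 0) r = (\<lambda>f. 0 * cfield (\<lambda>_. 0) r f) \<and> Y r = Y r" if "r \<in> V" for r
        using that V by (auto simp: cfield_def cvec_0 zero_tvec_def subset_iff)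
    qed (use const Y q in auto)
    also have "\<dots> = (\<lambda>f. 0)"
      using nabla_mult_left[OF smooth_fun_coord[OF V smooth_on_const[of _ 0]] const Y q] by simp
    finally show ?case by simp
  next
    case (insert i I)
    let ?T = "\<lambda>r f. h i (x r) * cfield (\<lambda>_. w i) r f"
    let ?R = "cfield (\<lambda>y. \<Sum>i\<in>I. h i y *\<^sub>R w i)"
    have T: "smooth_vf M V ?T"
      by (rule smooth_vf_cfield[OF V, of "\<lambda>y. h i y *\<^sub>R w i"])
        (use V in \<open>auto simp: cfield_def cvec_scaleR subset_iff intro!: smooth_on_scaleR oV h smooth_on_const\<close>)
    have R: "smooth_vf M V ?R"
      by (rule smooth_vf_cfield[OF V _ refl]) (intro smooth_on_sum smooth_on_scaleR oV h smooth_on_const)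
    have "nabla (cfield (\<lambda>y. \<Sum>i\<in>insert i I. h i y *\<^sub>R w i)) Y q = nabla (\<lambda>r f. ?T r f + ?R r f) Y q"
    proof (rule nabla_cong[where U = V])
      show "smooth_vf M V (cfield (\<lambda>y. \<Sum>i\<in>insert i I. h i y *\<^sub>R w i))"
        by (rule smooth_vf_cfield[OF V _ refl]) (intro smooth_on_sum smooth_on_scaleR oV h smooth_on_const)
      show *: "cfield (\<lambda>y. \<Sum>i\<in>insert i I. h i y *\<^sub>R w i) r = (\<lambda>f. ?T r f + ?R r f) \<and> Y r = Y r"
        if "r \<in> V" for r
        using that V insert.hyps by (auto simp: cfield_def cvec_add cvec_scaleR subset_iff)
      show "smooth_vf M V (\<lambda>r f. ?T r f + ?R r f)"
        by (rule smooth_vf_cfield[OF V, of "\<lambda>y. \<Sum>i\<in>insert i I. h i y *\<^sub>R w i"])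
          (use * in \<open>auto intro!: smooth_on_sum smooth_on_scaleR oV h smooth_on_const\<close>)
    qed (use Y q in auto)
    also have "\<dots> = (\<lambda>f. nabla ?T Y q f + nabla ?R Y q f)"
      by (rule nabla_add_left[OF T R Y q])
    also have "nabla ?T Y q = (\<lambda>f. h i (x q) * nabla (cfield (\<lambda>_. w i)) Y q f)"
      by (rule nabla_mult_left[OF smooth_fun_coord[OF V h] const Y q])
    finally show ?case using insert by simp
  qed
qed

lemma nabla_sum_right:
  assumes V: "openin (mtop M) V" "V \<subseteq> U" and q: "q \<in> V" and X: "smooth_vf M V X" "X q = cvec a q"
    and h: "\<And>i. smooth_on (x ` V) (h i)" and "finite I"
  shows "nabla X (cfield (\<lambda>y. \<Sum>i\<in>I. h i y *\<^sub>R w i)) q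
    = (\<lambda>f. \<Sum>i\<in>I. fderiv (h i) (x q) a * cvec (w i) q f + h i (x q) * nabla X (cfield (\<lambda>_. w i)) q f)"
proof -
  have oV: "open (x ` V)" by (rule open_image[OF V])
  note const = cfield_const_smooth[OF V]
  show ?thesis using \<open>finite I\<close>
  proof (induction I rule: finite_induct)
    case empty
    have "nabla X (cfield (\<lambda>y. 0)) q = nabla X (\<lambda>r f. 0 * cfield (\<lambda>_. 0) r f) q"
    proof (rule nabla_cong[where U = V])
      show "smooth_vf M V (\<lambda>r f. 0 * cfield (\<lambda>_. 0) r f)"
        by (rule smooth_vf_cfield[OF V smooth_on_const[of _ 0]])
          (use V in \<open>auto simp: cfield_def cvec_0 zero_tvec_def subset_iff\<close>)
      show "X r = X r \<and> cfield (\<lambda>y. 0) r = (\<lambda>f. 0 * cfield (\<lambda>_. 0) r f)" if "r \<in> V" for r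
        using that V by (auto simp: cfield_def cvec_0 zero_tvec_def subset_iff)
    qed (use const X q in auto)
    also have "\<dots> = (\<lambda>f. X q (\<lambda>_. 0) * cfield (\<lambda>_. 0) q f)"
      using nabla_mult_right[OF smooth_fun_coord[OF V smooth_on_const[of _ 0]] X(1) const q] by simp
    also have "\<dots> = (\<lambda>f. 0)"
      using q V by (auto simp: cfield_def cvec_0 zero_tvec_def subset_iff)
    finally show ?case by simp
  next
    case (insert i I)
    let ?T = "\<lambda>r f. h i (x r) * cfield (\<lambda>_. w i) r f"
    let ?R = "cfield (\<lambda>y. \<Sum>i\<in>I. h i y *\<^sub>R w i)"
    have T: "smooth_vf M V ?T"
      by (rule smooth_vf_cfield[OF V, of "\<lambda>y. h i y *\<^sub>R w i"])
        (use V in \<open>auto simp: cfield_def cvec_scaleR subset_iff intro!: smooth_on_scaleR oV h smooth_on_const\<close>)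
    have R: "smooth_vf M V ?R"
      by (rule smooth_vf_cfield[OF V _ refl]) (intro smooth_on_sum smooth_on_scaleR oV h smooth_on_const)
    have "nabla X (cfield (\<lambda>y. \<Sum>i\<in>insert i I. h i y *\<^sub>R w i)) q = nabla X (\<lambda>r f. ?T r f + ?R r f) q"
    proof (rule nabla_cong[where U = V])
      show "smooth_vf M V (cfield (\<lambda>y. \<Sum>i\<in>insert i I. h i y *\<^sub>R w i))"
        by (rule smooth_vf_cfield[OF V _ refl]) (intro smooth_on_sum smooth_on_scaleR oV h smooth_on_const)
      show *: "X r = X r \<and> cfield (\<lambda>y. \<Sum>i\<in>insert i I. h i y *\<^sub>R w i) r = (\<lambda>f. ?T r f + ?R r f)"
        if "r \<in> V" for r
        using that V insert.hyps by (auto simp: cfield_def cvec_add cvec_scaleR subset_iff)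
      show "smooth_vf M V (\<lambda>r f. ?T r f + ?R r f)"
        by (rule smooth_vf_cfield[OF V, of "\<lambda>y. \<Sum>i\<in>insert i I. h i y *\<^sub>R w i"])
          (use * in \<open>auto intro!: smooth_on_sum smooth_on_scaleR oV h smooth_on_const\<close>)
    qed (use X q in auto)
    also have "\<dots> = (\<lambda>f. nabla X ?T q f + nabla X ?R q f)"
      by (rule nabla_add_right[OF X(1) T R q])
    also have "nabla X ?T q = (\<lambda>f. X q (\<lambda>r. h i (x r)) * cfield (\<lambda>_. w i) q f
        + h i (x q) * nabla X (cfield (\<lambda>_. w i)) q f)"
      by (rule nabla_mult_right[OF smooth_fun_coord[OF V h] X(1) const q])
    also have "X q (\<lambda>r. h i (x r)) = fderiv (h i) (x q) a"
      unfolding X(2) by (rule cvec_apply_coord[OF V h q])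
    finally show ?case using insert by (simp add: cfield_def)
  qed
qed

definition christoffel_symbol :: "'m \<Rightarrow> 'm \<Rightarrow> real ^ 'm \<Rightarrow> real ^ 'm" where
  "christoffel_symbol i j y =
     (\<chi> k. nabla (cfield (\<lambda>_. axis i 1)) (cfield (\<lambda>_. axis j 1)) (pt y) (coord c k))"

definition christoffel :: "real ^ 'm \<Rightarrow> real ^ 'm \<Rightarrow> real ^ 'm \<Rightarrow> real ^ 'm" where
  "christoffel y v w = (\<Sum>i\<in>UNIV. v $ i *\<^sub>R (\<Sum>j\<in>UNIV. w $ j *\<^sub>R christoffel_symbol i j y))"

lemma nabla_coord_fields:
  shows "smooth_on \<Omega> (christoffel_symbol i j)"
    and "q \<in> U \<Longrightarrow> nabla (cfield (\<lambda>_. axis i 1)) (cfield (\<lambda>_. axis j 1)) q = cvec (christoffel_symbol i j (x q)) q"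
proof -
  have "smooth_vf M U (nabla (cfield (\<lambda>_. axis i 1)) (cfield (\<lambda>_. axis j 1)))"
    by (intro nabla_smooth cfield_const_smooth openU order_refl)
  then obtain a where a: "smooth_on \<Omega> a"
    "\<And>q. q \<in> U \<Longrightarrow> nabla (cfield (\<lambda>_. axis i 1)) (cfield (\<lambda>_. axis j 1)) q = cfield a q"
    using smooth_vf_obtain[OF _ order_refl] by blast
  have eq: "christoffel_symbol i j y = a y" if "y \<in> \<Omega>" for y
    using that a(2)[of "pt y"] pt_in[OF that] x_pt[OF that]
    by (simp add: christoffel_symbol_def cfield_def vec_eq_iff cvec_coord)
  show "smooth_on \<Omega> (christoffel_symbol i j)"
    using smooth_on_cong[OF open\<Omega>, of "christoffel_symbol i j" a] eq a(1) by simp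
  show "nabla (cfield (\<lambda>_. axis i 1)) (cfield (\<lambda>_. axis j 1)) q = cvec (christoffel_symbol i j (x q)) q"
    if "q \<in> U"
    using a(2)[OF that] eq[of "x q"] that by (simp add: cfield_def)
qed

lemma christoffel_smooth: "smooth_on \<Omega> (\<lambda>y. christoffel y v w)"
  unfolding christoffel_def
  by (intro smooth_on_sum smooth_on_scaleR smooth_on_const nabla_coord_fields open\<Omega>)

lemma christoffel_bilinear: "bilinear (christoffel y)"
  unfolding bilinear_def christoffel_def
  by (auto intro!: linearI simp: sum.distrib scaleR_add_left scaleR_add_right scaleR_sum_right distrib_left mult_ac)

text \<open>By the Leibniz rule the connection is determined by its values on the coordinate fields; this
  is the formula \<open>\<nabla>\<^sub>a b = Db(a) + \<Gamma>(a, b)\<close>.\<close>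

lemma nabla_cfield:
  assumes V: "openin (mtop M) V" "V \<subseteq> U" and q: "q \<in> V"
    and a: "smooth_on (x ` V) a" "\<And>q. q \<in> V \<Longrightarrow> X q = cfield a q"
    and b: "smooth_on (x ` V) b" "\<And>q. q \<in> V \<Longrightarrow> Y q = cfield b q"
  shows "nabla X Y q = cvec (fderiv b (x q) (a (x q)) + christoffel (x q) (a (x q)) (b (x q))) q"
proof -
  have qU: "q \<in> U" using q V by blast
  have oV: "open (x ` V)" by (rule open_image[OF V])
  have X: "smooth_vf M V X" "smooth_vf M V (cfield a)" using a by (auto intro!: smooth_vf_cfield[OF V a(1)])
  have Y: "smooth_vf M V Y" "smooth_vf M V (cfield b)" using b by (auto intro!: smooth_vf_cfield[OF V b(1)])
  define B where "B i = fderiv b (x q) (axis i 1) + (\<Sum>j\<in>UNIV. b (x q) $ j *\<^sub>R christoffel_symbol i j (x q))" for i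
  have db: "(b has_derivative fderiv b (x q)) (at (x q))"
    by (rule smooth_on_has_derivative[OF b(1)]) (use q in simp)
  have dbj: "fderiv (\<lambda>y. b y $ j) (x q) v = fderiv b (x q) v $ j" for j v
    using fderiv_eq[OF bounded_linear.has_derivative[OF bounded_linear_vec_nth db]] by metis
  have basis: "nabla (cfield (\<lambda>_. axis i 1)) (cfield b) q = cvec (B i) q" for i
  proof -
    have "nabla (cfield (\<lambda>_. axis i 1)) (cfield b) q
      = nabla (cfield (\<lambda>_. axis i 1)) (cfield (\<lambda>y. \<Sum>j\<in>UNIV. b y $ j *\<^sub>R axis j 1)) q"
      by (simp only: sum_axis)
    also have "\<dots> = (\<lambda>f. \<Sum>j\<in>UNIV. fderiv (\<lambda>y. b y $ j) (x q) (axis i 1) * cvec (axis j 1) q f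
        + b (x q) $ j * nabla (cfield (\<lambda>_. axis i 1)) (cfield (\<lambda>_. axis j 1)) q f)"
      by (rule nabla_sum_right[OF V q cfield_const_smooth[OF V]])
        (auto simp: cfield_def intro!: smooth_on_vec_nth oV b)
    also have "\<dots> = (\<lambda>f. \<Sum>j\<in>UNIV. fderiv b (x q) (axis i 1) $ j * cvec (axis j 1) q f
        + b (x q) $ j * cvec (christoffel_symbol i j (x q)) q f)"
      by (simp only: dbj nabla_coord_fields(2)[OF qU])
    also have "\<dots> = cvec ((\<Sum>j\<in>UNIV. fderiv b (x q) (axis i 1) $ j *\<^sub>R axis j 1)
        + (\<Sum>j\<in>UNIV. b (x q) $ j *\<^sub>R christoffel_symbol i j (x q))) q"
      by (simp only: cvec_add[OF qU] cvec_sum[OF qU] sum.distrib)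
    finally show ?thesis by (simp only: sum_axis B_def)
  qed
  have "nabla X Y q = nabla (cfield a) (cfield b) q"
    by (rule nabla_cong[OF X Y _ q]) (use a b in blast)
  also have "\<dots> = nabla (cfield (\<lambda>y. \<Sum>i\<in>UNIV. a y $ i *\<^sub>R axis i 1)) (cfield b) q"
    by (simp only: sum_axis)
  also have "\<dots> = (\<lambda>f. \<Sum>i\<in>UNIV. a (x q) $ i * nabla (cfield (\<lambda>_. axis i 1)) (cfield b) q f)"
    by (rule nabla_sum_left[OF V q Y(2)]) (auto intro!: smooth_on_vec_nth oV a)
  also have "\<dots> = cvec (\<Sum>i\<in>UNIV. a (x q) $ i *\<^sub>R B i) q"
    by (simp only: basis cvec_sum[OF qU])
  also have "(\<Sum>i\<in>UNIV. a (x q) $ i *\<^sub>R B i)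
     = (\<Sum>i\<in>UNIV. a (x q) $ i *\<^sub>R fderiv b (x q) (axis i 1)) + christoffel (x q) (a (x q)) (b (x q))"
    by (simp add: B_def christoffel_def scaleR_add_right sum.distrib)
  also have "(\<Sum>i\<in>UNIV. a (x q) $ i *\<^sub>R fderiv b (x q) (axis i 1)) = fderiv b (x q) (\<Sum>i\<in>UNIV. a (x q) $ i *\<^sub>R axis i 1)"
    using has_derivative_linear[OF db] by (simp add: linear_sum linear_cmul)
  finally show ?thesis by (simp only: sum_axis)
qed

text \<open>Apply the curvature to constant fields \<open>v\<close>, \<open>w\<close>, \<open>u\<close>, the first two of which commute.\<close>

lemma flatness_in_coordinates:
  assumes flat: "flat_connection M nabla" and y: "y \<in> \<Omega>"
  shows "fderiv (\<lambda>z. christoffel z w u) y v + christoffel y v (christoffel y w u)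
       = fderiv (\<lambda>z. christoffel z v u) y w + christoffel y w (christoffel y v u)"
proof -
  define q where "q = pt y"
  have q: "q \<in> U" "x q = y" using y by (auto simp: q_def)
  note const = cfield_const_smooth[OF openU order_refl]
  have one: "nabla (cfield (\<lambda>_. a)) (cfield (\<lambda>_. b)) r = cfield (\<lambda>z. christoffel z a b) r" if "r \<in> U" for r a b
    using nabla_cfield[OF openU order_refl that smooth_on_const refl smooth_on_const refl, of a b]
    by (simp add: frechet_derivative_const cfield_def[of "\<lambda>z. christoffel z a b"])
  have two: "nabla (cfield (\<lambda>_. a)) (nabla (cfield (\<lambda>_. b)) (cfield (\<lambda>_. d))) q
    = cvec (fderiv (\<lambda>z. christoffel z b d) y a + christoffel y a (christoffel y b d)) q" for a b d
    using nabla_cfield[OF openU order_refl q(1) smooth_on_const refl christoffel_smooth one, of a b d]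
    by (simp add: q)
  have "nabla (lie_bracket M (cfield (\<lambda>_. v)) (cfield (\<lambda>_. w))) (cfield (\<lambda>_. u)) q
    = cvec (fderiv (\<lambda>_. u) (x q) 0 + christoffel (x q) 0 u) q"
    by (rule nabla_cfield[OF openU order_refl q(1) smooth_on_const _ smooth_on_const refl])
      (simp add: lie_bracket_const cfield_def cvec_0)
  also have "\<dots> = zero_tvec"
    using christoffel_bilinear[of "x q"] q(1)
    by (simp add: frechet_derivative_const bilinear_def linear_0 cvec_0 bilinear_lzero christoffel_bilinear)
  finally have three: "nabla (lie_bracket M (cfield (\<lambda>_. v)) (cfield (\<lambda>_. w))) (cfield (\<lambda>_. u)) q = zero_tvec" .
  have "(\<lambda>f. nabla (cfield (\<lambda>_. v)) (nabla (cfield (\<lambda>_. w)) (cfield (\<lambda>_. u))) q f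
      - nabla (cfield (\<lambda>_. w)) (nabla (cfield (\<lambda>_. v)) (cfield (\<lambda>_. u))) q f
      - nabla (lie_bracket M (cfield (\<lambda>_. v)) (cfield (\<lambda>_. w))) (cfield (\<lambda>_. u)) q f) = zero_tvec"
    using flat const q(1) unfolding flat_connection_def by blast
  then have "nabla (cfield (\<lambda>_. v)) (nabla (cfield (\<lambda>_. w)) (cfield (\<lambda>_. u))) q
     = nabla (cfield (\<lambda>_. w)) (nabla (cfield (\<lambda>_. v)) (cfield (\<lambda>_. u))) q"
    unfolding three by (auto simp: zero_tvec_def fun_eq_iff)
  then show ?thesis unfolding two cvec_inject[OF q(1)] .
qed

lemma radiant_in_coordinates:
  assumes "radiant_vf M nabla \<rho>"
  obtains r where "smooth_on \<Omega> r" "\<And>q. q \<in> U \<Longrightarrow> \<rho> q = cfield r q"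
    "\<And>y v. y \<in> \<Omega> \<Longrightarrow> fderiv r y v + christoffel y v (r y) = v"
proof -
  have "smooth_vf M U \<rho>"
    using assms openU openin_subset by (auto simp: radiant_vf_def intro: smooth_vf_subset)
  then obtain r where r: "smooth_on \<Omega> r" "\<And>q. q \<in> U \<Longrightarrow> \<rho> q = cfield r q"
    using smooth_vf_obtain[OF _ order_refl] by blast
  have "fderiv r y v + christoffel y v (r y) = v" if "y \<in> \<Omega>" for y v
  proof -
    have q: "pt y \<in> U" "x (pt y) = y" using that by auto
    have "cvec (fderiv r y v + christoffel y v (r y)) (pt y) = nabla (cfield (\<lambda>_. v)) \<rho> (pt y)"
      using nabla_cfield[OF openU order_refl q(1) smooth_on_const refl r, of v] by (simp add: q)
    also have "\<dots> = cvec v (pt y)"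
      using assms cfield_const_smooth[OF openU order_refl, of v] q(1)
      unfolding radiant_vf_def by (simp add: cfield_def)
    finally show ?thesis using cvec_inject[OF q(1)] by blast
  qed
  then show ?thesis using that r by blast
qed

end

section \<open>Flat coordinates adapted to a radiant vector field\<close>

context affine_chart
begin

text \<open>The operator \<open>\<theta> \<mapsto> \<theta>(\<Gamma>(v, \<cdot>))\<close> on covectors, which are identified with vectors by the Euclidean
  inner product.\<close>

definition christoffel_dual :: "real ^ 'm \<Rightarrow> real ^ 'm \<Rightarrow> real ^ 'm \<Rightarrow> real ^ 'm" where
  "christoffel_dual y v \<theta> = (\<chi> i. \<theta> \<bullet> christoffel y v (axis i 1))"

lemma christoffel_linear: "linear (christoffel y v)" "linear (\<lambda>v. christoffel y v w)"
  using christoffel_bilinear[of y] by (auto simp: bilinear_def)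

lemma christoffel_dual_inner: "christoffel_dual y v \<theta> \<bullet> w = \<theta> \<bullet> christoffel y v w"
proof -
  have "christoffel y v w = (\<Sum>i\<in>UNIV. w $ i *\<^sub>R christoffel y v (axis i 1))"
    by (subst sum_axis[of w, symmetric])
      (simp only: linear_sum[OF christoffel_linear(1)] linear_cmul[OF christoffel_linear(1)])
  then show ?thesis
    by (simp add: christoffel_dual_def inner_vec_def[of _ w] inner_sum_right mult.commute)
qed

lemma christoffel_dual_bilinear: "bilinear (christoffel_dual y)"
  unfolding bilinear_def
proof (intro conjI allI linearI)
  fix v v' \<theta> \<theta>' :: "real ^ 'm" and s
  show "christoffel_dual y (v + v') \<theta> = christoffel_dual y v \<theta> + christoffel_dual y v' \<theta>"
    "christoffel_dual y (s *\<^sub>R v) \<theta> = s *\<^sub>R christoffel_dual y v \<theta>"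
    by (simp_all add: christoffel_dual_def vec_eq_iff inner_add_right
        linear_add[OF christoffel_linear(2)] linear_cmul[OF christoffel_linear(2)])
  show "christoffel_dual y v (\<theta> + \<theta>') = christoffel_dual y v \<theta> + christoffel_dual y v \<theta>'"
    "christoffel_dual y v (s *\<^sub>R \<theta>) = s *\<^sub>R christoffel_dual y v \<theta>"
    by (simp_all add: christoffel_dual_def vec_eq_iff inner_add_left)
qed

lemma christoffel_dual_smooth: "smooth_on \<Omega> (\<lambda>y. christoffel_dual y v \<theta>)"
  by (rule smooth_on_vecI[OF open\<Omega>])
    (auto simp: christoffel_dual_def intro!: smooth_on_inner open\<Omega> smooth_on_const christoffel_smooth)

text \<open>The equations for parallel vector fields and for parallel 1-forms are completely integrable;
  in both cases this is the vanishing of the curvature.\<close>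

lemma parallel_frame_system:
  assumes flat: "flat_connection M nabla" and x0: "x0 \<in> \<Omega>"
  shows "\<exists>r>0. ball x0 r \<subseteq> \<Omega> \<and> (\<forall>u0. \<exists>u. u x0 = u0 \<and> smooth_on (ball x0 r) u \<and>
    (\<forall>y\<in>ball x0 r. (u has_derivative (\<lambda>v. - christoffel y v (u y))) (at y)))"
proof (rule integrable_linear_system[OF open\<Omega> x0])
  fix y assume y: "y \<in> \<Omega>"
  show "bilinear (\<lambda>v u. - christoffel y v u)"
    using christoffel_bilinear[of y] by (simp add: bilinear_def linear_compose_neg)
  fix v w u
  have lin: "christoffel y v (- u) = - christoffel y v u" for v u
    using linear_neg[OF christoffel_linear(1)] .
  have "fderiv (\<lambda>z. - christoffel z v u) y w = - fderiv (\<lambda>z. christoffel z v u) y w" for v u w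
    using fderiv_eq[OF has_derivative_minus[OF smooth_on_has_derivative[OF christoffel_smooth y]]] by metis
  then show "fderiv (\<lambda>z. - christoffel z v u) y w + - christoffel y v (- christoffel y w u)
    = fderiv (\<lambda>z. - christoffel z w u) y v + - christoffel y w (- christoffel y v u)"
    using flatness_in_coordinates[OF flat y, of w u v] by (simp add: lin algebra_simps)
next
  fix v u
  show "smooth_on \<Omega> (\<lambda>y. - christoffel y v u)"
    using smooth_on_scaleR[OF open\<Omega> smooth_on_const[of _ "-1"] christoffel_smooth] by simp
qed

lemma parallel_coframe_system:
  assumes flat: "flat_connection M nabla" and x0: "x0 \<in> \<Omega>"
  shows "\<exists>r>0. ball x0 r \<subseteq> \<Omega> \<and> (\<forall>u0. \<exists>u. u x0 = u0 \<and> smooth_on (ball x0 r) u \<and>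
    (\<forall>y\<in>ball x0 r. (u has_derivative (\<lambda>v. christoffel_dual y v (u y))) (at y)))"
proof (rule integrable_linear_system[OF open\<Omega> x0 christoffel_dual_bilinear christoffel_dual_smooth])
  fix y v w \<theta> assume y: "y \<in> \<Omega>"
  have D: "fderiv (\<lambda>z. christoffel_dual z v \<theta>) y w \<bullet> u = \<theta> \<bullet> fderiv (\<lambda>z. christoffel z v u) y w" for v w u
  proof -
    have "((\<lambda>z. christoffel_dual z v \<theta> \<bullet> u) has_derivative (\<lambda>w. fderiv (\<lambda>z. christoffel_dual z v \<theta>) y w \<bullet> u)) (at y)"
      by (rule bounded_linear.has_derivative[OF bounded_linear_inner_left
            smooth_on_has_derivative[OF christoffel_dual_smooth y]])
    moreover have "((\<lambda>z. \<theta> \<bullet> christoffel z v u) has_derivative (\<lambda>w. \<theta> \<bullet> fderiv (\<lambda>z. christoffel z v u) y w)) (at y)"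
      by (rule bounded_linear.has_derivative[OF bounded_linear_inner_right
            smooth_on_has_derivative[OF christoffel_smooth y]])
    ultimately have "(\<lambda>w. fderiv (\<lambda>z. christoffel_dual z v \<theta>) y w \<bullet> u) = (\<lambda>w. \<theta> \<bullet> fderiv (\<lambda>z. christoffel z v u) y w)"
      unfolding christoffel_dual_inner by (rule has_derivative_unique)
    then show ?thesis by metis
  qed
  show "fderiv (\<lambda>z. christoffel_dual z v \<theta>) y w + christoffel_dual y v (christoffel_dual y w \<theta>)
    = fderiv (\<lambda>z. christoffel_dual z w \<theta>) y v + christoffel_dual y w (christoffel_dual y v \<theta>)" (is "?l = ?r")
  proof -
    have "?l \<bullet> u = ?r \<bullet> u" for u
      using flatness_in_coordinates[OF flat y, of v u w]
      by (simp only: inner_add_left D christoffel_dual_inner inner_add_right[symmetric])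
    then show ?thesis by (metis vector_eq_rdot)
  qed
qed

text \<open>Let \<open>X\<close> be a parallel frame and \<open>\<theta>\<close> the dual parallel coframe near \<open>x\<^sub>0\<close>. As \<open>\<theta>\<^sup>i\<close> is parallel and
  \<open>\<nabla>\<rho> = Id\<close>, the functions \<open>f\<^sup>i = \<theta>\<^sup>i(\<rho>)\<close> satisfy \<open>df\<^sup>i = \<theta>\<^sup>i\<close>. So they are coordinates whose
  coordinate vector fields are the parallel fields \<open>X\<^sub>i\<close>, and by duality \<open>\<rho> = \<Sum>\<^sub>i f\<^sup>i X\<^sub>i\<close> is their Euler
  field. The initial value \<open>P\<close> of the frame at \<open>x\<^sub>0\<close> can be prescribed.\<close>

lemma parallel_frame_coordinates:
  fixes P Q :: "real ^ 'm \<Rightarrow> real ^ 'm"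
  assumes flat: "flat_connection M nabla" and x0: "x0 \<in> \<Omega>"
    and r: "smooth_on \<Omega> r" "\<And>y v. y \<in> \<Omega> \<Longrightarrow> fderiv r y v + christoffel y v (r y) = v"
    and P: "linear P" "linear Q" "\<And>v. P (Q v) = v" "\<And>v. Q (P v) = v"
  obtains s X f where "s > 0" "ball x0 s \<subseteq> \<Omega>"
    "\<And>j. smooth_on (ball x0 s) (X j)" "smooth_on (ball x0 s) f"
    "\<And>j. X j x0 = P (axis j 1)" "f x0 = Q (r x0)"
    "\<And>j y v. y \<in> ball x0 s \<Longrightarrow> fderiv (X j) y v + christoffel y v (X j y) = 0"
    "\<And>y v. y \<in> ball x0 s \<Longrightarrow> (\<Sum>j\<in>UNIV. fderiv f y v $ j *\<^sub>R X j y) = v"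
    "\<And>y. y \<in> ball x0 s \<Longrightarrow> (\<Sum>j\<in>UNIV. f y $ j *\<^sub>R X j y) = r y"
proof -
  obtain s1 where s1: "s1 > 0" "ball x0 s1 \<subseteq> \<Omega>" "\<And>u0. \<exists>u. u x0 = u0 \<and> smooth_on (ball x0 s1) u \<and>
    (\<forall>y\<in>ball x0 s1. (u has_derivative (\<lambda>v. - christoffel y v (u y))) (at y))"
    using parallel_frame_system[OF flat x0] by blast
  obtain s2 where s2: "s2 > 0" "ball x0 s2 \<subseteq> \<Omega>" "\<And>u0. \<exists>u. u x0 = u0 \<and> smooth_on (ball x0 s2) u \<and>
    (\<forall>y\<in>ball x0 s2. (u has_derivative (\<lambda>v. christoffel_dual y v (u y))) (at y))"
    using parallel_coframe_system[OF flat x0] by blast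
  obtain X where X: "\<And>j. X j x0 = P (axis j 1)" "\<And>j. smooth_on (ball x0 s1) (X j)"
    "\<And>j y. y \<in> ball x0 s1 \<Longrightarrow> (X j has_derivative (\<lambda>v. - christoffel y v (X j y))) (at y)"
    using s1(3)[of "P (axis _ 1)"] by metis
  obtain \<Theta> where \<Theta>: "\<And>i. \<Theta> i x0 = (\<chi> j. Q (axis j 1) $ i)" "\<And>i. smooth_on (ball x0 s2) (\<Theta> i)"
    "\<And>i y. y \<in> ball x0 s2 \<Longrightarrow> (\<Theta> i has_derivative (\<lambda>v. christoffel_dual y v (\<Theta> i y))) (at y)"
    using s2(3)[of "\<chi> j. Q (axis j 1) $ _"] by metis
  define s where "s = min s1 s2"
  define B where "B = ball x0 s"
  have s: "s > 0" and B: "B \<subseteq> ball x0 s1" "B \<subseteq> ball x0 s2" "B \<subseteq> \<Omega>" "x0 \<in> B" "open B" "convex B"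
    using s1 s2 by (auto simp: s_def B_def)
  note dX = X(3)[OF subsetD[OF B(1)]] and d\<Theta> = \<Theta>(3)[OF subsetD[OF B(2)]]
  have smX: "smooth_on B (X j)" and sm\<Theta>: "smooth_on B (\<Theta> j)" and smr: "smooth_on B r" for j
    using X(2) \<Theta>(2) r(1) B smooth_on_subset by blast+
  have \<Theta>0: "\<Theta> i x0 \<bullet> v = Q v $ i" for i v
  proof -
    have "Q v = (\<Sum>j\<in>UNIV. v $ j *\<^sub>R Q (axis j 1))"
      by (subst sum_axis[of v, symmetric]) (simp only: linear_sum[OF P(2)] linear_cmul[OF P(2)])
    then show ?thesis by (simp add: \<Theta>(1) inner_vec_def mult.commute)
  qed
  have dual: "\<Theta> i y \<bullet> X j y = (if i = j then 1 else 0)" if "y \<in> B" for i j y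
  proof -
    have "((\<lambda>y. \<Theta> i y \<bullet> X j y) has_derivative (\<lambda>v. 0)) (at y within B)" if "y \<in> B" for y
      by (rule has_derivative_at_withinI
          [OF has_derivative_eq_rhs[OF has_derivative_inner[OF d\<Theta>[OF that] dX[OF that]]]])
        (simp only: christoffel_dual_inner inner_minus_right left_minus)
    from has_derivative_zero_constant[OF B(6) this] obtain k where k: "\<And>y. y \<in> B \<Longrightarrow> \<Theta> i y \<bullet> X j y = k" by blast
    then have "\<Theta> i y \<bullet> X j y = \<Theta> i x0 \<bullet> X j x0" using that B(4) by metis
    also have "\<dots> = axis j 1 $ i" by (simp add: \<Theta>0 X(1) P)
    finally show ?thesis by (simp add: axis_def)
  qed
  define f where "f y = (\<chi> i. \<Theta> i y \<bullet> r y)" for y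
  have smf: "smooth_on B f"
    by (rule smooth_on_vecI[OF B(5)]) (auto simp: f_def intro!: smooth_on_inner B(5) sm\<Theta> smr)
  have df: "fderiv f y v = (\<chi> i. \<Theta> i y \<bullet> v)" if y: "y \<in> B" for y v
  proof -
    have "fderiv f y v $ i = \<Theta> i y \<bullet> v" for i
    proof -
      have "((\<lambda>y. f y $ i) has_derivative (\<lambda>v. fderiv f y v $ i)) (at y)"
        by (rule bounded_linear.has_derivative[OF bounded_linear_vec_nth smooth_on_has_derivative[OF smf y]])
      moreover have "((\<lambda>y. f y $ i) has_derivative (\<lambda>v. \<Theta> i y \<bullet> fderiv r y v + christoffel_dual y v (\<Theta> i y) \<bullet> r y)) (at y)"
        using has_derivative_inner[OF d\<Theta>[OF y] smooth_on_has_derivative[OF smr y], of i] by (simp add: f_def)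
      ultimately have "(\<lambda>v. fderiv f y v $ i) = (\<lambda>v. \<Theta> i y \<bullet> fderiv r y v + christoffel_dual y v (\<Theta> i y) \<bullet> r y)"
        by (rule has_derivative_unique)
      then have "fderiv f y v $ i = \<Theta> i y \<bullet> fderiv r y v + christoffel_dual y v (\<Theta> i y) \<bullet> r y"
        by (rule fun_cong)
      also have "\<dots> = \<Theta> i y \<bullet> v"
        using r(2)[of y v] y B(3) by (simp add: christoffel_dual_inner inner_add_right[symmetric] subset_iff)
      finally show ?thesis .
    qed
    then show ?thesis by (simp add: vec_eq_iff)
  qed
  have QP: "fderiv f y (\<Sum>j\<in>UNIV. v $ j *\<^sub>R X j y) = v" if "y \<in> B" for y v
    by (simp add: df[OF that] inner_sum_right dual[OF that] vec_eq_iff if_distrib cong: if_cong)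
  have PQ: "(\<Sum>j\<in>UNIV. fderiv f y v $ j *\<^sub>R X j y) = v" if "y \<in> B" for y v
  proof -
    have "surj (fderiv f y)" 
      by (rule surjI[where f = "\<lambda>v. \<Sum>j\<in>UNIV. v $ j *\<^sub>R X j y"]) (rule QP[OF that])
    then have "inj (fderiv f y)"
      by (rule linear_surj_imp_inj[OF smooth_on_linear_fderiv[OF smf that]])
    then show ?thesis using QP[OF that, of "fderiv f y v"] by (rule injD)
  qed
  show ?thesis
  proof (rule that[OF s])
    show "ball x0 s \<subseteq> \<Omega>" using B(3) by (simp add: B_def)
    show "smooth_on (ball x0 s) (X j)" for j using smX by (simp add: B_def)
    show "smooth_on (ball x0 s) f" using smf by (simp add: B_def)
    show "f x0 = Q (r x0)" by (simp add: f_def \<Theta>0)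
    show "fderiv (X j) y v + christoffel y v (X j y) = 0" if "y \<in> ball x0 s" for j y v
      using fderiv_eq[OF dX] that unfolding B_def by simp
    show "(\<Sum>j\<in>UNIV. f y $ j *\<^sub>R X j y) = r y" if "y \<in> ball x0 s" for y
      using PQ[of y "r y"] df[of y "r y"] that by (simp add: f_def B_def)
  qed (use X PQ in \<open>auto simp: B_def\<close>)
qed

text \<open>The functions \<open>f\<^sup>i\<close> restrict to a diffeomorphism onto a ball, because the differential \<open>df = \<theta>\<close> is
  inverted by the frame; the inverse map is smooth since its differential is the frame itself.\<close>

lemma frame_diffeomorphism:
  fixes f :: "real ^ 'm \<Rightarrow> real ^ 'm"
  assumes B: "open B" "x0 \<in> B" and sm: "smooth_on B f" "\<And>j. smooth_on B (X j)"
    and PQ: "\<And>y v. y \<in> B \<Longrightarrow> (\<Sum>j\<in>UNIV. fderiv f y v $ j *\<^sub>R X j y) = v"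
    and N: "open N" "f x0 \<in> N"
  obtains W e G where "open W" "W \<subseteq> B" "x0 \<in> W" "e > 0" "f ` W = ball (f x0) e" "ball (f x0) e \<subseteq> N"
    "smooth_on (ball (f x0) e) G" "\<And>y. y \<in> W \<Longrightarrow> G (f y) = y"
    "\<And>y v. y \<in> W \<Longrightarrow> fderiv G (f y) v = (\<Sum>j\<in>UNIV. v $ j *\<^sub>R X j y)"
proof -
  have linP: "linear (\<lambda>v. \<Sum>j\<in>UNIV. v $ j *\<^sub>R X j y)" for y
    by (auto intro!: linearI simp: scaleR_add_left sum.distrib scaleR_sum_right)
  have df: "(f has_derivative fderiv f y) (at y)" if "y \<in> B" for y
    using smooth_on_has_derivative[OF sm(1) that] .
  obtain s where s: "s > 0" "ball x0 s \<subseteq> B" "inj_on f (ball x0 s)"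
  proof (rule has_derivative_locally_injective[OF B(2,1)])
    show "bounded_linear (\<lambda>v. \<Sum>j\<in>UNIV. v $ j *\<^sub>R X j x0)"
      using linP linear_conv_bounded_linear by blast
    show "(\<lambda>v. \<Sum>j\<in>UNIV. v $ j *\<^sub>R X j x0) \<circ> fderiv f x0 = id"
      using PQ[OF B(2)] by auto
    show "(f has_derivative fderiv f y) (at y)" if "y \<in> B" for y using df[OF that] .
    fix e :: real assume e: "e > 0"
    define h where "h y = (\<Sum>i\<in>UNIV. norm (fderiv f y (axis i 1) - fderiv f x0 (axis i 1)))" for y
    have "continuous_on B h"
      unfolding h_def by (intro continuous_intros smooth_on_imp_continuous_on smooth_on_fderiv sm)
    then have "\<exists>d>0. \<forall>y\<in>B. dist y x0 < d \<longrightarrow> dist (h y) (h x0) < e / 2"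
      using B(2) e unfolding continuous_on_iff by (meson half_gt_zero)
    then obtain d where d: "d > 0" "\<And>y. y \<in> B \<Longrightarrow> dist y x0 < d \<Longrightarrow> dist (h y) (h x0) < e / 2" by blast
    obtain d' where d': "d' > 0" "ball x0 d' \<subseteq> B" using B openE by blast
    show "\<exists>d>0. \<forall>y. dist x0 y < d \<longrightarrow> onorm (\<lambda>v. fderiv f y v - fderiv f x0 v) < e"
    proof (intro exI[of _ "min d d'"] conjI allI impI)
      fix y assume y: "dist x0 y < min d d'"
      then have yB: "y \<in> B" using d' by auto
      have hy: "h y \<le> e / 2" using d(2)[OF yB] y by (simp add: dist_commute h_def dist_real_def)
      have "onorm (\<lambda>v. fderiv f y v - fderiv f x0 v) \<le> h y"
      proof (rule onorm_le)
        fix v :: "real ^ 'm"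
        have "fderiv f y v - fderiv f x0 v = (\<Sum>i\<in>UNIV. v $ i *\<^sub>R (fderiv f y (axis i 1) - fderiv f x0 (axis i 1)))"
        proof -
          have "L v = (\<Sum>i\<in>UNIV. v $ i *\<^sub>R L (axis i 1))" if "linear L" for L :: "real ^ 'm \<Rightarrow> real ^ 'm"
            by (subst sum_axis[of v, symmetric]) (simp only: linear_sum[OF that] linear_cmul[OF that])
          from this[OF linear_compose_sub[OF smooth_on_linear_fderiv[OF sm(1) yB] smooth_on_linear_fderiv[OF sm(1) B(2)]]]
          show ?thesis .
        qed
        also have "norm \<dots> \<le> (\<Sum>i\<in>UNIV. norm v * norm (fderiv f y (axis i 1) - fderiv f x0 (axis i 1)))"
          by (intro sum_norm_le) (simp add: component_le_norm_cart mult_right_mono)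
        finally show "norm (fderiv f y v - fderiv f x0 v) \<le> h y * norm v"
          by (simp add: h_def sum_distrib_left mult.commute)
      qed
      then show "onorm (\<lambda>v. fderiv f y v - fderiv f x0 v) < e" using hy e by linarith
    qed (use d d' in auto)
  qed
  let ?B = "ball x0 s"
  have cf: "continuous_on ?B f"
    using continuous_on_subset[OF smooth_on_imp_continuous_on[OF sm(1)] s(2)] .
  have oimg: "open (f ` ?B)" by (rule invariance_of_domain[OF cf open_ball s(3)])
  obtain G where G: "homeomorphism ?B (f ` ?B) f G"
    using invariance_of_domain_homeomorphism[OF open_ball cf _ s(3)] by auto
  have Gf: "G (f y) = y" if "y \<in> ?B" for y using G that by (simp add: homeomorphism_def)
  have "open (f ` ?B \<inter> N)" "f x0 \<in> f ` ?B \<inter> N" using oimg N s by auto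
  then obtain e where e: "e > 0" "ball (f x0) e \<subseteq> f ` ?B \<inter> N" using openE by blast
  define V where "V = ball (f x0) e"
  define W where "W = ?B \<inter> f -` V"
  have W: "open W" "W \<subseteq> ?B" "x0 \<in> W" "f ` W = V"
    using continuous_open_preimage[OF cf open_ball open_ball] s(1) e by (auto simp: W_def V_def)
  have GV: "G z \<in> W" "f (G z) = z" if "z \<in> V" for z
  proof -
    obtain y where "y \<in> W" "z = f y" using \<open>z \<in> V\<close> W(4) by blast
    then show "G z \<in> W" "f (G z) = z" using Gf W(2) by auto
  qed
  have cG: "continuous_on V G"
    using G e(2) by (auto simp: homeomorphism_def V_def elim!: continuous_on_subset)
  have dG: "(G has_derivative (\<lambda>v. \<Sum>j\<in>UNIV. v $ j *\<^sub>R X j (G z))) (at z)" if z: "z \<in> V" for z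
  proof (rule has_derivative_inverse_basic[where T = V])
    have GB: "G z \<in> B" using GV[OF z] W(2) s(2) by blast
    show "(f has_derivative fderiv f (G z)) (at (G z))" by (rule df[OF GB])
    show "bounded_linear (\<lambda>v. \<Sum>j\<in>UNIV. v $ j *\<^sub>R X j (G z))" using linP linear_conv_bounded_linear by blast
    show "(\<lambda>v. \<Sum>j\<in>UNIV. v $ j *\<^sub>R X j (G z)) \<circ> fderiv f (G z) = id" using PQ[OF GB] by auto
    show "continuous (at z) G" using cG z by (simp add: V_def continuous_on_eq_continuous_at)
  qed (use z GV in \<open>auto simp: V_def\<close>)
  have "Ck_on k G V" for k
  proof (induction k)
    case 0
    show ?case using cG by simp
  next
    case (Suc k)
    have "Ck_on k (\<lambda>z. X j (G z)) V" for j
      by (rule Ck_on_compose[OF _ W(1) Suc])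
        (use sm(2)[of j] W(2) s(2) GV in \<open>auto simp: V_def smooth_on_def intro: Ck_on_subset\<close>)
    then have "Ck_on k (\<lambda>z. \<Sum>j\<in>UNIV. v $ j *\<^sub>R X j (G z)) V" for v :: "real ^ 'm"
      by (intro Ck_on_sum Ck_on_bounded_bilinear[OF _ bounded_bilinear_scaleR] Ck_on_const) (auto simp: V_def)
    then show ?case by (intro Ck_on_SucI[OF _ dG]) (auto simp: V_def)
  qed
  then have "smooth_on V G" by (simp add: smooth_on_def)
  moreover have "fderiv G (f y) v = (\<Sum>j\<in>UNIV. v $ j *\<^sub>R X j y)" if "y \<in> W" for y v
    using fderiv_eq[OF dG, of "f y"] W that Gf by auto
  ultimately show ?thesis
    using W e s(2) Gf by (intro that[of W e G]) (auto simp: V_def)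
qed

text \<open>The chart is shrunk to a preimage of a ball in \<open>N\<close>: a star-shaped range is needed for moving along
  rays to the origin, and \<open>N\<close> serves to keep a coordinate positive.\<close>

theorem radiant_flat_coordinates:
  assumes flat: "flat_connection M nabla" and rad: "radiant_vf M nabla \<rho>" and p: "p \<in> U"
    and P: "linear P" "linear Q" "\<And>v. P (Q v) = v" "\<And>v. Q (P v) = v"
    and \<rho>p: "\<rho> p = cvec (P y0) p" and N: "open N" "y0 \<in> N"
  obtains d e where "flat_coordinates M nabla d" "p \<in> fst d" "snd d p = y0"
    "e > 0" "snd d ` fst d = ball y0 e" "ball y0 e \<subseteq> N"
    "\<And>q. q \<in> fst d \<Longrightarrow> \<rho> q = euler_field M d q"
    "\<And>v. coord_vec M d v p = cvec (P v) p"
proof -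
  obtain r where r: "smooth_on \<Omega> r" "\<And>q. q \<in> U \<Longrightarrow> \<rho> q = cfield r q"
    "\<And>y v. y \<in> \<Omega> \<Longrightarrow> fderiv r y v + christoffel y v (r y) = v"
    using radiant_in_coordinates[OF rad] by blast
  have x0: "x p \<in> \<Omega>" using p by blast
  obtain s X f where s: "s > 0" "ball (x p) s \<subseteq> \<Omega>"
    and smX: "\<And>j. smooth_on (ball (x p) s) (X j)" and smf: "smooth_on (ball (x p) s) f"
    and X0: "\<And>j. X j (x p) = P (axis j 1)" and f0: "f (x p) = Q (r (x p))"
    and dX: "\<And>j y v. y \<in> ball (x p) s \<Longrightarrow> fderiv (X j) y v + christoffel y v (X j y) = 0"
    and PQ: "\<And>y v. y \<in> ball (x p) s \<Longrightarrow> (\<Sum>j\<in>UNIV. fderiv f y v $ j *\<^sub>R X j y) = v"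
    and fX: "\<And>y. y \<in> ball (x p) s \<Longrightarrow> (\<Sum>j\<in>UNIV. f y $ j *\<^sub>R X j y) = r y"
    using parallel_frame_coordinates[OF flat x0 r(1,3) P] by blast
  have "r (x p) = P y0" using \<rho>p r(2)[OF p] by (simp add: cfield_def cvec_inject p)
  then have f0: "f (x p) = y0" using f0 P(4) by simp
  have xB: "x p \<in> ball (x p) s" using s by simp
  have fN: "f (x p) \<in> N" using f0 N by simp
  obtain W e G where W: "open W" "W \<subseteq> ball (x p) s" "x p \<in> W" and e: "e > 0" "f ` W = ball y0 e" "ball y0 e \<subseteq> N"
    and G: "smooth_on (ball y0 e) G" "\<And>y. y \<in> W \<Longrightarrow> G (f y) = y"
    "\<And>y v. y \<in> W \<Longrightarrow> fderiv G (f y) v = (\<Sum>j\<in>UNIV. v $ j *\<^sub>R X j y)"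
    using frame_diffeomorphism[OF open_ball xB smf smX PQ N(1) fN, unfolded f0] by blast
  define d where "d = (pt ` W, f \<circ> x)"
  have W\<Omega>: "W \<subseteq> \<Omega>" using W s by blast
  have d: "local_coordinates M d" "snd d ` fst d = ball y0 e" "\<And>z. z \<in> ball y0 e \<Longrightarrow> chart_inv d z = pt (G z)"
    unfolding d_def e(2)[symmetric]
    by (rule reparametrise[OF W(1) W\<Omega> smooth_on_subset[OF smf W(2)], of G]; use e(2) G in simp)+
  interpret d: local_chart M d using manifold d(1) by unfold_locales
  have fstd: "fst d = pt ` W" by (simp add: d_def)
  have xW: "x q \<in> W" and qU: "q \<in> U" if "q \<in> fst d" for q
    using that W\<Omega> by (auto simp: fstd)
  have dU: "fst d \<subseteq> U" using qU by blast
  have sndd: "snd d q = f (x q)" for q by (simp add: d_def)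
  have xd: "x ` fst d = W" unfolding fstd by (rule chart_image_inv_image[OF W\<Omega>])
  have GW: "(x \<circ> chart_inv d) z = G z" if "z \<in> ball y0 e" for z
  proof -
    obtain y where y: "y \<in> W" "z = f y" using \<open>z \<in> ball y0 e\<close> e(2) by blast
    have "x (pt y) = y" by (rule x_pt) (use y W\<Omega> in blast)
    then show ?thesis using d(3)[OF that] G(2)[OF y(1)] by (simp add: y(2))
  qed
  have change: "coord_vec M d v q = cvec (\<Sum>j\<in>UNIV. v $ j *\<^sub>R X j (x q)) q" if q: "q \<in> fst d" for v q
  proof -
    have "coord_vec M d v q = cvec (fderiv (x \<circ> chart_inv d) (snd d q) v) q"
    proof (rule coord_vec_change[OF _ _ qU[OF q] q])
      show "local_chart M c" by unfold_locales
      show "local_chart M d" by unfold_locales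
      have "U \<inter> fst d = fst d" using dU by blast
      then have "snd d ` (U \<inter> fst d) = ball y0 e" using d(2) by simp
      moreover have "smooth_on (ball y0 e) (x \<circ> chart_inv d)"
        by (rule smooth_on_cong[THEN iffD1, OF _ _ G(1)]) (use GW in auto)
      ultimately show "smooth_on (snd d ` (U \<inter> fst d)) (x \<circ> chart_inv d)" by simp
    qed
    also have "fderiv (x \<circ> chart_inv d) (snd d q) = fderiv G (snd d q)"
      by (rule fderiv_cong_open[of "ball y0 e"]) (use d(2) q GW in auto)
    also have "\<dots> v = (\<Sum>j\<in>UNIV. v $ j *\<^sub>R X j (x q))"
      using G(3)[OF xW[OF q]] by (simp add: sndd)
    finally show ?thesis .
  qed
  have axis_sum: "(\<Sum>j\<in>UNIV. axis i 1 $ j *\<^sub>R X j y) = X i y" for i y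
    by (simp add: axis_def if_distrib[of "\<lambda>t. t *\<^sub>R _"] cong: if_cong)
  have cf: "coord_field M d i q = cfield (X i) q" if "q \<in> fst d" for i q
    using change[OF that, of "axis i 1"] by (simp add: coord_field_def cfield_def axis_sum)
  have smXW: "smooth_on W (X i)" for i by (rule smooth_on_subset[OF smX W(2)])
  have "parallel_vf M nabla (fst d) (coord_field M d i)" for i
    unfolding parallel_vf_def
  proof (intro conjI allI impI ballI)
    show "smooth_vf M (fst d) (coord_field M d i)"
      by (rule smooth_vf_cfield[OF d.openU dU]) (use smXW cf xd in auto)
    fix V Y q assume V: "V \<subseteq> fst d" and Y: "smooth_vf M V Y" and q: "q \<in> V"
    have oV: "openin (mtop M) V" and VU: "V \<subseteq> U" using Y V dU by (auto simp: smooth_vf_def)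
    obtain a where a: "smooth_on (x ` V) a" "\<And>q. q \<in> V \<Longrightarrow> Y q = cfield a q"
      using smooth_vf_obtain[OF Y VU] by blast
    have smV: "smooth_on (x ` V) (X i)" by (rule smooth_on_subset[OF smXW]) (use V xd in blast)
    have "nabla Y (coord_field M d i) q = cvec (fderiv (X i) (x q) (a (x q)) + christoffel (x q) (a (x q)) (X i (x q))) q"
      by (rule nabla_cfield[OF oV VU q a smV]) (use V cf in auto)
    also have "\<dots> = zero_tvec"
    proof -
      have "x q \<in> ball (x p) s" "q \<in> U" using xW qU V q W(2) by blast+
      then show ?thesis by (simp only: dX cvec_0)
    qed
    finally show "nabla Y (coord_field M d i) q = zero_tvec" .
  qed
  then have "flat_coordinates M nabla d" using d(1) by (simp add: flat_coordinates_def)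
  moreover have "\<rho> q = euler_field M d q" if "q \<in> fst d" for q
    using that d.euler_field_eq[OF that] change[OF that, of "snd d q"] fX[of "x q"] xW[OF that] W(2) r(2)[OF qU[OF that]]
    by (auto simp: sndd cfield_def)
  moreover have pd: "p \<in> fst d" unfolding fstd using W(3) p by (metis image_eqI pt_x)
  moreover have "coord_vec M d v p = cvec (P v) p" for v
  proof -
    have "P v = (\<Sum>j\<in>UNIV. v $ j *\<^sub>R P (axis j 1))"
      by (subst sum_axis[of v, symmetric]) (simp only: linear_sum[OF P(1)] linear_cmul[OF P(1)])
    then show ?thesis using change[OF pd, of v] X0 by simp
  qed
  ultimately show ?thesis using that[of d e] e d(2) f0 sndd by simp
qed

end

section \<open>Radiant Hessian metrics in flat coordinates\<close>

locale metric_chart = local_chart M c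
  for M :: "('a, 'm::finite) manifold" and c :: "('a, 'm) chart" +
  fixes g :: "'a \<Rightarrow> 'a tvec \<Rightarrow> 'a tvec \<Rightarrow> real"
  assumes riemannian: "riemannian_metric M g"
begin

text \<open>The coefficients of the metric, as a bilinear form on coordinate space.\<close>

definition G :: "real ^ 'm \<Rightarrow> real ^ 'm \<Rightarrow> real ^ 'm \<Rightarrow> real" where
  "G y a b = g (pt y) (cvec a (pt y)) (cvec b (pt y))"

lemma g_eq_G: "q \<in> U \<Longrightarrow> g q (cvec a q) (cvec b q) = G (x q) a b"
  by (simp add: G_def)

lemma pt_points: "y \<in> \<Omega> \<Longrightarrow> pt y \<in> points M"
  using pt_in openin_subset[OF openU] by blast

lemma cvec_tangent: "q \<in> U \<Longrightarrow> cvec a q \<in> tangent_space M q"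
  by (simp add: tangent_space_eq)

lemma G_sym: "y \<in> \<Omega> \<Longrightarrow> G y a b = G y b a"
  using riemannian cvec_tangent[OF pt_in] pt_points unfolding riemannian_metric_def G_def by blast

lemma G_pos:
  assumes "y \<in> \<Omega>" "a \<noteq> 0" shows "G y a a > 0"
proof -
  have "cvec a (pt y) \<noteq> zero_tvec" using assms cvec_eq_zero[OF pt_in] by blast
  then show ?thesis
    using riemannian cvec_tangent[OF pt_in[OF assms(1)]] pt_points[OF assms(1)]
    unfolding riemannian_metric_def G_def by blast
qed

lemma G_linear_left: assumes y: "y \<in> \<Omega>" shows "linear (\<lambda>a. G y a b)"
proof -
  have comb: "G y (s *\<^sub>R a + t *\<^sub>R a') b = s * G y a b + t * G y a' b" for s t a a'
  proof -
    have "cvec (s *\<^sub>R a + t *\<^sub>R a') (pt y) = (\<lambda>f. s * cvec a (pt y) f + t * cvec a' (pt y) f)"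
      using y by (simp only: cvec_add[OF pt_in] cvec_scaleR[OF pt_in])
    moreover have "g (pt y) (\<lambda>f. s * cvec a (pt y) f + t * cvec a' (pt y) f) (cvec b (pt y))
      = s * g (pt y) (cvec a (pt y)) (cvec b (pt y)) + t * g (pt y) (cvec a' (pt y)) (cvec b (pt y))"
      using riemannian cvec_tangent[OF pt_in[OF y]] pt_points[OF y] unfolding riemannian_metric_def by blast
    ultimately show ?thesis by (simp add: G_def)
  qed
  show ?thesis
    using comb[of 1 _ 1] comb[of _ _ 0 0] by (intro linearI) simp_all
qed

lemma G_linear_right: assumes y: "y \<in> \<Omega>" shows "linear (\<lambda>b. G y a b)"
  using G_linear_left[OF y, of a] by (simp only: G_sym[OF y, of _ a])

lemma G_smooth: "smooth_on \<Omega> (\<lambda>y. G y a b)"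
proof -
  have "smooth_fun M U (\<lambda>q. g q (cfield (\<lambda>_. a) q) (cfield (\<lambda>_. b) q))"
    using riemannian cfield_const_smooth[OF openU order_refl] unfolding riemannian_metric_def by blast
  then show ?thesis
    using smooth_fun_iff[OF openU order_refl] smooth_on_cong[OF open\<Omega>, of "\<lambda>y. G y a b"]
    by (simp add: cfield_def G_def o_def)
qed

lemma G_expand:
  assumes y: "y \<in> \<Omega>"
  shows "G y a b = (\<Sum>i\<in>UNIV. \<Sum>j\<in>UNIV. a $ i * (b $ j * G y (axis i 1) (axis j 1)))"
proof -
  have "G y a b = (\<Sum>i\<in>UNIV. a $ i * G y (axis i 1) b)"
    by (subst sum_axis[of a, symmetric])
      (simp only: linear_sum[OF G_linear_left[OF y]] linear_cmul[OF G_linear_left[OF y]] real_scaleR_def)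
  also have "\<dots> = (\<Sum>i\<in>UNIV. a $ i * (\<Sum>j\<in>UNIV. b $ j * G y (axis i 1) (axis j 1)))"
    by (subst (1) sum_axis[of b, symmetric])
      (simp only: linear_sum[OF G_linear_right[OF y]] linear_cmul[OF G_linear_right[OF y]] real_scaleR_def)
  finally show ?thesis by (simp add: sum_distrib_left)
qed

lemma G_fields_smooth:
  assumes S: "open S" "S \<subseteq> \<Omega>" and A: "smooth_on S A" and B: "smooth_on S B"
  shows "smooth_on S (\<lambda>z. G z (A z) (B z))"
proof -
  have "smooth_on S (\<lambda>z. \<Sum>i\<in>UNIV. \<Sum>j\<in>UNIV. A z $ i * (B z $ j * G z (axis i 1) (axis j 1)))"
    using A B smooth_on_subset[OF G_smooth S(2)]
    by (intro smooth_on_sum smooth_on_mult smooth_on_vec_nth S(1))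
  then show "smooth_on S (\<lambda>z. G z (A z) (B z))"
    by (rule smooth_on_cong[OF S(1), THEN iffD1, rotated]) (use S(2) G_expand in \<open>auto simp: subset_iff\<close>)
qed

lemma G_product_rule:
  assumes S: "open S" "S \<subseteq> \<Omega>" and A: "smooth_on S A" and B: "smooth_on S B" and y: "y \<in> S"
  shows "fderiv (\<lambda>z. G z (A z) (B z)) y v
    = fderiv (\<lambda>z. G z (A y) (B y)) y v + G y (fderiv A y v) (B y) + G y (A y) (fderiv B y v)"
proof -
  let ?g = "\<lambda>i j z. G z (axis i 1) (axis j 1)"
  have y\<Omega>: "y \<in> \<Omega>" using y S by blast
  have dg: "(?g i j has_derivative fderiv (?g i j) y) (at y)" for i j
    by (rule smooth_on_has_derivative[OF G_smooth y\<Omega>])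
  have dA: "((\<lambda>z. A z $ i) has_derivative (\<lambda>v. fderiv A y v $ i)) (at y)"
    and dB: "((\<lambda>z. B z $ i) has_derivative (\<lambda>v. fderiv B y v $ i)) (at y)" for i
    using A B y by (auto intro!: bounded_linear.has_derivative[OF bounded_linear_vec_nth] smooth_on_has_derivative)
  have expand: "((\<lambda>z. G z (A' z) (B' z)) has_derivative D) (at y)"
    if "((\<lambda>z. \<Sum>i\<in>UNIV. \<Sum>j\<in>UNIV. A' z $ i * (B' z $ j * ?g i j z)) has_derivative D) (at y)" for A' B' D
    by (rule has_derivative_transform_within_open[OF that S(1) y])
      (use S(2) G_expand in \<open>auto simp: subset_iff\<close>)
  have "((\<lambda>z. G z (A z) (B z)) has_derivative (\<lambda>v. \<Sum>i\<in>UNIV. \<Sum>j\<in>UNIV.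
      A y $ i * (B y $ j * fderiv (?g i j) y v + fderiv B y v $ j * ?g i j y)
      + fderiv A y v $ i * (B y $ j * ?g i j y))) (at y)"
    by (rule expand) (intro has_derivative_sum has_derivative_mult dA dB dg)
  from fderiv_eq[OF this]
  have "fderiv (\<lambda>z. G z (A z) (B z)) y v = (\<Sum>i\<in>UNIV. \<Sum>j\<in>UNIV.
      A y $ i * (B y $ j * fderiv (?g i j) y v + fderiv B y v $ j * ?g i j y)
      + fderiv A y v $ i * (B y $ j * ?g i j y))" by simp
  moreover have "((\<lambda>z. G z (A y) (B y)) has_derivative (\<lambda>v. \<Sum>i\<in>UNIV. \<Sum>j\<in>UNIV.
      A y $ i * (B y $ j * fderiv (?g i j) y v))) (at y)"
    by (rule expand) (intro has_derivative_sum has_derivative_mult_right dg)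
  from fderiv_eq[OF this]
  have "fderiv (\<lambda>z. G z (A y) (B y)) y v = (\<Sum>i\<in>UNIV. \<Sum>j\<in>UNIV. A y $ i * (B y $ j * fderiv (?g i j) y v))"
    by simp
  ultimately show ?thesis
    by (simp add: G_expand[OF y\<Omega>, of "fderiv A y v" "B y"] G_expand[OF y\<Omega>, of "A y" "fderiv B y v"]
        sum.distrib algebra_simps)
qed

end

text \<open>Gram--Schmidt orthonormalisation: as long as there are fewer than \<open>CARD('m)\<close> vectors, some vector
  lies outside their span, and its component orthogonal to them can be normalised.\<close>

lemma orthonormal_frame_exists:
  fixes B :: "real ^ 'm::finite \<Rightarrow> real ^ 'm \<Rightarrow> real"
  assumes lin: "\<And>b. linear (\<lambda>a. B a b)" and sym: "\<And>a b. B a b = B b a"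
    and pos: "\<And>a. a \<noteq> 0 \<Longrightarrow> B a a > 0"
  shows "\<exists>P Q :: real ^ 'm \<Rightarrow> real ^ 'm. linear P \<and> linear Q \<and> (\<forall>v. P (Q v) = v) \<and>
    (\<forall>v. Q (P v) = v) \<and> (\<forall>a b. B (P a) (P b) = a \<bullet> b)"
proof -
  have lin2: "linear (\<lambda>b. B a b)" for a using lin[of a] by (simp only: sym[of _ a])
  have "\<exists>w. \<forall>i\<in>I. \<forall>j\<in>I. B (w i) (w j) = (if i = j then 1 else 0)" if "finite I" for I :: "'m set"
    using that
  proof (induction I rule: finite_induct)
    case (insert i I)
    then obtain w where w: "\<And>j k. j \<in> I \<Longrightarrow> k \<in> I \<Longrightarrow> B (w j) (w k) = (if j = k then 1 else 0)" by blast
    have "dim (w ` I) \<le> card I"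
      using dim_le_card'[of "w ` I"] card_image_le[of I w] insert.hyps(1) by simp
    also have "\<dots> < CARD('m)" using insert.hyps by (metis card_mono card_seteq finite_code insertI1 not_le top_greatest UNIV_I)
    finally have "span (w ` I) \<noteq> UNIV" by (metis dim_UNIV dim_span nat_less_le DIM_cart DIM_real mult_1_right)
    then obtain v where v: "v \<notin> span (w ` I)" by blast
    define u where "u = v - (\<Sum>j\<in>I. B v (w j) *\<^sub>R w j)"
    have "(\<Sum>j\<in>I. B v (w j) *\<^sub>R w j) \<in> span (w ` I)" by (intro span_sum span_scale span_base) auto
    then have "u \<noteq> 0" using v by (auto simp: u_def)
    then have B0: "B u u > 0" by (rule pos)
    have ortho: "B u (w k) = 0" if "k \<in> I" for k
    proof -
      have "B u (w k) = B v (w k) - (\<Sum>j\<in>I. B v (w j) * B (w j) (w k))"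
        by (simp add: u_def linear_diff[OF lin] linear_sum[OF lin] linear_cmul[OF lin])
      also have "(\<Sum>j\<in>I. B v (w j) * B (w j) (w k)) = (\<Sum>j\<in>I. if j = k then B v (w j) else 0)"
        by (rule sum.cong) (use w that in auto)
      finally show ?thesis using that insert.hyps(1) by (simp add: sum.delta)
    qed
    define u' where "u' = (1 / sqrt (B u u)) *\<^sub>R u"
    have "B u' u' = 1" using B0 by (simp add: u'_def linear_cmul[OF lin] linear_cmul[OF lin2] field_simps)
    moreover have "B u' (w k) = 0" "B (w k) u' = 0" if "k \<in> I" for k
      using ortho[OF that] sym[of "w k"] by (simp_all add: u'_def linear_cmul[OF lin])
    ultimately show ?case using insert.hyps w by (intro exI[of _ "w(i := u')"]) auto
  qed auto
  from this[OF finite_class.finite_UNIV] obtain w :: "'m \<Rightarrow> real ^ 'm" where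
    "\<forall>j\<in>UNIV. \<forall>k\<in>UNIV. B (w j) (w k) = (if j = k then 1 else 0)" by blast
  then have w: "B (w j) (w k) = (if j = k then 1 else 0)" for j k by simp
  define P where "P a = (\<Sum>i\<in>UNIV. a $ i *\<^sub>R w i)" for a :: "real ^ 'm"
  have linP: "linear P"
    unfolding P_def by (auto intro!: linearI simp: scaleR_add_left sum.distrib scaleR_sum_right)
  have BP: "B (P a) (P b) = a \<bullet> b" for a b
    by (simp add: P_def linear_sum[OF lin] linear_cmul[OF lin] linear_sum[OF lin2] linear_cmul[OF lin2] w
        inner_vec_def if_distrib mult.commute cong: if_cong)
  have "inj P"
    unfolding linear_injective_0[OF linP]
  proof (intro allI impI)
    fix a assume "P a = 0"
    then have "a \<bullet> a = 0" using BP[of a a] linear_0[OF lin] by simp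
    then show "a = 0" by simp
  qed
  then obtain Q where "linear Q" "\<forall>v. Q (P v) = v" "\<forall>v. P (Q v) = v"
    using linear_injective_isomorphism[OF linP _ refl] by blast
  then show ?thesis using linP BP by blast
qed

locale radiant_chart = affine_chart M c nabla + metric_chart M c g
  for M :: "('a, 'm::finite) manifold" and c :: "('a, 'm) chart" and nabla and g +
  fixes \<xi> \<rho> :: "'a vfield" and l :: real
  assumes radiant: "radiant_Hessian_manifold M nabla g \<xi> \<rho> l"
    and flat: "flat_coordinates M nabla c"
    and euler: "\<And>q. q \<in> fst c \<Longrightarrow> \<rho> q = euler_field M c q"
begin

text \<open>The degree of homogeneity of the metric, as a tensor, under the flow of the Euler field.\<close>

definition m :: real where "m = 2 / l"

lemma l: "l \<noteq> 0" "m \<noteq> 0" "m \<noteq> 1"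
  using radiant by (auto simp: radiant_Hessian_manifold_def m_def)

lemma selfsimilar: "selfsimilar_Hessian_manifold M nabla g \<xi>"
  using radiant by (simp add: radiant_Hessian_manifold_def)

lemma \<xi>_eq: "q \<in> U \<Longrightarrow> \<xi> q = cfield (\<lambda>y. l *\<^sub>R y) q"
  using radiant openin_subset[OF openU] euler euler_field_eq
  by (auto simp: radiant_Hessian_manifold_def cfield_def cvec_scaleR)

lemma christoffel_0:
  assumes y: "y \<in> \<Omega>" shows "christoffel y v w = 0"
proof -
  have "nabla (coord_field M c i) (coord_field M c j) (pt y) = zero_tvec" for i j
    using flat pt_in[OF y] cfield_const_smooth[OF openU order_refl]
    unfolding flat_coordinates_def parallel_vf_def coord_field_cfield by blast
  then have "christoffel_symbol i j y = 0" for i j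
    by (simp add: christoffel_symbol_def vec_eq_iff zero_tvec_def coord_field_cfield)
  then show ?thesis by (simp add: christoffel_def)
qed

lemma nabla_flat:
  assumes "openin (mtop M) V" "V \<subseteq> U" "q \<in> V"
    and "smooth_on (x ` V) a" "\<And>q. q \<in> V \<Longrightarrow> X q = cfield a q"
    and "smooth_on (x ` V) b" "\<And>q. q \<in> V \<Longrightarrow> Y q = cfield b q"
  shows "nabla X Y q = cvec (fderiv b (x q) (a (x q))) q"
  using nabla_cfield[OF assms] christoffel_0[of "x q"] assms(2,3) by auto

text \<open>In flat coordinates the Hessian metric is a matrix of second derivatives, so its first
  derivatives are symmetric in all three indices.\<close>

lemma codazzi:
  assumes y: "y \<in> \<Omega>"
  shows "fderiv (\<lambda>z. G z a b) y v = fderiv (\<lambda>z. G z v b) y a"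
proof -
  have q: "pt y \<in> U" "x (pt y) = y" using y by auto
  obtain N u where N: "pt y \<in> N" "is_Hess_on M nabla N g u"
    using selfsimilar pt_points[OF y] unfolding selfsimilar_Hessian_manifold_def Hessian_manifold_def by blast
  define V where "V = N \<inter> U"
  have V: "openin (mtop M) V" "V \<subseteq> U" "V \<subseteq> N" "pt y \<in> V"
    using N q openU by (auto simp: V_def is_Hess_on_def smooth_fun_def)
  have u: "smooth_fun M V u" using N(2) V by (auto simp: is_Hess_on_def intro: smooth_fun_subset)
  define F where "F = u \<circ> pt"
  have smF: "smooth_on (x ` V) F" using smooth_fun_iff[OF V(1,2)] u by (simp add: F_def)
  have uF: "u r = F (x r)" if "r \<in> V" for r using that V by (auto simp: F_def subset_iff)
  have oV: "open (x ` V)" by (rule open_image[OF V(1,2)])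
  note const = cfield_const_smooth[OF V(1,2)]
  have hess: "G z a b = fderiv (\<lambda>z. fderiv F z b) z a" if "z \<in> x ` V" for a b z
  proof -
    obtain r where r: "r \<in> V" "z = x r" using \<open>z \<in> x ` V\<close> by blast
    have "G z a b = g r (cfield (\<lambda>_. a) r) (cfield (\<lambda>_. b) r)"
      using r V by (simp add: cfield_def g_eq_G subset_iff)
    also have "\<dots> = Hess nabla u (cfield (\<lambda>_. a)) (cfield (\<lambda>_. b)) r"
      using N(2) V(3) const r(1) unfolding is_Hess_on_def by blast
    also have "\<dots> = cfield (\<lambda>_. a) r (\<lambda>s. cfield (\<lambda>_. b) s u)"
      using nabla_flat[OF V(1,2) r(1) smooth_on_const refl smooth_on_const refl, of a b] r V(2)
      by (auto simp: Hess_def nabla_form_def differential_def frechet_derivative_const cvec_0 zero_tvec_def subset_iff)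
    also have "\<dots> = cvec a r (\<lambda>s. cfield (\<lambda>_. b) s u)" by (simp add: cfield_def[of _ r])
    also have "\<dots> = fderiv (\<lambda>z. fderiv F z b) (x r) a"
    proof (rule cvec_apply[OF _ V(2) r(1)])
      show "smooth_fun M V (\<lambda>s. cfield (\<lambda>_. b) s u)" using const u unfolding smooth_vf_def by blast
      show "cfield (\<lambda>_. b) s u = fderiv F (x s) b" if "s \<in> V" for s
        unfolding cfield_def by (rule cvec_apply[OF u V(2) that uF])
    qed
    finally show ?thesis by (simp add: r(2))
  qed
  have yV: "y \<in> x ` V" using V(4) q(2) by (metis image_eqI)
  have eq: "fderiv (\<lambda>z. G z a b) y = fderiv (\<lambda>z. fderiv (\<lambda>z. fderiv F z b) z a) y" for a
    by (rule fderiv_cong_open[OF oV yV hess])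
  show ?thesis unfolding eq
    by (rule fderiv_commute[OF oV smooth_on_fderiv[OF smF] yV])
qed

text \<open>Since \<open>\<xi>\<close> is \<open>l\<close> times the Euler field, \<open>[\<xi>, \<partial>\<^sub>a] = - l \<partial>\<^sub>a\<close>. So \<open>L\<^sub>\<xi> g = 2 g\<close> says that the
  coefficients of the metric are homogeneous of degree \<open>2/l - 2\<close>.\<close>

lemma metric_homogeneous:
  assumes y: "y \<in> \<Omega>"
  shows "fderiv (\<lambda>z. G z a b) y y = (m - 2) * G y a b"
proof -
  define q where "q = pt y"
  have q: "q \<in> U" "x q = y" using y by (auto simp: q_def)
  note const = cfield_const_smooth[OF openU order_refl]
  have \<xi>: "smooth_vf M U \<xi>"
    using selfsimilar openU openin_subset[OF openU]
    by (auto simp: selfsimilar_Hessian_manifold_def intro: smooth_vf_subset)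
  have smE: "smooth_on \<Omega> (\<lambda>y. l *\<^sub>R y)"
    by (intro smooth_on_scaleR open\<Omega> smooth_on_const smooth_on_ident)
  have dE: "fderiv (\<lambda>y. l *\<^sub>R y) z = (\<lambda>v. l *\<^sub>R v)" for z :: "real ^ 'm"
    by (rule fderiv_eq) (auto intro!: derivative_eq_intros)
  have br: "lie_bracket M \<xi> (cfield (\<lambda>_. a)) q = cvec (- l *\<^sub>R a) q" for a
  proof -
    have "lie_bracket M \<xi> (cfield (\<lambda>_. a)) q
      = (\<lambda>f. nabla \<xi> (cfield (\<lambda>_. a)) q f - nabla (cfield (\<lambda>_. a)) \<xi> q f)"
      using selfsimilar \<xi> const q(1)
      unfolding selfsimilar_Hessian_manifold_def Hessian_manifold_def flat_affine_manifold_def torsion_free_def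
      by metis
    also have "nabla \<xi> (cfield (\<lambda>_. a)) q = cvec 0 q"
      using nabla_flat[OF openU order_refl q(1) smE \<xi>_eq smooth_on_const refl]
      by (simp add: frechet_derivative_const)
    also have "nabla (cfield (\<lambda>_. a)) \<xi> q = cvec (l *\<^sub>R a) q"
      using nabla_flat[OF openU order_refl q(1) smooth_on_const refl smE \<xi>_eq, of a] by (simp add: dE)
    finally show ?thesis
      using cvec_scaleR[OF q(1), of "-l" a] cvec_scaleR[OF q(1), of l a]
      by (simp add: cvec_0[OF q(1)] zero_tvec_def)
  qed
  have "lie_deriv_metric M \<xi> g (cfield (\<lambda>_. a)) (cfield (\<lambda>_. b)) q = 2 * g q (cfield (\<lambda>_. a) q) (cfield (\<lambda>_. b) q)"
    using selfsimilar const q(1) unfolding selfsimilar_Hessian_manifold_def by blast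
  then have eq: "\<xi> q (\<lambda>r. g r (cfield (\<lambda>_. a) r) (cfield (\<lambda>_. b) r)) - G y (- l *\<^sub>R a) b - G y a (- l *\<^sub>R b) = 2 * G y a b"
    unfolding lie_deriv_metric_def br by (simp only: cfield_def[of _ q] g_eq_G[OF q(1)] q(2))
  have "\<xi> q (\<lambda>r. g r (cfield (\<lambda>_. a) r) (cfield (\<lambda>_. b) r)) = cvec (l *\<^sub>R y) q (\<lambda>r. g r (cfield (\<lambda>_. a) r) (cfield (\<lambda>_. b) r))"
    by (simp only: \<xi>_eq[OF q(1)] cfield_def[of _ q] q(2))
  also have "\<dots> = fderiv (\<lambda>z. G z a b) (x q) (l *\<^sub>R y)"
  proof (rule cvec_apply[OF _ order_refl q(1)])
    show "smooth_fun M U (\<lambda>r. g r (cfield (\<lambda>_. a) r) (cfield (\<lambda>_. b) r))"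
      using riemannian const unfolding riemannian_metric_def by blast
  qed (simp add: cfield_def g_eq_G)
  also have "\<dots> = l * fderiv (\<lambda>z. G z a b) y y"
    using linear_cmul[OF smooth_on_linear_fderiv[OF G_smooth y]] by (simp add: q(2))
  finally have "l * fderiv (\<lambda>z. G z a b) y y + l * G y a b + l * G y a b = 2 * G y a b"
    using eq linear_cmul[OF G_linear_left[OF y], of "-l" a b] linear_cmul[OF G_linear_right[OF y], of a "-l" b]
    by simp
  then show ?thesis using l(1) by (simp add: m_def field_simps)
qed

text \<open>At the origin the Euler field vanishes, so coefficients that do not vanish there can only be
  homogeneous of degree \<open>0\<close>; they are then constant along rays, hence constant.\<close>

lemma metric_at_origin:
  assumes ball: "\<Omega> = ball 0 e" and y: "y \<in> \<Omega>"
  shows "l = 1" "G y a b = G 0 a b"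
proof -
  have 0: "0 \<in> \<Omega>" using ball y by (metis ball_eq_empty centre_in_ball empty_iff not_le)
  obtain w :: "real ^ 'm" where "w \<noteq> 0" using axis_eq_0_iff zero_neq_one by metis
  have "(m - 2) * G 0 w w = 0"
    using metric_homogeneous[OF 0, of w w] linear_0[OF smooth_on_linear_fderiv[OF G_smooth 0]] by simp
  then have m: "m = 2" using G_pos[OF 0 \<open>w \<noteq> 0\<close>] by simp
  then show "l = 1" using l(1) by (simp add: m_def field_simps)
  have mem: "t *\<^sub>R y \<in> \<Omega>" if "0 \<le> t" "t \<le> 1" for t
  proof -
    have "norm (t *\<^sub>R y) \<le> 1 * norm y" unfolding norm_scaleR using that by (intro mult_right_mono) auto
    then show ?thesis using y unfolding ball by simp
  qed
  have "G (1 *\<^sub>R y) a b = G (0 *\<^sub>R y) a b"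
  proof (rule DERIV_isconst_end[of 0 "1::real" "\<lambda>t. G (t *\<^sub>R y) a b"])
    show "continuous_on {0..1} (\<lambda>t. G (t *\<^sub>R y) a b)"
      by (rule continuous_on_compose2[OF smooth_on_imp_continuous_on[OF G_smooth]])
        (use mem in \<open>auto intro!: continuous_intros\<close>)
    fix t :: real assume t: "0 < t" "t < 1"
    have mt: "t *\<^sub>R y \<in> \<Omega>" using mem t by simp
    let ?D = "fderiv (\<lambda>z. G z a b) (t *\<^sub>R y)"
    note lin = smooth_on_linear_fderiv[OF G_smooth mt, of a b]
    have "t * ?D y = 0" using metric_homogeneous[OF mt, of a b] linear_cmul[OF lin, of t y] by (simp add: m)
    then have "?D y = 0" using t by simp
    moreover have "((\<lambda>t. t *\<^sub>R y) has_derivative (\<lambda>s. s *\<^sub>R y)) (at t)"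
      by (auto intro!: derivative_eq_intros)
    from has_derivative_compose[OF this smooth_on_has_derivative[OF G_smooth[of a b] mt]]
    have "((\<lambda>t. G (t *\<^sub>R y) a b) has_derivative (\<lambda>s. ?D (s *\<^sub>R y))) (at t)" .
    ultimately show "((\<lambda>t. G (t *\<^sub>R y) a b) has_real_derivative 0) (at t)"
      unfolding has_field_derivative_def by (simp add: linear_cmul[OF lin] lambda_zero)
  qed simp
  then show "G y a b = G 0 a b" by simp
qed

text \<open>If \<open>g = Hess \<phi>\<close> with \<open>\<phi>\<close> homogeneous of degree \<open>m\<close>, then \<open>g(E, E) = (m\<^sup>2 - m) \<phi>\<close> for the Euler
  field \<open>E\<close>. This determines the candidate for such a potential.\<close>

definition potential :: "real ^ 'm \<Rightarrow> real" where
  "potential y = G y y y / (m\<^sup>2 - m)"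

lemma m2m: "m\<^sup>2 - m \<noteq> 0" "m - 1 \<noteq> 0" "m\<^sup>2 - m = m * (m - 1)"
  using l by (auto simp: power2_eq_square algebra_simps)

lemma potential_smooth: "smooth_on \<Omega> potential"
proof -
  have "smooth_on \<Omega> (\<lambda>y. (1 / (m\<^sup>2 - m)) * G y y y)"
    by (intro smooth_on_mult open\<Omega> smooth_on_const G_fields_smooth smooth_on_ident order_refl)
  then show ?thesis by (simp add: potential_def[abs_def])
qed

text \<open>By the symmetry of the derivatives of the metric, differentiating \<open>g(E, E)\<close> in a direction \<open>v\<close>
  amounts to differentiating \<open>g(v, E)\<close> along the Euler field, where homogeneity applies. The
  second derivatives of the potential are computed in the same way.\<close>

lemma potential_deriv:
  assumes y: "y \<in> \<Omega>"
  shows "fderiv potential y v = G y y v / (m - 1)"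
proof -
  note id = smooth_on_ident[OF open\<Omega>]
  have "fderiv (\<lambda>z. G z z z) y v = fderiv (\<lambda>z. G z y y) y v + G y v y + G y y v"
    using G_product_rule[OF open\<Omega> order_refl id id y, of v] by (simp add: frechet_derivative_ident)
  also have "\<dots> = m * G y y v"
    using codazzi[OF y, of y y v] metric_homogeneous[OF y, of v y] G_sym[OF y, of v y] by (simp add: algebra_simps)
  finally have *: "fderiv (\<lambda>z. G z z z) y v = m * G y y v" .
  have "((\<lambda>z. G z z z / (m\<^sup>2 - m)) has_derivative (\<lambda>v. fderiv (\<lambda>z. G z z z) y v / (m\<^sup>2 - m))) (at y)"
    by (rule bounded_linear.has_derivative[OF bounded_linear_divide
        smooth_on_has_derivative[OF G_fields_smooth[OF open\<Omega> order_refl id id] y]])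
  from fderiv_eq[OF this] have "fderiv potential y v = m * G y y v / (m\<^sup>2 - m)"
    by (simp add: potential_def[abs_def] *)
  then show ?thesis using l m2m by simp
qed

lemma potential_second_deriv:
  assumes S: "open S" "S \<subseteq> \<Omega>" and y: "y \<in> S" and b: "smooth_on S b"
  shows "fderiv (\<lambda>z. fderiv potential z (b z)) y v = G y v (b y) + fderiv potential y (fderiv b y v)"
proof -
  have y\<Omega>: "y \<in> \<Omega>" using y S by blast
  note id = smooth_on_ident[OF S(1)]
  have "fderiv (\<lambda>z. G z z (b z)) y v = fderiv (\<lambda>z. G z y (b y)) y v + G y v (b y) + G y y (fderiv b y v)"
    using G_product_rule[OF S id b y, of v] by (simp add: frechet_derivative_ident)
  also have "\<dots> = (m - 1) * G y v (b y) + G y y (fderiv b y v)"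
    using codazzi[OF y\<Omega>, of y "b y" v] metric_homogeneous[OF y\<Omega>, of v "b y"] by (simp add: algebra_simps)
  finally have *: "fderiv (\<lambda>z. G z z (b z)) y v = (m - 1) * G y v (b y) + G y y (fderiv b y v)" .
  have "((\<lambda>z. G z z (b z) / (m - 1)) has_derivative (\<lambda>v. fderiv (\<lambda>z. G z z (b z)) y v / (m - 1))) (at y)"
    by (rule bounded_linear.has_derivative[OF bounded_linear_divide
        smooth_on_has_derivative[OF G_fields_smooth[OF S id b] y]])
  from fderiv_eq[OF this]
  have "fderiv (\<lambda>z. G z z (b z) / (m - 1)) y v = ((m - 1) * G y v (b y) + G y y (fderiv b y v)) / (m - 1)"
    by (simp add: *)
  also have "\<dots> = G y v (b y) + fderiv potential y (fderiv b y v)"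
    using m2m(2) by (simp add: potential_deriv[OF y\<Omega>] add_divide_distrib)
  finally have "fderiv (\<lambda>z. G z z (b z) / (m - 1)) y v = G y v (b y) + fderiv potential y (fderiv b y v)" .
  moreover have "fderiv (\<lambda>z. fderiv potential z (b z)) y = fderiv (\<lambda>z. G z z (b z) / (m - 1)) y"
    by (rule fderiv_cong_open[OF S(1) y]) (use S(2) potential_deriv in blast)
  ultimately show ?thesis by simp
qed

lemma is_Hess_potential:
  assumes f: "\<And>q. q \<in> U \<Longrightarrow> f q = potential (x q)"
  shows "is_Hess_on M nabla U g f"
  unfolding is_Hess_on_def
proof (intro conjI allI impI ballI)
  show sf: "smooth_fun M U f" by (rule smooth_funI[OF openU order_refl potential_smooth f])
  fix V X Y q assume V: "V \<subseteq> U" and X: "smooth_vf M V X" and Y: "smooth_vf M V Y" and q: "q \<in> V"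
  have oV: "openin (mtop M) V" using X by (simp add: smooth_vf_def)
  have oxV: "open (x ` V)" by (rule open_image[OF oV V])
  obtain a where a: "smooth_on (x ` V) a" "\<And>q. q \<in> V \<Longrightarrow> X q = cfield a q" using smooth_vf_obtain[OF X V] by blast
  obtain b where b: "smooth_on (x ` V) b" "\<And>q. q \<in> V \<Longrightarrow> Y q = cfield b q" using smooth_vf_obtain[OF Y V] by blast
  have sV: "smooth_fun M V f" by (rule smooth_fun_subset[OF sf oV V])
  have fV: "f r = potential (x r)" if "r \<in> V" for r using f V that by blast
  have "X q (\<lambda>r. Y r f) = cvec (a (x q)) q (\<lambda>r. Y r f)" by (simp add: a(2)[OF q] cfield_def)
  also have "\<dots> = fderiv (\<lambda>z. fderiv potential z (b z)) (x q) (a (x q))"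
  proof (rule cvec_apply[OF _ V q])
    show "smooth_fun M V (\<lambda>r. Y r f)" using Y sV unfolding smooth_vf_def by blast
    show "Y r f = fderiv potential (x r) (b (x r))" if "r \<in> V" for r
      unfolding b(2)[OF that] cfield_def by (rule cvec_apply[OF sV V that fV])
  qed
  also have "\<dots> = G (x q) (a (x q)) (b (x q)) + fderiv potential (x q) (fderiv b (x q) (a (x q)))"
    by (rule potential_second_deriv[OF oxV _ _ b(1)]) (use V q in auto)
  finally have "X q (\<lambda>r. Y r f) = G (x q) (a (x q)) (b (x q)) + fderiv potential (x q) (fderiv b (x q) (a (x q)))" .
  moreover have "nabla X Y q f = fderiv potential (x q) (fderiv b (x q) (a (x q)))"
  proof -
    have "nabla X Y q = cvec (fderiv b (x q) (a (x q))) q" by (rule nabla_flat[OF oV V q a b])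
    then show ?thesis using cvec_apply[OF sV V q fV] by simp
  qed
  moreover have "g q (X q) (Y q) = G (x q) (a (x q)) (b (x q))"
    using q V by (simp add: a(2) b(2) cfield_def g_eq_G subset_iff)
  ultimately show "g q (X q) (Y q) = Hess nabla f X Y q"
    by (simp add: Hess_def nabla_form_def differential_def)
qed

lemma powr_coord_smooth:
  assumes pos: "\<And>y. y \<in> \<Omega> \<Longrightarrow> y $ k > 0"
  shows "smooth_on \<Omega> (\<lambda>y. (y $ k) powr s)"
  by (rule smooth_on_compose[OF open\<Omega> open_greaterThan smooth_on_vec_nth[OF open\<Omega> smooth_on_ident[OF open\<Omega>]] smooth_on_powr])
    (use pos in auto)

lemma powr_coord_deriv:
  assumes y: "y \<in> \<Omega>" "y $ k > 0" and h: "smooth_on \<Omega> h"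
  shows "fderiv (\<lambda>z. (z $ k) powr s * h z) y v = s * (y $ k) powr (s - 1) * v $ k * h y + (y $ k) powr s * fderiv h y v"
proof -
  have "((\<lambda>z. z $ k) has_derivative (\<lambda>v. v $ k)) (at y)"
    by (rule bounded_linear_imp_has_derivative[OF bounded_linear_vec_nth])
  moreover have "((\<lambda>t. t powr s) has_derivative (\<lambda>t. (s * (y $ k) powr (s - 1)) * t)) (at (y $ k))"
    using has_real_derivative_powr[OF y(2), of s] by (simp add: has_field_derivative_def)
  ultimately have "((\<lambda>z. (z $ k) powr s) has_derivative (\<lambda>v. (s * (y $ k) powr (s - 1)) * v $ k)) (at y)"
    by (rule has_derivative_compose)
  from has_derivative_mult[OF this smooth_on_has_derivative[OF h y(1)]] show ?thesis
    by (subst fderiv_eq) (auto simp: algebra_simps)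
qed

text \<open>With \<open>E\<close> the Euler field, the second derivative of \<open>\<psi>\<close> in a direction \<open>X\<close> without \<open>k\<close>-component
  is a positive multiple of \<open>g(X, X)\<close>, and the lower bound for it expresses that \<open>g(X + E, X + E) > 0\<close>.\<close>

lemma potential_normal_form:
  assumes pos: "\<And>y. y \<in> \<Omega> \<Longrightarrow> y $ k > 0"
  defines "\<psi> \<equiv> \<lambda>q. (x q $ k) powr (- m) * potential (x q)"
  shows "smooth_fun M U \<psi>"
    and "is_Hess_on M nabla U g (\<lambda>q. (coord c k q) powr (2 / l) * \<psi> q)"
    and "\<And>q. q \<in> U \<Longrightarrow> euler_field M c q \<psi> = 0"
    and "\<And>q. q \<in> U \<Longrightarrow> (4 / l\<^sup>2 - 2 / l) * \<psi> q > 0"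
    and "\<And>b X q. \<exists>i. i \<noteq> k \<and> b i \<noteq> 0 \<Longrightarrow> X = (\<lambda>q f. \<Sum>i\<in>UNIV - {k}. b i * coord_field M c i q f) \<Longrightarrow>
       q \<in> U \<Longrightarrow> X q (\<lambda>r. X r \<psi>) > max ((2 - 4 / l) * X q \<psi> - (4 / l\<^sup>2 - 2 / l) * \<psi> q) 0"
proof -
  define \<Psi> where "\<Psi> y = (y $ k) powr (- m) * potential y" for y
  have sm\<Psi>: "smooth_on \<Omega> \<Psi>" unfolding \<Psi>_def
    by (intro smooth_on_mult open\<Omega> potential_smooth powr_coord_smooth pos)
  have \<psi>\<Psi>: "\<psi> q = \<Psi> (x q)" for q by (simp add: \<psi>_def \<Psi>_def)
  show s\<psi>: "smooth_fun M U \<psi>" by (rule smooth_funI[OF openU order_refl sm\<Psi> \<psi>\<Psi>])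
  have xpos: "x q $ k > 0" if "q \<in> U" for q using pos that by blast
  show "is_Hess_on M nabla U g (\<lambda>q. (coord c k q) powr (2 / l) * \<psi> q)"
  proof (rule is_Hess_potential)
    fix q assume "q \<in> U"
    then have "(x q $ k) powr m * (x q $ k) powr (- m) = 1"
      using xpos[of q] by (simp add: powr_add[symmetric])
    then show "(coord c k q) powr (2 / l) * \<psi> q = potential (x q)"
      by (simp add: coord_def \<psi>_def mult.assoc[symmetric] m_def)
  qed
  have m_eq: "4 / l\<^sup>2 - 2 / l = m\<^sup>2 - m" "2 - 4 / l = - 2 * (m - 1)"
    by (simp_all add: m_def power_divide)
  have d\<psi>: "cvec v q \<psi> = fderiv \<Psi> (x q) v" if "q \<in> U" for v q
    by (rule cvec_apply[OF s\<psi> order_refl that \<psi>\<Psi>])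
  have d\<Psi>: "fderiv \<Psi> y v = - m * (y $ k) powr (- m - 1) * v $ k * potential y + (y $ k) powr (- m) * fderiv potential y v"
    if "y \<in> \<Omega>" for y v
    unfolding \<Psi>_def[abs_def] by (rule powr_coord_deriv[OF that pos[OF that] potential_smooth])
  show "euler_field M c q \<psi> = 0" if q: "q \<in> U" for q
  proof -
    let ?y = "x q"
    have y: "?y \<in> \<Omega>" using q by blast
    have "(?y $ k) powr (- m - 1) * ?y $ k = (?y $ k) powr (- m - 1) * (?y $ k) powr 1"
      using xpos[OF q] by simp
    also have "\<dots> = (?y $ k) powr (- m)" by (simp only: powr_add[symmetric]) simp
    finally have *: "(?y $ k) powr (- m - 1) * ?y $ k = (?y $ k) powr (- m)" .
    have "fderiv potential ?y ?y = m * potential ?y"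
      using l m2m by (simp add: potential_deriv[OF y] potential_def m2m(3))
    then have "fderiv \<Psi> ?y ?y = - m * ((?y $ k) powr (- m - 1) * ?y $ k) * potential ?y + (?y $ k) powr (- m) * (m * potential ?y)"
      by (simp add: d\<Psi>[OF y])
    also have "\<dots> = 0" unfolding * by simp
    finally show ?thesis by (simp add: euler_field_eq[OF q] d\<psi>[OF q])
  qed
  show "(4 / l\<^sup>2 - 2 / l) * \<psi> q > 0" if q: "q \<in> U" for q
  proof -
    have "x q \<noteq> 0" using xpos[OF q] by auto
    then have "G (x q) (x q) (x q) > 0" using q by (intro G_pos) auto
    moreover have "(x q $ k) powr (- m) > 0" using xpos[OF q] by simp
    ultimately have "(x q $ k) powr (- m) * G (x q) (x q) (x q) > 0" by (rule mult_pos_pos[rotated])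
    then show ?thesis unfolding m_eq using m2m(1) by (simp add: \<psi>_def potential_def)
  qed
  show "X q (\<lambda>r. X r \<psi>) > max ((2 - 4 / l) * X q \<psi> - (4 / l\<^sup>2 - 2 / l) * \<psi> q) 0"
    if b: "\<exists>i. i \<noteq> k \<and> b i \<noteq> 0" and X: "X = (\<lambda>q f. \<Sum>i\<in>UNIV - {k}. b i * coord_field M c i q f)" and q: "q \<in> U"
    for b X q
  proof -
    define \<beta> :: "real ^ 'm" where "\<beta> = (\<Sum>i\<in>UNIV - {k}. b i *\<^sub>R axis i 1)"
    have \<beta>_nth: "\<beta> $ i = (if i = k then 0 else b i)" for i
      by (simp add: \<beta>_def axis_def if_distrib sum.If_cases cong: if_cong)
    have \<beta>: "\<beta> $ k = 0" "\<beta> \<noteq> 0" using b by (auto simp: \<beta>_nth vec_eq_iff)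
    have X\<beta>: "X r = cvec \<beta> r" if "r \<in> U" for r
      using cvec_sum[OF that, of b "\<lambda>i. axis i 1" "UNIV - {k}"] by (simp add: X \<beta>_def coord_field_def)
    have X1: "X r \<psi> = (x r $ k) powr (- m) * fderiv potential (x r) \<beta>" if "r \<in> U" for r
      using that by (simp add: X\<beta> d\<psi> d\<Psi> \<beta>)
    have sm': "smooth_on \<Omega> (\<lambda>y. fderiv potential y \<beta>)" by (rule smooth_on_fderiv[OF potential_smooth])
    define y where "y = x q"
    have y: "y \<in> \<Omega>" "y $ k > 0" using q xpos by (auto simp: y_def)
    have "X q (\<lambda>r. X r \<psi>) = fderiv (\<lambda>z. (z $ k) powr (- m) * fderiv potential z \<beta>) (x q) \<beta>"
      unfolding X\<beta>[OF q]
    proof (rule cvec_apply[where F = "\<lambda>z. (z $ k) powr (- m) * fderiv potential z \<beta>", OF _ order_refl q X1])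
      show "smooth_fun M U (\<lambda>r. X r \<psi>)"
        by (rule smooth_funI[where F = "\<lambda>z. (z $ k) powr (- m) * fderiv potential z \<beta>", OF openU order_refl _ X1])
          (intro smooth_on_mult open\<Omega> sm' powr_coord_smooth pos)
    qed
    also have "\<dots> = (y $ k) powr (- m) * fderiv (\<lambda>z. fderiv potential z \<beta>) y \<beta>"
      using powr_coord_deriv[OF y sm', of "- m" \<beta>] by (simp add: \<beta> y_def)
    also have "fderiv (\<lambda>z. fderiv potential z \<beta>) y \<beta> = G y \<beta> \<beta>"
      using potential_second_deriv[OF open\<Omega> order_refl y(1) smooth_on_const, of \<beta> \<beta>]
        linear_0[OF smooth_on_linear_fderiv[OF potential_smooth y(1)]]
      by (simp add: frechet_derivative_const)
    finally have X2: "X q (\<lambda>r. X r \<psi>) = (y $ k) powr (- m) * G y \<beta> \<beta>" .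
    have E: "(y $ k) powr (- m) > 0" using y by simp
    have "\<beta> + y \<noteq> 0"
    proof
      assume "\<beta> + y = 0"
      then have "(\<beta> + y) $ k = 0" by simp
      then show False using \<beta>(1) y(2) by simp
    qed
    from G_pos[OF y(1) this] have "G y \<beta> \<beta> > - 2 * G y y \<beta> - G y y y"
      by (simp add: linear_add[OF G_linear_left[OF y(1)]] linear_add[OF G_linear_right[OF y(1)]] G_sym[OF y(1), of \<beta> y])
    then have "(y $ k) powr (- m) * G y \<beta> \<beta> > (y $ k) powr (- m) * (- 2 * G y y \<beta> - G y y y)"
      using E by simp
    also have "(y $ k) powr (- m) * (- 2 * G y y \<beta> - G y y y)
       = (2 - 4 / l) * X q \<psi> - (4 / l\<^sup>2 - 2 / l) * \<psi> q"
    proof -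
      have "(2 - 4 / l) * X q \<psi> = - 2 * ((m - 1) * ((y $ k) powr (- m) * (G y y \<beta> / (m - 1))))"
        unfolding m_eq(2) X1[OF q] using potential_deriv[OF y(1), of \<beta>] by (simp only: y_def mult.assoc)
      also have "\<dots> = - 2 * ((y $ k) powr (- m) * G y y \<beta>)" using m2m(2) by simp
      finally have 1: "(2 - 4 / l) * X q \<psi> = - 2 * ((y $ k) powr (- m) * G y y \<beta>)" .
      have 2: "(4 / l\<^sup>2 - 2 / l) * \<psi> q = (y $ k) powr (- m) * G y y y"
        unfolding m_eq(1) using m2m(1) by (simp add: \<psi>_def y_def potential_def)
      show ?thesis unfolding 1 2 by (simp add: algebra_simps)
    qed
    finally have A: "(2 - 4 / l) * X q \<psi> - (4 / l\<^sup>2 - 2 / l) * \<psi> q < X q (\<lambda>r. X r \<psi>)" unfolding X2 .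
    have B: "0 < X q (\<lambda>r. X r \<psi>)" unfolding X2 using E G_pos[OF y(1) \<beta>(2)] by simp
    show ?thesis using A B by simp
  qed
qed

end

section \<open>The local structure theorem\<close>

theorem theorem1p5:
  fixes M :: "('a, 'm::finite) manifold"
    and nabla :: "'a vfield \<Rightarrow> 'a vfield \<Rightarrow> 'a vfield"
    and g :: "'a \<Rightarrow> 'a tvec \<Rightarrow> 'a tvec \<Rightarrow> real"
    and \<xi> \<rho> :: "'a vfield"
    and l :: real
    and n :: nat
    and k :: 'm
    and p :: 'a
  assumes "CARD('m) = n + 1"
    and "radiant_Hessian_manifold M nabla g \<xi> \<rho> l"
    and "p \<in> points M"
  shows
    "(\<xi> p = zero_tvec \<longrightarrow>
       (\<exists>c. flat_coordinates M nabla c \<and> p \<in> fst c \<and>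
          (\<forall>q\<in>fst c. \<forall>u\<in>tangent_space M q. \<forall>v\<in>tangent_space M q.
             g q u v = (\<Sum>i\<in>UNIV. differential (coord c i) q u * differential (coord c i) q v)) \<and>
          (\<forall>q\<in>fst c. \<xi> q = euler_field M c q)))
     \<and>
     (\<xi> p \<noteq> zero_tvec \<longrightarrow>
       (\<exists>c \<psi>. flat_coordinates M nabla c \<and> p \<in> fst c \<and>
          (\<forall>q\<in>fst c. coord c k q > 0) \<and>
          (\<forall>q\<in>fst c. \<xi> q = (\<lambda>f. l * euler_field M c q f)) \<and>
          smooth_fun M (fst c) \<psi> \<and>
          is_Hess_on M nabla (fst c) g (\<lambda>q. (coord c k q) powr (2 / l) * \<psi> q) \<and>
          (\<forall>q\<in>fst c. euler_field M c q \<psi> = 0) \<and>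
          (\<forall>q\<in>fst c. (4 / l\<^sup>2 - 2 / l) * \<psi> q > 0) \<and>
          (\<forall>b :: 'm \<Rightarrow> real. \<forall>X. (\<exists>i. i \<noteq> k \<and> b i \<noteq> 0) \<longrightarrow>
             X = (\<lambda>q f. \<Sum>i\<in>UNIV - {k}. b i * coord_field M c i q f) \<longrightarrow>
             (\<forall>q\<in>fst c. X q (\<lambda>r. X r \<psi>) >
                max ((2 - 4 / l) * X q \<psi> - (4 / l\<^sup>2 - 2 / l) * \<psi> q) 0))))"
proof -
  have sh: "selfsimilar_Hessian_manifold M nabla g \<xi>" and rad: "radiant_vf M nabla \<rho>"
    and \<xi>\<rho>: "\<xi> q = (\<lambda>f. l * \<rho> q f)" if "q \<in> points M" for q
    using assms(2) that by (auto simp: radiant_Hessian_manifold_def)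
  note sh = sh[OF assms(3)] and rad = rad[OF assms(3)]
  have mf: "smooth_manifold M" and conn: "affine_connection M nabla" and flat: "flat_connection M nabla"
    and riem: "riemannian_metric M g"
    using sh by (auto simp: selfsimilar_Hessian_manifold_def Hessian_manifold_def flat_affine_manifold_def)
  have l: "l \<noteq> 0" using assms(2) by (simp add: radiant_Hessian_manifold_def)
  obtain c0 where c0: "c0 \<in> atlas M" "p \<in> fst c0"
    using mf assms(3) unfolding smooth_manifold_def by blast
  interpret c0: affine_chart M c0 nabla
    using mf conn atlas_local_coordinates[OF mf c0(1)] by unfold_locales
  interpret g0: metric_chart M c0 g using riem by unfold_locales
  have "\<rho> p \<in> tangent_space M p" using rad assms(3) by (simp add: radiant_vf_def smooth_vf_def)
  then obtain r where r: "\<rho> p = coord_vec M c0 r p" using c0.tangent_space_eq[OF c0(2)] by blast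
  have \<xi>0: "\<xi> p = zero_tvec \<longleftrightarrow> r = 0"
    using l c0.cvec_eq_zero[OF c0(2), of "l *\<^sub>R r"] c0.cvec_scaleR[OF c0(2), of l r]
    by (simp add: \<xi>\<rho>[OF assms(3)] r)
  have chart: "radiant_chart M d nabla g \<xi> \<rho> l"
    if "flat_coordinates M nabla d" "\<And>q. q \<in> fst d \<Longrightarrow> \<rho> q = euler_field M d q" for d
    using that mf conn riem assms(2) by unfold_locales (auto simp: flat_coordinates_def)
  show ?thesis
  proof (intro conjI impI)
    assume "\<xi> p = zero_tvec"
    then have r0: "r = 0" using \<xi>0 by simp
    let ?y0 = "snd c0 p"
    have y0: "?y0 \<in> snd c0 ` fst c0" using c0(2) by blast
    \<comment> \<open>The initial frame is chosen orthonormal, so that the constant metric becomes the standard one.\<close>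
    obtain P Q :: "real ^ 'm \<Rightarrow> real ^ 'm"
      where P: "linear P" "linear Q" "\<And>v. P (Q v) = v" "\<And>v. Q (P v) = v"
      and orth: "\<And>a b. g0.G ?y0 (P a) (P b) = a \<bullet> b"
    proof -
      have "\<exists>P Q :: real ^ 'm \<Rightarrow> real ^ 'm. linear P \<and> linear Q \<and> (\<forall>v. P (Q v) = v) \<and>
        (\<forall>v. Q (P v) = v) \<and> (\<forall>a b. g0.G ?y0 (P a) (P b) = a \<bullet> b)"
        by (rule orthonormal_frame_exists) (rule g0.G_linear_left[OF y0] g0.G_sym[OF y0] g0.G_pos[OF y0]; assumption)+
      then show ?thesis using that by blast
    qed
    have \<rho>p: "\<rho> p = coord_vec M c0 (P 0) p" by (simp add: r r0 linear_0[OF P(1)])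
    obtain d e where d: "flat_coordinates M nabla d" "p \<in> fst d" "snd d p = 0"
      "e > 0" "snd d ` fst d = ball 0 e" "ball 0 e \<subseteq> UNIV"
      "\<And>q. q \<in> fst d \<Longrightarrow> \<rho> q = euler_field M d q" "\<And>v. coord_vec M d v p = coord_vec M c0 (P v) p"
      by (rule c0.radiant_flat_coordinates[OF flat rad c0(2) P \<rho>p open_UNIV UNIV_I])
        (rule that; (assumption | blast))
    interpret d: radiant_chart M d nabla g \<xi> \<rho> l by (rule chart[OF d(1,7)])
    have G0: "d.G 0 a b = a \<bullet> b" for a b
      using d.g_eq_G[OF d(2), of a b] g0.g_eq_G[OF c0(2), of "P a" "P b"] by (simp add: d(3,8) orth)
    show "\<exists>c. flat_coordinates M nabla c \<and> p \<in> fst c \<and>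
          (\<forall>q\<in>fst c. \<forall>u\<in>tangent_space M q. \<forall>v\<in>tangent_space M q.
             g q u v = (\<Sum>i\<in>UNIV. differential (coord c i) q u * differential (coord c i) q v)) \<and>
          (\<forall>q\<in>fst c. \<xi> q = euler_field M c q)"
    proof (intro exI[of _ d] conjI ballI d)
      fix q u v assume q: "q \<in> fst d" and "u \<in> tangent_space M q" "v \<in> tangent_space M q"
      then obtain a b where ab: "u = coord_vec M d a q" "v = coord_vec M d b q"
        using d.tangent_space_eq[OF q] by blast
      have "g q u v = d.G (snd d q) a b" by (simp add: ab d.g_eq_G[OF q])
      also have "\<dots> = d.G 0 a b" by (rule d.metric_at_origin(2)[OF d(5)]) (use q in blast)
      finally show "g q u v = (\<Sum>i\<in>UNIV. differential (coord d i) q u * differential (coord d i) q v)"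
        by (simp add: G0 inner_vec_def differential_def ab d.cvec_coord[OF q])
    next
      fix q assume q: "q \<in> fst d"
      have "l = 1" by (rule d.metric_at_origin(1)[OF d(5)]) (use q in blast)
      moreover have "q \<in> points M" using q openin_subset[OF d.openU] by blast
      ultimately show "\<xi> q = euler_field M d q" by (simp add: \<xi>\<rho> d(7)[OF q])
    qed
  next
    assume "\<xi> p \<noteq> zero_tvec"
    then have r0: "r \<noteq> 0" using \<xi>0 by simp
    \<comment> \<open>The frame is the image of the standard basis under a linear map \<open>P\<close> that sends \<open>y0\<close> to \<open>\<rho>\<close>
      at \<open>p\<close>. Then \<open>p\<close> has the coordinates \<open>y0\<close>, with a positive entry at \<open>k\<close>.\<close>
    define y0 :: "real ^ 'm" where "y0 = norm r *\<^sub>R axis k 1"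
    have "norm y0 = norm r" by (simp add: y0_def)
    then obtain P where P: "orthogonal_transformation P" "P y0 = r"
      using orthogonal_transformation_exists by metis
    have linP: "linear P" and "inj P"
      using P(1) orthogonal_transformation_linear orthogonal_transformation_inj by blast+
    then obtain Q where Q: "linear Q" "\<And>v. P (Q v) = v" "\<And>v. Q (P v) = v"
      using linear_injective_isomorphism by metis
    have \<rho>p: "\<rho> p = coord_vec M c0 (P y0) p" by (simp add: r P(2))
    have N: "open {y :: real ^ 'm. 0 < y $ k}" "y0 \<in> {y. 0 < y $ k}"
      using r0 by (auto simp: y0_def intro!: open_Collect_less continuous_intros)
    obtain d e where d: "flat_coordinates M nabla d" "p \<in> fst d" "snd d p = y0"
      "e > 0" "snd d ` fst d = ball y0 e" "ball y0 e \<subseteq> {y. 0 < y $ k}"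
      "\<And>q. q \<in> fst d \<Longrightarrow> \<rho> q = euler_field M d q" "\<And>v. coord_vec M d v p = coord_vec M c0 (P v) p"
      by (rule c0.radiant_flat_coordinates[OF flat rad c0(2) linP Q \<rho>p N])
        (rule that; (assumption | blast))
    interpret d: radiant_chart M d nabla g \<xi> \<rho> l by (rule chart[OF d(1,7)])
    have pos: "0 < y $ k" if "y \<in> snd d ` fst d" for y using that d(5,6) by blast
    note normal = d.potential_normal_form[OF pos]
    let ?\<psi> = "\<lambda>q. (snd d q $ k) powr (- d.m) * d.potential (snd d q)"
    show "\<exists>c \<psi>. flat_coordinates M nabla c \<and> p \<in> fst c \<and>
          (\<forall>q\<in>fst c. coord c k q > 0) \<and>
          (\<forall>q\<in>fst c. \<xi> q = (\<lambda>f. l * euler_field M c q f)) \<and>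
          smooth_fun M (fst c) \<psi> \<and>
          is_Hess_on M nabla (fst c) g (\<lambda>q. (coord c k q) powr (2 / l) * \<psi> q) \<and>
          (\<forall>q\<in>fst c. euler_field M c q \<psi> = 0) \<and>
          (\<forall>q\<in>fst c. (4 / l\<^sup>2 - 2 / l) * \<psi> q > 0) \<and>
          (\<forall>b :: 'm \<Rightarrow> real. \<forall>X. (\<exists>i. i \<noteq> k \<and> b i \<noteq> 0) \<longrightarrow>
             X = (\<lambda>q f. \<Sum>i\<in>UNIV - {k}. b i * coord_field M c i q f) \<longrightarrow>
             (\<forall>q\<in>fst c. X q (\<lambda>r. X r \<psi>) >
                max ((2 - 4 / l) * X q \<psi> - (4 / l\<^sup>2 - 2 / l) * \<psi> q) 0))"
    proof (intro exI[of _ d] exI[of _ ?\<psi>] conjI ballI allI impI)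
      show "coord d k q > 0" if "q \<in> fst d" for q using pos that by (simp add: coord_def)
      show "\<xi> q = (\<lambda>f. l * euler_field M d q f)" if "q \<in> fst d" for q
        using \<xi>\<rho>[of q] d(7)[OF that] that openin_subset[OF d.openU] by auto
    qed (rule d(1) d(2) normal; assumption)+
  qed
qed

end
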